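(* Let $X\subset\mathbb{R}^n$ be a locally closed set that is pure $d$-dimensional and locally definable in an o-minimal structure on $\mathbb{R}$. Let $k$ be a nonnegative integer and $\alpha\in[0,1]$. Then $X$ is $C^{k+1,\alpha}$ smooth if and only if the following three conditions hold: the Nash mapping $\eta\colon\mathcal{N}(X)\to X$ is a homeomorphism such that $\eta^{-1}$ is $C^{k,\alpha}$ smooth; $X$ is LNE at each $p\in X$; and $C_3(X,p)=C_4(X,p)$ for all $p\in X$.
   Context: $X$ is locally definable if every $x\in\overline X$ has a neighbourhood $U\subset\mathbb{R}^n$ such that $X\cap U$ is definable in the given o-minimal structure. ${\rm Reg}_1X$ is the set of points of $X$ around which $X$ is a $C^1$ submanifold of $\mathbb{R}^n$. For $p\in\overline X$: - $v\in C_3(X,p)$ iff there are $x_i\in X$, $x_i\to p$, and $t_i>0$ with $\frac{1}{t_i}(x_i-p)\to v$. - $v\in C_4(X,p)$ iff there are $x_i\in{\rm Reg}_1X$, $x_i\to p$, and $v_i\in T_{x_i}X$ with $v_i\to v$. Nash mapping: let $Gr_{\mathbb{R}}(d,n)$ be the Grassmannian of $d$-dimensional linear subspaces of $\mathbb{R}^n$. $\mathcal{N}(X)$ is the closure in $X\times Gr_{\mathbb{R}}(d,n)$ of the graph of the Gauss mapping ${\rm Reg}_1X\to Gr_{\mathbb{R}}(d,n)$, $x\mapsto T_xX$, and $\eta\colon\mathcal{N}(X)\to X$ is the restriction of the projection to the first factor. $\mathcal{N}(X)$ has the topology induced from $\mathbb{R}^n\times Gr_{\mathbb{R}}(d,n)$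 (equivalently, from the distance $\max\{\|x_1-x_2\|,\delta(L_1,L_2)\}$, where $\delta(L_1,L_2)$ is the Hausdorff distance between $L_1\cap\mathbb{S}^{n-1}$ and $L_2\cap\mathbb{S}^{n-1}$). Smoothness of maps: a map between $C^\infty$ manifolds is $C^{k,\alpha}$ smooth if it is $C^k$ with $k$-th derivatives locally $\alpha$-Hölder (for $\alpha=0$: simply $C^k$; for $\alpha=1$: locally Lipschitz $k$-th derivatives). If $M_1,M_2$ are $C^\infty$ manifolds, $A_1\subset M_1$ and $A_2\subset M_2$, a map $f\colon A_1\to A_2$ is $C^{k,\alpha}$ smooth if each $p\in A_1$ has an open neighbourhood $U\subset M_1$ and a $C^{k,\alpha}$ smooth map $F\colon U\to M_2$ with $F|_{A_1\cap U}=f|_{A_1\cap U}$. Here $\eta^{-1}\colon X\to\mathcal{N}(X)$ with $X\subset\mathbb{R}^n$ and $\mathcal{N}(X)\subset\mathbb{R}^n\times Gr_{\mathbb{R}}(d,n)$. The set $X$ is $C^{k+1,\alpha}$ smooth if it is a $C^{k+1,\alpha}$ submanifold of $\mathbb{R}^n$ (locally, up to a linear change of coordinates, the graph of a $C^{k+1,\alpha}$ map of $d$ variables). $X$ is Lipschitz normally embedded (LNE) at $p\in X$ if there are a neighbourhood $U\subset\mathbb{R}^n$ of $p$ and $C\ge 1$ such that $d_{X\cap U}(x,y)\le C\|x-y\|$ for all $x,y\in X\cap U$, where $d_{X\cap U}$ is the geodesic (inner) distance on $X\cap U$ (infimum of lengths of rectifiable paths in $X\cap U$). *)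

theory Defs
  imports "HOL-Analysis.Analysis"
begin

text \<open>
  As \<open>m\<close> varies over all natural numbers, the space \<open>\<real>\<^sup>m\<close> is modelled by the real sequences vanishing
  from index \<open>m\<close> on. The product topology on \<^typ>\<open>nat \<Rightarrow> real\<close> induces the usual topology on it.
\<close>

definition Rn :: "nat \<Rightarrow> (nat \<Rightarrow> real) set" where
  "Rn m = {x. \<forall>i\<ge>m. x i = 0}"

definition polynomial_map :: "nat \<Rightarrow> ((nat \<Rightarrow> real) \<Rightarrow> real) \<Rightarrow> bool" where
  "polynomial_map m p \<longleftrightarrow>
     (\<exists>(E :: (nat \<Rightarrow> nat) set) c. finite E \<and> (\<forall>x. p x = (\<Sum>e\<in>E. c e * (\<Prod>i<m. x i ^ e i))))"

definition algebraic_subset :: "nat \<Rightarrow> (nat \<Rightarrow> real) set \<Rightarrow> bool" where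
  "algebraic_subset m A \<longleftrightarrow>
     (\<exists>Q. finite Q \<and> (\<forall>p\<in>Q. polynomial_map m p) \<and> A = {x \<in> Rn m. \<forall>p\<in>Q. p x = 0})"

text \<open>
  An o-minimal structure on \<open>\<real>\<close> is understood to expand the real field: \<open>S m\<close> is the collection of
  definable subsets of \<open>\<real>\<^sup>m\<close>, and all algebraic sets are definable. The map \<open>x \<mapsto> x(m := 0)\<close> is the
  projection \<open>\<real>\<^sup>m\<^sup>+\<^sup>1 \<rightarrow> \<real>\<^sup>m\<close> forgetting the last coordinate.
\<close>

definition o_minimal_structure :: "(nat \<Rightarrow> (nat \<Rightarrow> real) set set) \<Rightarrow> bool" where
  "o_minimal_structure S \<longleftrightarrow>
     (\<forall>m. \<forall>A\<in>S m. A \<subseteq> Rn m) \<and>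
     (\<forall>m A. algebraic_subset m A \<longrightarrow> A \<in> S m) \<and>
     (\<forall>m. \<forall>A\<in>S m. \<forall>B\<in>S m. A \<union> B \<in> S m) \<and>
     (\<forall>m. \<forall>A\<in>S m. Rn m - A \<in> S m) \<and>
     (\<forall>m l. \<forall>A\<in>S m. \<forall>B\<in>S l.
        {x \<in> Rn (m + l). (\<lambda>i. if i < m then x i else 0) \<in> A \<and> (\<lambda>i. x (m + i)) \<in> B} \<in> S (m + l)) \<and>
     (\<forall>m. \<forall>A\<in>S (Suc m). (\<lambda>x. x(m := 0)) ` A \<in> S m) \<and>
     (\<forall>A. A \<subseteq> Rn 1 \<longrightarrow>
        (A \<in> S 1 \<longleftrightarrow>
         (\<exists>\<I>. finite \<I> \<and> (\<forall>I\<in>\<I>. is_interval I) \<and> (\<lambda>x. x 0) ` A = \<Union>\<I>)))"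

text \<open>
  The dimension of a definable set is the maximal dimension of a cell contained in it. A cell
  of type \<open>is\<close> is a subset of \<open>\<real>\<^sup>m\<close> with \<open>m = length is\<close>, of dimension \<open>sum_list is\<close>.
\<close>

definition definable_continuous ::
    "(nat \<Rightarrow> (nat \<Rightarrow> real) set set) \<Rightarrow> nat \<Rightarrow> (nat \<Rightarrow> real) set \<Rightarrow> ((nat \<Rightarrow> real) \<Rightarrow> real) \<Rightarrow> bool" where
  "definable_continuous S m C f \<longleftrightarrow> {x(m := f x) | x. x \<in> C} \<in> S (Suc m) \<and> continuous_on C f"

definition cell_bound ::
    "(nat \<Rightarrow> (nat \<Rightarrow> real) set set) \<Rightarrow> nat \<Rightarrow> (nat \<Rightarrow> real) set \<Rightarrow> ((nat \<Rightarrow> real) \<Rightarrow> ereal) \<Rightarrow> bool" where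
  "cell_bound S m C h \<longleftrightarrow>
     h = (\<lambda>_. -\<infinity>) \<or> h = (\<lambda>_. \<infinity>) \<or> (\<exists>f. definable_continuous S m C f \<and> h = (\<lambda>x. ereal (f x)))"

inductive cell :: "(nat \<Rightarrow> (nat \<Rightarrow> real) set set) \<Rightarrow> nat list \<Rightarrow> (nat \<Rightarrow> real) set \<Rightarrow> bool"
  for S where
  origin: "cell S [] {\<lambda>_. 0}"
| graph: "cell S is C \<Longrightarrow> definable_continuous S (length is) C f \<Longrightarrow>
    cell S (is @ [0]) {x(length is := f x) | x. x \<in> C}"
| band: "cell S is C \<Longrightarrow> cell_bound S (length is) C g \<Longrightarrow> cell_bound S (length is) C h \<Longrightarrow>
    (\<And>x. x \<in> C \<Longrightarrow> g x < h x) \<Longrightarrow>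
    cell S (is @ [1]) {x(length is := t) | x t. x \<in> C \<and> g x < ereal t \<and> ereal t < h x}"

definition cell_dim :: "(nat \<Rightarrow> (nat \<Rightarrow> real) set set) \<Rightarrow> nat \<Rightarrow> (nat \<Rightarrow> real) set \<Rightarrow> nat" where
  "cell_dim S m A = Max {sum_list is | is. length is = m \<and> (\<exists>C. cell S is C \<and> C \<subseteq> A)}"

text \<open>
  Subsets of \<^typ>\<open>real ^ 'n\<close> are transported along an enumeration \<open>\<sigma>\<close> of the index type. Every \<open>S m\<close>
  is invariant under permuting coordinates, so the choice of \<open>\<sigma>\<close> is immaterial.
\<close>

definition coord_seq :: "(nat \<Rightarrow> 'n) \<Rightarrow> real ^ 'n::finite \<Rightarrow> nat \<Rightarrow> real" where
  "coord_seq \<sigma> x = (\<lambda>i. if i < CARD('n) then x $ \<sigma> i else 0)"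

definition index_enum :: "nat \<Rightarrow> 'n::finite" where
  "index_enum = (SOME \<sigma>. bij_betw \<sigma> {..<CARD('n)} UNIV)"

definition definable :: "(nat \<Rightarrow> (nat \<Rightarrow> real) set set) \<Rightarrow> (real ^ 'n::finite) set \<Rightarrow> bool" where
  "definable S X \<longleftrightarrow> coord_seq index_enum ` X \<in> S CARD('n)"

definition definable_dim :: "(nat \<Rightarrow> (nat \<Rightarrow> real) set set) \<Rightarrow> (real ^ 'n::finite) set \<Rightarrow> nat" where
  "definable_dim S X = cell_dim S CARD('n) (coord_seq index_enum ` X)"

definition locally_definable :: "(nat \<Rightarrow> (nat \<Rightarrow> real) set set) \<Rightarrow> (real ^ 'n::finite) set \<Rightarrow> bool" where
  "locally_definable S X \<longleftrightarrow> (\<forall>x\<in>closure X. \<exists>U. x \<in> interior U \<and> definable S (X \<inter> U))"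

definition pure_dimensional ::
    "(nat \<Rightarrow> (nat \<Rightarrow> real) set set) \<Rightarrow> nat \<Rightarrow> (real ^ 'n::finite) set \<Rightarrow> bool" where
  "pure_dimensional S d X \<longleftrightarrow>
     (\<forall>p\<in>X. \<forall>U. p \<in> interior U \<and> definable S (X \<inter> U) \<longrightarrow> definable_dim S (X \<inter> U) = d)"

definition locally_closed_set :: "'a::topological_space set \<Rightarrow> bool" where
  "locally_closed_set X \<longleftrightarrow> (\<exists>U C. open U \<and> closed C \<and> X = U \<inter> C)"

definition locally_Hoelder ::
    "real \<Rightarrow> 'a::real_normed_vector set \<Rightarrow> ('a \<Rightarrow> 'b::real_normed_vector) \<Rightarrow> bool" where
  "locally_Hoelder \<alpha> U f \<longleftrightarrow>
     (\<forall>x\<in>U. \<exists>V c. open V \<and> x \<in> V \<and>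
        (\<forall>y\<in>V \<inter> U. \<forall>z\<in>V \<inter> U. norm (f y - f z) \<le> c * norm (y - z) powr \<alpha>))"

text \<open>
  \<open>Ck k \<alpha> U f\<close>: the map \<open>f\<close> is \<open>C\<^sup>k\<^sup>,\<^sup>\<alpha>\<close> on the open set \<open>U\<close>. The derivatives of order \<open>k\<close> enter through their
  values on all vectors, which in finite dimension is equivalent to using the multilinear maps themselves.
\<close>

primrec Ck ::
    "nat \<Rightarrow> real \<Rightarrow> 'a::euclidean_space set \<Rightarrow> ('a \<Rightarrow> 'b::euclidean_space) \<Rightarrow> bool" where
  "Ck 0 \<alpha> U f \<longleftrightarrow> (if \<alpha> = 0 then continuous_on U f else locally_Hoelder \<alpha> U f)"
| "Ck (Suc k) \<alpha> U f \<longleftrightarrow>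
     (\<exists>f'. (\<forall>x\<in>U. (f has_derivative f' x) (at x)) \<and> (\<forall>v. Ck k \<alpha> U (\<lambda>x. f' x v)))"

text \<open>
  \<open>d\<close> variables are \<open>d\<close> of the coordinates of \<^typ>\<open>real ^ 'n\<close>: those with index in \<open>I\<close>, spanning \<open>\<real>\<^sup>I\<close>.
  The open subsets of \<open>\<real>\<^sup>I\<close> are the traces \<open>W \<inter> \<real>\<^sup>I\<close> of open sets \<open>W\<close>, and the \<open>C\<^sup>k\<^sup>,\<^sup>\<alpha>\<close> maps on them are the
  restrictions of \<open>C\<^sup>k\<^sup>,\<^sup>\<alpha>\<close> maps on such a \<open>W\<close> (extend by composing with the projection onto \<open>\<real>\<^sup>I\<close>).
\<close>

definition coord_subspace :: "'n set \<Rightarrow> (real ^ 'n::finite) set" where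
  "coord_subspace I = {x. \<forall>i. i \<notin> I \<longrightarrow> x $ i = 0}"

definition submanifold_near ::
    "nat \<Rightarrow> nat \<Rightarrow> real \<Rightarrow> (real ^ 'n::finite) set \<Rightarrow> real ^ 'n \<Rightarrow> bool" where
  "submanifold_near d k \<alpha> X p \<longleftrightarrow>
     (\<exists>(L :: real ^ 'n \<Rightarrow> real ^ 'n) I U W f.
        linear L \<and> bij L \<and> card I = d \<and> open U \<and> p \<in> U \<and> open W \<and> Ck k \<alpha> W f \<and>
        f ` (W \<inter> coord_subspace I) \<subseteq> coord_subspace (- I) \<and>
        L ` (X \<inter> U) = {u + f u | u. u \<in> W \<inter> coord_subspace I})"

definition smooth_set :: "nat \<Rightarrow> nat \<Rightarrow> real \<Rightarrow> (real ^ 'n::finite) set \<Rightarrow> bool" where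
  "smooth_set d k \<alpha> X \<longleftrightarrow> (\<forall>p\<in>X. submanifold_near d k \<alpha> X p)"

definition Reg1 :: "(real ^ 'n::finite) set \<Rightarrow> (real ^ 'n) set" where
  "Reg1 X = {p \<in> X. \<exists>e. submanifold_near e 1 0 X p}"

definition tangent_space :: "(real ^ 'n::finite) set \<Rightarrow> real ^ 'n \<Rightarrow> (real ^ 'n) set" where
  "tangent_space X p =
     {v. \<exists>\<gamma> \<epsilon>. \<epsilon> > 0 \<and> \<gamma> C1_differentiable_on {-\<epsilon><..<\<epsilon>} \<and> \<gamma> ` {-\<epsilon><..<\<epsilon>} \<subseteq> X \<and>
        \<gamma> 0 = p \<and> (\<gamma> has_vector_derivative v) (at 0)}"

definition cone_C3 :: "(real ^ 'n::finite) set \<Rightarrow> real ^ 'n \<Rightarrow> (real ^ 'n) set" where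
  "cone_C3 X p =
     {v. \<exists>x t. (\<forall>i::nat. x i \<in> X \<and> t i > 0) \<and> x \<longlonglongrightarrow> p \<and>
        (\<lambda>i. (1 / t i) *\<^sub>R (x i - p)) \<longlonglongrightarrow> v}"

definition cone_C4 :: "(real ^ 'n::finite) set \<Rightarrow> real ^ 'n \<Rightarrow> (real ^ 'n) set" where
  "cone_C4 X p =
     {v. \<exists>x w. (\<forall>i::nat. x i \<in> Reg1 X \<and> w i \<in> tangent_space X (x i)) \<and> x \<longlonglongrightarrow> p \<and> w \<longlonglongrightarrow> v}"

definition Gr :: "nat \<Rightarrow> (real ^ 'n::finite) set set" where
  "Gr d = {L. subspace L \<and> dim L = d}"

text \<open>Below, the case of an empty set only arises for the single point of \<open>Gr 0\<close>.\<close>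

definition Hausdorff_dist :: "'a::metric_space set \<Rightarrow> 'a set \<Rightarrow> real" where
  "Hausdorff_dist A B =
     (if A = {} \<or> B = {} then 0 else max (SUP a\<in>A. infdist a B) (SUP b\<in>B. infdist b A))"

definition Gr_dist :: "(real ^ 'n::finite) set \<Rightarrow> (real ^ 'n) set \<Rightarrow> real" where
  "Gr_dist L1 L2 = Hausdorff_dist (L1 \<inter> sphere 0 1) (L2 \<inter> sphere 0 1)"

lemma infdist_bdd_sphere:
  fixes A B :: "'a::real_normed_vector set"
  assumes "A \<subseteq> sphere 0 1" "B \<subseteq> sphere 0 1" "B \<noteq> {}"
  shows "bdd_above ((\<lambda>a. infdist a B) ` A)"
proof -
  obtain b where b: "b \<in> B" using assms by auto
  show ?thesis
  proof (rule bdd_aboveI2)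
    fix a assume "a \<in> A"
    have "infdist a B \<le> dist a b" by (rule infdist_le[OF b])
    also have "\<dots> \<le> 2" using assms b \<open>a \<in> A\<close> 
      by (metis dist_0_norm dist_commute dist_triangle_le mem_sphere one_add_one order_refl subsetD)
    finally show "infdist a B \<le> 2" .
  qed
qed

lemma Hausdorff_dist_le_iff:
  fixes A B :: "'a::real_normed_vector set"
  assumes "A \<subseteq> sphere 0 1" "B \<subseteq> sphere 0 1" "A \<noteq> {}" "B \<noteq> {}"
  shows "Hausdorff_dist A B \<le> r \<longleftrightarrow> (\<forall>a\<in>A. infdist a B \<le> r) \<and> (\<forall>b\<in>B. infdist b A \<le> r)"
  using assms infdist_bdd_sphere[of A B] infdist_bdd_sphere[of B A]
  by (simp add: Hausdorff_dist_def cSUP_le_iff)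

lemma Hausdorff_dist_commute: "Hausdorff_dist A B = Hausdorff_dist B A"
  by (auto simp: Hausdorff_dist_def max.commute)

lemma Gr_dist_nonneg: "0 \<le> Gr_dist K L"
proof (cases "K \<inter> sphere 0 1 = {} \<or> L \<inter> sphere 0 1 = {}")
  case True then show ?thesis by (auto simp: Gr_dist_def Hausdorff_dist_def)
next
  case False
  then obtain a where "a \<in> K \<inter> sphere 0 1" by blast
  with False Hausdorff_dist_le_iff[of "K \<inter> sphere 0 1" "L \<inter> sphere 0 1" "Gr_dist K L"]
  have "infdist a (L \<inter> sphere 0 1) \<le> Gr_dist K L"
    by (simp add: Gr_dist_def)
  then show ?thesis using infdist_nonneg order_trans by blast
qed

lemma subspace_eq_span_sphere:
  fixes L :: "(real^'n::finite) set"
  assumes "subspace L" shows "span (L \<inter> sphere 0 1) = L"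
proof
  show "span (L \<inter> sphere 0 1) \<subseteq> L" using assms by (metis inf_le1 span_minimal)
  show "L \<subseteq> span (L \<inter> sphere 0 1)"
  proof
    fix x assume x: "x \<in> L"
    show "x \<in> span (L \<inter> sphere 0 1)"
    proof (cases "x = 0")
      case False
      have "x /\<^sub>R norm x \<in> L \<inter> sphere 0 1" using False x assms by (simp add: subspace_scale)
      then have "norm x *\<^sub>R (x /\<^sub>R norm x) \<in> span (L \<inter> sphere 0 1)" by (intro span_scale span_base)
      then show ?thesis using False by simp
    qed (simp add: span_zero)
  qed
qed

lemma Metric_space_Gr: "Metric_space (Gr d) (Gr_dist :: (real ^ 'n::finite) set \<Rightarrow> _)"
proof
  fix K L M :: "(real^'n) set"
  let ?S = "\<lambda>L :: (real^'n) set. L \<inter> sphere 0 1"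
  show "0 \<le> Gr_dist K L" by (rule Gr_dist_nonneg)
  show "Gr_dist K L = Gr_dist L K" by (simp add: Gr_dist_def Hausdorff_dist_commute)
  have ne: "?S N = {} \<longleftrightarrow> d = 0" if "N \<in> Gr d" for N
  proof -
    have N: "span (?S N) = N" "dim N = d" using that subspace_eq_span_sphere by (auto simp: Gr_def)
    show ?thesis
    proof
      assume "?S N = {}"
      then show "d = 0" using N by (metis dim_empty dim_span)
    next
      assume "d = 0"
      then have "N \<subseteq> {0}" using N dim_eq_0 by blast
      then show "?S N = {}" by auto
    qed
  qed
  show "Gr_dist K L = 0 \<longleftrightarrow> K = L" if KL: "K \<in> Gr d" "L \<in> Gr d"
  proof
    assume 0: "Gr_dist K L = 0"
    have "?S K = ?S L"
    proof (cases "d = 0")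
      case True then show ?thesis using ne KL by blast
    next
      case False
      have cl: "closed (?S K)" "closed (?S L)"
        using KL by (auto simp: Gr_def closed_subspace)
      have n: "?S K \<noteq> {}" "?S L \<noteq> {}" using ne KL False by blast+
      have "(\<forall>a\<in>?S K. infdist a (?S L) \<le> 0) \<and> (\<forall>a\<in>?S L. infdist a (?S K) \<le> 0)"
        using Hausdorff_dist_le_iff[of "?S K" "?S L" 0] 0 n by (simp add: Gr_dist_def)
      then have "(\<forall>a\<in>?S K. infdist a (?S L) = 0) \<and> (\<forall>a\<in>?S L. infdist a (?S K) = 0)"
        by (meson infdist_nonneg order_antisym)
      then show ?thesis using in_closed_iff_infdist_zero[OF cl(1) n(1)] in_closed_iff_infdist_zero[OF cl(2) n(2)]
        by blast
    qed
    then show "K = L" using KL subspace_eq_span_sphere unfolding Gr_def by (metis mem_Collect_eq)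
  next
    assume "K = L"
    show "Gr_dist K L = 0"
    proof (cases "?S K = {}")
      case True then show ?thesis by (auto simp: Gr_dist_def Hausdorff_dist_def)
    next
      case False
      then have "Gr_dist K L \<le> 0" using Hausdorff_dist_le_iff[of "?S K" "?S L" 0] \<open>K = L\<close>
        by (simp add: Gr_dist_def)
      then show ?thesis using Gr_dist_nonneg order_antisym by blast
    qed
  qed
  show "Gr_dist K M \<le> Gr_dist K L + Gr_dist L M" if KLM: "K \<in> Gr d" "L \<in> Gr d" "M \<in> Gr d"
  proof (cases "d = 0")
    case True then show ?thesis using ne KLM by (simp add: Gr_dist_def Hausdorff_dist_def)
  next
    case False
    have n: "?S K \<noteq> {}" "?S L \<noteq> {}" "?S M \<noteq> {}" using ne KLM False by blast+
    have *: "infdist a (?S C) \<le> Gr_dist A B + Gr_dist B C"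
      if n: "?S A \<noteq> {}" "?S B \<noteq> {}" "?S C \<noteq> {}" and B: "B \<in> Gr d" and a: "a \<in> ?S A" for A B C a
    proof -
      have "closed (?S B)" using B by (auto simp: Gr_def closed_subspace)
      then obtain b where b: "b \<in> ?S B" "infdist a (?S B) = dist a b"
        using infdist_attains_inf n by blast
      have "infdist a (?S B) \<le> Gr_dist A B"
        using Hausdorff_dist_le_iff[of "?S A" "?S B" "Gr_dist A B"] n a by (simp add: Gr_dist_def)
      moreover have "infdist b (?S C) \<le> Gr_dist B C"
        using Hausdorff_dist_le_iff[of "?S B" "?S C" "Gr_dist B C"] n b by (simp add: Gr_dist_def)
      moreover have "infdist a (?S C) \<le> infdist b (?S C) + dist a b" by (rule infdist_triangle)
      ultimately show ?thesis using b by linarith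
    qed
    have "\<forall>a\<in>?S K. infdist a (?S M) \<le> Gr_dist K L + Gr_dist L M"
      using * n KLM by blast
    moreover have "\<forall>a\<in>?S M. infdist a (?S K) \<le> Gr_dist K L + Gr_dist L M"
      using *[of M L K] n KLM by (simp add: Gr_dist_def Hausdorff_dist_commute add.commute)
    ultimately show ?thesis
      using Hausdorff_dist_le_iff[of "?S K" "?S M" "Gr_dist K L + Gr_dist L M"] n by (simp add: Gr_dist_def)
  qed
qed

definition Gr_topology :: "nat \<Rightarrow> (real ^ 'n::finite) set topology" where
  "Gr_topology d = Metric_space.mtopology (Gr d) Gr_dist"

text \<open>
  The standard chart at \<open>E\<close>: the subspaces transverse to the orthogonal complement \<open>E\<^sup>\<bottom>\<close> are the graphs
  of the linear maps \<open>E \<rightarrow> E\<^sup>\<bottom>\<close>. Such a map is represented by the matrix of its extension by \<open>0\<close> to \<open>E\<^sup>\<bottom>\<close>;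
  the image of the chart is thus a linear subspace of the space of matrices.
\<close>

definition Gr_chart_dom :: "nat \<Rightarrow> (real ^ 'n::finite) set \<Rightarrow> (real ^ 'n) set set" where
  "Gr_chart_dom d E = {L \<in> Gr d. L \<inter> E\<^sup>\<bottom> = {0}}"

definition Gr_chart :: "(real ^ 'n::finite) set \<Rightarrow> (real ^ 'n) set \<Rightarrow> real ^ 'n ^ 'n" where
  "Gr_chart E L =
     (THE A. (\<forall>w\<in>E\<^sup>\<bottom>. A *v w = 0) \<and> range ((*v) A) \<subseteq> E\<^sup>\<bottom> \<and> L = {v + A *v v | v. v \<in> E})"

lemma linear_projection_along:
  fixes L W :: "'a::euclidean_space set"
  assumes "subspace L" "subspace W" "L \<inter> W = {0}" "dim L + dim W = DIM('a)"
  obtains Q where "linear Q" "\<And>x. Q x \<in> L" "\<And>x. x - Q x \<in> W"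
proof -
  have "dim {x + y | x y. x \<in> L \<and> y \<in> W} = DIM('a)"
    using dim_sums_Int[OF assms(1,2)] assms(3,4) by simp
  then have UN: "{x + y | x y. x \<in> L \<and> y \<in> W} = UNIV"
    using subspace_sums[OF assms(1,2)] dim_eq_full[of "{x + y | x y. x \<in> L \<and> y \<in> W}"]
      span_eq_iff[of "{x + y | x y. x \<in> L \<and> y \<in> W}"] by simp
  have "\<exists>q. q \<in> L \<and> x - q \<in> W" for x
  proof -
    obtain a b where "x = a + b" "a \<in> L" "b \<in> W" using UN by blast
    then show ?thesis by (intro exI[of _ a]) simp
  qed
  then obtain Q where Q: "\<And>x. Q x \<in> L" "\<And>x. x - Q x \<in> W" by metis
  have uniq: "q = Q x" if "q \<in> L" "x - q \<in> W" for q x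
  proof -
    have "q - Q x \<in> L" using that Q assms(1) by (simp add: subspace_diff)
    moreover have "(x - Q x) - (x - q) \<in> W" by (rule subspace_diff[OF assms(2) Q(2) that(2)])
    ultimately have "q - Q x \<in> L \<inter> W" by simp
    then show ?thesis using assms(3) by simp
  qed
  have "linear Q"
  proof (rule linearI)
    fix x y show "Q (x + y) = Q x + Q y"
    proof (rule uniq[symmetric])
      show "Q x + Q y \<in> L" using Q assms(1) by (simp add: subspace_add)
      have "(x - Q x) + (y - Q y) \<in> W" by (rule subspace_add[OF assms(2) Q(2) Q(2)])
      then show "x + y - (Q x + Q y) \<in> W" by (simp add: algebra_simps)
    qed
  next
    fix c x show "Q (c *\<^sub>R x) = c *\<^sub>R Q x"
    proof (rule uniq[symmetric])
      show "c *\<^sub>R Q x \<in> L" using Q assms(1) by (simp add: subspace_scale)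
      have "c *\<^sub>R (x - Q x) \<in> W" by (rule subspace_scale[OF assms(2) Q(2)])
      then show "c *\<^sub>R x - c *\<^sub>R Q x \<in> W" by (simp add: algebra_simps)
    qed
  qed
  then show ?thesis using Q by (rule that)
qed

lemma Gr_chart_ex1:
  fixes E L :: "(real ^ 'n::finite) set"
  assumes E: "E \<in> Gr d" and L: "L \<in> Gr_chart_dom d E"
  shows "\<exists>!A. (\<forall>w\<in>E\<^sup>\<bottom>. A *v w = 0) \<and> range ((*v) A) \<subseteq> E\<^sup>\<bottom> \<and> L = {v + A *v v | v. v \<in> E}"
proof -
  have sE: "subspace E" and dE: "dim E = d" using E by (auto simp: Gr_def)
  have sL: "subspace L" and dL: "dim L = d" and tL: "L \<inter> E\<^sup>\<bottom> = {0}"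
    using L by (auto simp: Gr_chart_dom_def Gr_def)
  have sC: "subspace (E\<^sup>\<bottom>)" by (rule subspace_orthogonal_comp)
  have tE: "E \<inter> E\<^sup>\<bottom> = {0}"
    using sE sC subspace_0 by (fastforce simp: orthogonal_comp_def orthogonal_def)
  have dC: "dim E + dim (E\<^sup>\<bottom>) = DIM(real ^ 'n)"
    using dim_subspace_orthogonal_to_vectors[OF sE subspace_UNIV subset_UNIV]
    by (simp add: orthogonal_comp_def add.commute)
  obtain P where P: "linear P" "\<And>x. P x \<in> E" "\<And>x. x - P x \<in> E\<^sup>\<bottom>"
    using linear_projection_along[OF sE sC tE] dC by metis
  obtain Q where Q: "linear Q" "\<And>x. Q x \<in> L" "\<And>x. x - Q x \<in> E\<^sup>\<bottom>"
    using linear_projection_along[OF sL sC tL] dC dE dL by metis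
  have PE: "P v = v" if "v \<in> E" for v
  proof -
    have "v - P v \<in> E \<inter> E\<^sup>\<bottom>" using P that subspace_diff[OF sE, of v "P v"] by blast
    then show ?thesis using tE by simp
  qed
  have PC: "P w = 0" if "w \<in> E\<^sup>\<bottom>" for w
  proof -
    have "w - (w - P w) \<in> E\<^sup>\<bottom>" using P that subspace_diff[OF sC] by blast
    then have "P w \<in> E \<inter> E\<^sup>\<bottom>" using P by simp
    then show ?thesis using tE by simp
  qed
  have QL: "Q v = v" if "v \<in> L" for v
  proof -
    have "v - Q v \<in> L \<inter> E\<^sup>\<bottom>" using Q that subspace_diff[OF sL, of v "Q v"] by blast
    then show ?thesis using tL by simp
  qed
  have QC: "Q w = 0" if "w \<in> E\<^sup>\<bottom>" for w
  proof -
    have "w - (w - Q w) \<in> E\<^sup>\<bottom>" using Q that subspace_diff[OF sC] by blast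
    then have "Q w \<in> L \<inter> E\<^sup>\<bottom>" using Q by simp
    then show ?thesis using tL by simp
  qed
  define A where "A = matrix (\<lambda>x. Q x - P x)"
  have A: "A *v x = Q x - P x" for x
    unfolding A_def using linear_compose_sub[OF Q(1) P(1)] by (simp add: matrix_works linear_matrix_vector_mul_eq)
  show ?thesis
  proof (rule ex1I[of _ A], intro conjI ballI)
    fix w assume "w \<in> E\<^sup>\<bottom>" then show "A *v w = 0" by (simp add: A PC QC)
  next
    show "range ((*v) A) \<subseteq> E\<^sup>\<bottom>"
    proof clarify
      fix x
      have "(x - P x) - (x - Q x) \<in> E\<^sup>\<bottom>" using P Q sC subspace_diff by blast
      then show "A *v x \<in> E\<^sup>\<bottom>" by (simp add: A)
    qed
  next
    have "Q (P l) = l" if "l \<in> L" for l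
    proof -
      have "Q (l - P l) = 0" using QC P by blast
      then show ?thesis using Q(1) QL[OF that] by (simp add: linear_diff)
    qed
    then have "\<exists>v\<in>E. l = v + A *v v" if "l \<in> L" for l
      using that P by (intro bexI[of _ "P l"]) (auto simp: A PE)
    moreover have "v + A *v v \<in> L" if "v \<in> E" for v using that Q by (simp add: A PE)
    ultimately show "L = {v + A *v v | v. v \<in> E}" by blast
  next
    fix B assume B: "(\<forall>w\<in>E\<^sup>\<bottom>. B *v w = 0) \<and> range ((*v) B) \<subseteq> E\<^sup>\<bottom> \<and> L = {v + B *v v | v. v \<in> E}"
    have "B *v x = A *v x" for x
    proof -
      have "B *v x = B *v (P x)"
        using B P(3)[of x] by (metis eq_iff_diff_eq_0 matrix_vector_mult_diff_distrib)
      moreover have "Q (P x + B *v P x) = P x + B *v P x" using B P(2)[of x] by (intro QL) blast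
      moreover have "Q (B *v P x) = 0" using B by (intro QC) blast
      moreover have "Q (x - P x) = 0" using QC P by blast
      ultimately show ?thesis using Q(1) by (simp add: A linear_add linear_diff)
    qed
    then show "B = A" by (simp add: matrix_eq)
  qed
qed

definition Rn_Gr_atlas ::
    "nat \<Rightarrow> (((real ^ 'n::finite) \<times> (real ^ 'n) set) set \<times>
             ((real ^ 'n) \<times> (real ^ 'n) set \<Rightarrow> (real ^ 'n) \<times> (real ^ 'n ^ 'n))) set" where
  "Rn_Gr_atlas d = {(UNIV \<times> Gr_chart_dom d E, \<lambda>(x, L). (x, Gr_chart E L)) | E. E \<in> Gr d}"

definition Ck_into ::
    "('m set \<times> ('m \<Rightarrow> 'e::euclidean_space)) set \<Rightarrow> nat \<Rightarrow> real \<Rightarrow>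
     'a::euclidean_space set \<Rightarrow> ('a \<Rightarrow> 'm) \<Rightarrow> bool" where
  "Ck_into \<A> k \<alpha> U F \<longleftrightarrow>
     (\<forall>x\<in>U. \<exists>(V, \<phi>)\<in>\<A>. \<exists>W. open W \<and> x \<in> W \<and> W \<subseteq> U \<and> F ` W \<subseteq> V \<and> Ck k \<alpha> W (\<phi> \<circ> F))"

definition Ck_into_on ::
    "('m set \<times> ('m \<Rightarrow> 'e::euclidean_space)) set \<Rightarrow> nat \<Rightarrow> real \<Rightarrow>
     'a::euclidean_space set \<Rightarrow> ('a \<Rightarrow> 'm) \<Rightarrow> bool" where
  "Ck_into_on \<A> k \<alpha> A f \<longleftrightarrow>
     (\<forall>p\<in>A. \<exists>U F. open U \<and> p \<in> U \<and> Ck_into \<A> k \<alpha> U F \<and> (\<forall>x\<in>A \<inter> U. F x = f x))"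

definition Nash_ambient :: "nat \<Rightarrow> ((real ^ 'n::finite) \<times> (real ^ 'n) set) topology" where
  "Nash_ambient d = prod_topology euclidean (Gr_topology d)"

definition Nash_space :: "nat \<Rightarrow> (real ^ 'n::finite) set \<Rightarrow> ((real ^ 'n) \<times> (real ^ 'n) set) set" where
  "Nash_space d X =
     (subtopology (Nash_ambient d) (X \<times> Gr d)) closure_of {(x, tangent_space X x) | x. x \<in> Reg1 X}"

definition Nash_map_homeomorphism :: "nat \<Rightarrow> (real ^ 'n::finite) set \<Rightarrow> bool" where
  "Nash_map_homeomorphism d X \<longleftrightarrow>
     homeomorphic_map (subtopology (Nash_ambient d) (Nash_space d X)) (top_of_set X) fst"

definition Nash_map_inverse :: "nat \<Rightarrow> (real ^ 'n::finite) set \<Rightarrow> real ^ 'n \<Rightarrow> (real ^ 'n) \<times> (real ^ 'n) set" where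
  "Nash_map_inverse d X = inv_into (Nash_space d X) fst"

definition path_length :: "(real \<Rightarrow> 'a::metric_space) \<Rightarrow> ennreal" where
  "path_length \<gamma> =
     (SUP ts\<in>{ts. sorted ts \<and> set ts \<subseteq> {0..1}}.
        ennreal (\<Sum>i<length ts - 1. dist (\<gamma> (ts ! i)) (\<gamma> (ts ! Suc i))))"

text \<open>Paths that are not rectifiable have length \<open>\<infinity>\<close>, so they do not affect the infimum.\<close>

definition inner_dist :: "'a::metric_space set \<Rightarrow> 'a \<Rightarrow> 'a \<Rightarrow> ennreal" where
  "inner_dist Y x y =
     (INF \<gamma>\<in>{\<gamma>. path \<gamma> \<and> path_image \<gamma> \<subseteq> Y \<and> pathstart \<gamma> = x \<and> pathfinish \<gamma> = y}. path_length \<gamma>)"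

definition LNE_at :: "'a::real_normed_vector set \<Rightarrow> 'a \<Rightarrow> bool" where
  "LNE_at X p \<longleftrightarrow>
     (\<exists>U C. p \<in> interior U \<and> C \<ge> 1 \<and>
        (\<forall>x\<in>X \<inter> U. \<forall>y\<in>X \<inter> U. inner_dist (X \<inter> U) x y \<le> ennreal (C * norm (x - y))))"

end

theory Submission
  imports Defs
begin

text \<open>
  Suppose that \<open>X\<close> is smooth. In the definition of a submanifold the linear coordinates are arbitrary, but
  near each point \<open>X\<close> is also the graph of a map \<open>h\<close> over an orthogonal projection, namely the one along
  the given vertical space. The chart of the Grassmannian at the range of that projection then sends the tangent space
  at \<open>x\<close> to the matrix of the derivative of \<open>h\<close>, so the Nash inverse is one derivative less smooth than \<open>X\<close>.

  Conversely, surjectivity of \<open>\<eta>\<close> forces all points of \<open>Reg1 X\<close> to have dimension \<open>d\<close>, and injectivity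
  gives \<open>C\<^sub>4(X,q)\<close>, hence \<open>C\<^sub>3(X,q)\<close>, as the single limit of tangent spaces at \<open>q\<close>. In a chart it
  is the graph of a linear map \<open>A(q)\<close> depending smoothly on \<open>q\<close>. By the LNE condition, the projection of the
  chart is bi-Lipschitz on \<open>X\<close> near \<open>p\<close>; by a nearest point argument its image is a neighbourhood. So \<open>X\<close>
  is locally the graph of a map \<open>h\<close> whose derivative is \<open>A\<close> evaluated along the graph, and the smoothness of \<open>h\<close>
  follows by bootstrapping.
\<close>

section \<open>Calculus of maps of class \<open>C\<^sup>k\<^sup>,\<^sup>\<alpha>\<close>\<close>

text \<open>The cones give information only point by point: secants of \<open>X\<close> at
  \<open>q\<close> are almost tangent, but within a radius that depends on \<open>q\<close>. A
  bi-Lipschitz projection needs a bound for all pairs of nearby points at once. LNE closes this gap: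
  two points are joined by a path in \<open>X\<close> of length comparable to their distance, and
  the pointwise estimates are added up along it, compactness of the parameter interval replacing
  uniformity in \<open>q\<close>. The charts of the Grassmannian pair \<open>E\<close> with its
  orthogonal complement. This is why graphs are taken over orthogonal projections \<open>P\<close>,
  with functions \<open>h\<close> that live on open subsets of the whole space and are constant
  along the fibres of \<open>P\<close>: the derivative of such an \<open>h\<close> is literally the
  linear map whose matrix is the chart coordinate of the tangent space. The bootstrapping starts
  from \<open>h' = A \<circ> (P + h)\<close>, where \<open>A\<close> may be only Hoelder. For the
  composition to keep the exponent, \<open>h\<close> has to be known to be Lipschitz
  beforehand.\<close>

lemma locally_HoelderE:
  assumes "locally_Hoelder \<alpha> U f" "x \<in> U"
  obtains V c where "open V" "x \<in> V"
    "\<forall>y\<in>V \<inter> U. \<forall>z\<in>V \<inter> U. norm (f y - f z) \<le> c * norm (y - z) powr \<alpha>"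
  using assms unfolding locally_Hoelder_def by meson

lemma locally_Hoelder_subset:
  assumes "locally_Hoelder \<alpha> U f" "V \<subseteq> U"
  shows "locally_Hoelder \<alpha> V f"
  unfolding locally_Hoelder_def
proof
  fix x assume "x \<in> V"
  with assms obtain N c where "open N" "x \<in> N"
    "\<forall>y\<in>N \<inter> U. \<forall>z\<in>N \<inter> U. norm (f y - f z) \<le> c * norm (y - z) powr \<alpha>"
    unfolding locally_Hoelder_def by (meson subsetD)
  with assms(2) show "\<exists>N c. open N \<and> x \<in> N \<and>
      (\<forall>y\<in>N \<inter> V. \<forall>z\<in>N \<inter> V. norm (f y - f z) \<le> c * norm (y - z) powr \<alpha>)"
    by (meson IntE IntI subsetD)
qed

lemma Ck_subset:
  assumes "Ck k \<alpha> U f" "V \<subseteq> U"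
  shows "Ck k \<alpha> V f"
  using assms
proof (induction k arbitrary: f)
  case 0 then show ?case
    by (auto split: if_splits intro: locally_Hoelder_subset continuous_on_subset)
next
  case (Suc k)
  then obtain f' where "\<forall>x\<in>U. (f has_derivative f' x) (at x)" "\<forall>v. Ck k \<alpha> U (\<lambda>x. f' x v)"
    by auto
  with Suc.IH Suc.prems(2) show ?case by (simp, intro exI[of _ f']) blast
qed

lemma locally_Hoelder_cong:
  assumes "locally_Hoelder \<alpha> U f" "\<And>x. x \<in> U \<Longrightarrow> f x = g x"
  shows "locally_Hoelder \<alpha> U g"
  using assms unfolding locally_Hoelder_def by (metis IntD2)

lemma Ck_cong:
  assumes "Ck k \<alpha> U f" "open U" "\<And>x. x \<in> U \<Longrightarrow> f x = g x"
  shows "Ck k \<alpha> U g"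
proof (cases k)
  case 0 then show ?thesis
    using assms locally_Hoelder_cong[of \<alpha> U f g] continuous_on_cong[of U U f g]
    by (auto split: if_splits)
next
  case (Suc j)
  then obtain f' where "\<forall>x\<in>U. (f has_derivative f' x) (at x)" "\<forall>v. Ck j \<alpha> U (\<lambda>x. f' x v)"
    using assms(1) by auto
  moreover have "(g has_derivative f' x) (at x)" if x: "x \<in> U" for x
    using calculation(1) that assms(2,3) by (meson has_derivative_transform_within_open)
  ultimately show ?thesis using Suc by auto
qed

lemma locally_Hoelder_continuous_on:
  assumes "locally_Hoelder \<alpha> U f" "0 < \<alpha>"
  shows "continuous_on U f"
  unfolding continuous_on_def
proof
  fix x assume x: "x \<in> U"
  with assms obtain N c where N: "open N" "x \<in> N"
    "\<forall>y\<in>N \<inter> U. \<forall>z\<in>N \<inter> U. norm (f y - f z) \<le> c * norm (y - z) powr \<alpha>"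
    unfolding locally_Hoelder_def by meson
  have lim: "((\<lambda>y. norm (y - x) powr \<alpha>) \<longlongrightarrow> 0) (at x within U)"
    by (intro tendsto_eq_intros tendsto_zero_powrI) (use \<open>0 < \<alpha>\<close> in auto)
  have ev: "\<forall>\<^sub>F y in at x within U. norm (f y - f x) \<le> c * norm (y - x) powr \<alpha>"
    unfolding eventually_at_topological using N x by blast
  have "((\<lambda>y. f y - f x) \<longlongrightarrow> 0) (at x within U)"
    by (rule Lim_null_comparison[OF ev]) (use tendsto_mult_right_zero[OF lim] in simp)
  then show "(f \<longlongrightarrow> f x) (at x within U)" using Lim_null by blast
qed

lemma Ck_continuous_on:
  assumes "Ck k \<alpha> U f" "0 \<le> \<alpha>"
  shows "continuous_on U f"
proof (cases k)
  case 0 with assms show ?thesis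
    by (auto split: if_splits intro: locally_Hoelder_continuous_on)
next
  case (Suc j)
  then obtain f' where "\<forall>x\<in>U. (f has_derivative f' x) (at x)" using assms by auto
  then show ?thesis
    by (meson continuous_at_imp_continuous_on has_derivative_continuous)
qed

text \<open>\<open>Ck 0 1\<close> serves throughout as the notion of a locally Lipschitz map. For
  the estimates, the neighbourhood is shrunk to a ball inside the domain and the constant is made
  nonnegative.\<close>

lemma Ck_0_1_D:
  assumes "Ck 0 1 U f" "x \<in> U" "open U"
  obtains r c where "0 < r" "0 \<le> c" "ball x r \<subseteq> U"
    "\<And>y z. y \<in> ball x r \<Longrightarrow> z \<in> ball x r \<Longrightarrow> norm (f y - f z) \<le> c * norm (y - z)"
proof -
  have "locally_Hoelder 1 U f" using assms(1) by simp
  then obtain N c where N: "open N" "x \<in> N"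
    "\<forall>y\<in>N \<inter> U. \<forall>z\<in>N \<inter> U. norm (f y - f z) \<le> c * norm (y - z)"
    using assms(2) unfolding locally_Hoelder_def by simp meson
  obtain r where r: "0 < r" "ball x r \<subseteq> N \<inter> U"
    using N assms open_contains_ball[of "N \<inter> U"] by (metis IntI open_Int)
  show ?thesis
  proof (rule that[of r "max c 0"])
    fix y z assume "y \<in> ball x r" "z \<in> ball x r"
    then have "norm (f y - f z) \<le> c * norm (y - z)" using N r by blast
    also have "\<dots> \<le> max c 0 * norm (y - z)" by (intro mult_right_mono) auto
    finally show "norm (f y - f z) \<le> max c 0 * norm (y - z)" .
  qed (use r in auto)
qed

lemma Ck_0_1_I:
  assumes "\<And>x. x \<in> U \<Longrightarrow> \<exists>r>0. \<exists>c. \<forall>y\<in>ball x r \<inter> U. \<forall>z\<in>ball x r \<inter> U. norm (f y - f z) \<le> c * norm (y - z)"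
  shows "Ck 0 1 U f"
  unfolding Ck.simps locally_Hoelder_def using assms
  by simp (metis open_ball centre_in_ball)

text \<open>\<open>Ck\<close> sees a derivative only through its values at fixed vectors. This
  expansion turns such values into statements about the whole linear map, or about a vector that
  varies too.\<close>

lemma linear_eq_sum_Basis:
  fixes T :: "'a::euclidean_space \<Rightarrow> 'b::real_vector"
  assumes "linear T"
  shows "T v = (\<Sum>b\<in>Basis. (v \<bullet> b) *\<^sub>R T b)"
proof -
  have "T v = T (\<Sum>b\<in>Basis. (v \<bullet> b) *\<^sub>R b)" by (simp add: euclidean_representation)
  also have "\<dots> = (\<Sum>b\<in>Basis. (v \<bullet> b) *\<^sub>R T b)"
    by (simp add: linear_sum[OF assms] linear_scale[OF assms])
  finally show ?thesis .
qed

text \<open>The values of the derivative at basis vectors are continuous, hence bounded on a compact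
  ball; their sum bounds the operator norm, and the mean value inequality applies on the convex
  ball.\<close>

lemma Ck_Lipschitz:
  fixes f :: "'a::euclidean_space \<Rightarrow> 'b::euclidean_space"
  assumes "Ck (Suc k) \<alpha> U f" "open U" "0 \<le> \<alpha>"
  shows "Ck 0 1 U f"
proof (rule Ck_0_1_I)
  fix x assume "x \<in> U"
  obtain f' where f': "\<And>x. x \<in> U \<Longrightarrow> (f has_derivative f' x) (at x)" "\<And>v. Ck k \<alpha> U (\<lambda>x. f' x v)"
    using assms(1) by auto
  obtain r where r: "0 < r" "cball x r \<subseteq> U" using \<open>x \<in> U\<close> assms(2) open_contains_cball by blast
  have "\<exists>B. \<forall>y\<in>cball x r. norm (f' y b) \<le> B" for b
  proof -
    have "continuous_on (cball x r) (\<lambda>y. f' y b)"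
      using Ck_continuous_on[OF f'(2) assms(3)] r continuous_on_subset by blast
    then have "bounded ((\<lambda>y. f' y b) ` cball x r)"
      by (intro compact_imp_bounded compact_continuous_image compact_cball)
    then show ?thesis by (auto simp: bounded_iff)
  qed
  then obtain B where B: "\<And>b y. y \<in> cball x r \<Longrightarrow> norm (f' y b) \<le> B b" by metis
  have on: "onorm (f' y) \<le> (\<Sum>b\<in>Basis. B b)" if y: "y \<in> cball x r" for y
  proof -
    have lin: "linear (f' y)" using f'(1) y r has_derivative_linear by blast
    show ?thesis
    proof (rule onorm_le)
      fix v
      have "f' y v = (\<Sum>b\<in>Basis. (v \<bullet> b) *\<^sub>R f' y b)"
        by (rule linear_eq_sum_Basis[OF lin])
      also have "norm \<dots> \<le> (\<Sum>b\<in>Basis. \<bar>v \<bullet> b\<bar> * norm (f' y b))"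
        by (rule order_trans[OF norm_sum]) simp
      also have "\<dots> \<le> (\<Sum>b\<in>Basis. norm v * B b)"
        by (intro sum_mono mult_mono) (use B y in \<open>auto simp: Basis_le_norm\<close>)
      finally show "norm (f' y v) \<le> (\<Sum>b\<in>Basis. B b) * norm v"
        by (simp add: sum_distrib_left mult.commute)
    qed
  qed
  have "norm (f y - f z) \<le> (\<Sum>b\<in>Basis. B b) * norm (y - z)"
    if "y \<in> cball x r" "z \<in> cball x r" for y z
  proof (rule differentiable_bound[OF convex_cball[of x r], where f' = f'])
    fix w assume "w \<in> cball x r"
    then show "(f has_derivative f' w) (at w within cball x r)" "onorm (f' w) \<le> (\<Sum>b\<in>Basis. B b)"
      using f'(1) r on has_derivative_at_withinI by blast+
  qed (use that in auto)
  then show "\<exists>r>0. \<exists>c. \<forall>y\<in>ball x r \<inter> U. \<forall>z\<in>ball x r \<inter> U. norm (f y - f z) \<le> c * norm (y - z)"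
    using r by (intro exI[of _ r] conjI exI[of _ "\<Sum>b\<in>Basis. B b"]) auto
qed

lemma Lipschitz_imp_Ck_0:
  assumes "Ck 0 1 U f" "open U" "0 \<le> \<alpha>" "\<alpha> \<le> 1"
  shows "Ck 0 \<alpha> U f"
proof (cases "\<alpha> = 0")
  case True
  then show ?thesis using Ck_continuous_on[OF assms(1)] by simp
next
  case False
  have "\<exists>V c. open V \<and> x \<in> V \<and>
        (\<forall>y\<in>V \<inter> U. \<forall>z\<in>V \<inter> U. norm (f y - f z) \<le> c * norm (y - z) powr \<alpha>)" if x: "x \<in> U" for x
  proof -
    obtain r c where r: "0 < r" "0 \<le> c" "ball x r \<subseteq> U"
      "\<And>y z. y \<in> ball x r \<Longrightarrow> z \<in> ball x r \<Longrightarrow> norm (f y - f z) \<le> c * norm (y - z)"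
      using Ck_0_1_D[OF assms(1) x assms(2)] by metis
    \<comment> \<open>Radius at most \<open>1/2\<close> puts any two points of the ball at distance
      at most \<open>1\<close>, where \<open>t \<le> t powr \<alpha>\<close> because
      \<open>\<alpha> \<le> 1\<close>.\<close>
    have est: "norm (f y - f z) \<le> c * norm (y - z) powr \<alpha>"
      if "y \<in> ball x (min r (1/2))" "z \<in> ball x (min r (1/2))" for y z
    proof -
      have "dist y z \<le> dist x y + dist x z" by (metis dist_commute dist_triangle)
      then have le1: "norm (y - z) \<le> 1" using that by (simp add: dist_norm)
      have "norm (f y - f z) \<le> c * norm (y - z)" using r that by auto
      also have "\<dots> \<le> c * norm (y - z) powr \<alpha>"
      proof (intro mult_left_mono r)
        show "norm (y - z) \<le> norm (y - z) powr \<alpha>"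
          using powr_mono'[of \<alpha> 1 "norm (y - z)"] le1 assms(4) by simp
      qed
      finally show ?thesis .
    qed
    show ?thesis
      by (intro exI[of _ "ball x (min r (1/2))"] exI[of _ c] conjI ballI est) (use r(1) in auto)
  qed
  then show ?thesis using False by (simp add: locally_Hoelder_def)
qed

text \<open>The exponent belongs to the top order only, so the claim passes to the derivatives until
  order \<open>0\<close> is reached; there the map is Lipschitz and hence
  \<open>\<alpha>\<close>-Hoelder.\<close>

lemma Ck_Suc_imp_Ck:
  fixes f :: "'a::euclidean_space \<Rightarrow> 'b::euclidean_space"
  assumes "Ck (Suc k) \<alpha> U f" "open U" "0 \<le> \<alpha>" "\<alpha> \<le> 1"
  shows "Ck k \<alpha> U f"
  using assms(1)
proof (induction k arbitrary: f)
  case 0 show ?case by (rule Lipschitz_imp_Ck_0[OF Ck_Lipschitz[OF 0 assms(2,3)] assms(2-4)])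
next
  case (Suc k)
  then obtain f' where f': "\<forall>x\<in>U. (f has_derivative f' x) (at x)" "\<And>v. Ck (Suc k) \<alpha> U (\<lambda>x. f' x v)"
    by auto
  then show ?case using Suc.IH by auto
qed

lemma Ck_mono:
  fixes f :: "'a::euclidean_space \<Rightarrow> 'b::euclidean_space"
  assumes "Ck k \<alpha> U f" "j \<le> k" "open U" "0 \<le> \<alpha>" "\<alpha> \<le> 1"
  shows "Ck j \<alpha> U f"
  using assms(2,1) by (induction rule: inc_induct) (use assms Ck_Suc_imp_Ck in blast)+

section \<open>Closure properties: sums, products and compositions\<close>

lemma Ck_const: "Ck k \<alpha> U (\<lambda>_. c)"
proof (induction k arbitrary: c)
  case 0
  have "locally_Hoelder \<alpha> U (\<lambda>_. c)"
    unfolding locally_Hoelder_def by (intro ballI exI[of _ UNIV] exI[of _ 0]) simp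
  then show ?case by simp
next
  case (Suc k) then show ?case by (auto intro!: exI[of _ "\<lambda>_ _. 0"])
qed

lemma Ck_bounded_linear_compose:
  assumes "bounded_linear T" "Ck k \<alpha> U f"
  shows "Ck k \<alpha> U (\<lambda>x. T (f x))"
  using assms(2)
proof (induction k arbitrary: f)
  case 0
  show ?case
  proof (cases "\<alpha> = 0")
    case True then show ?thesis using 0 assms(1) by (simp add: bounded_linear.continuous_on)
  next
    case False
    obtain K where K: "\<And>x. norm (T x) \<le> norm x * K" "0 < K"
      using bounded_linear.pos_bounded[OF assms(1)] by blast
    have "\<exists>V c. open V \<and> x \<in> V \<and>
         (\<forall>y\<in>V \<inter> U. \<forall>z\<in>V \<inter> U. norm (T (f y) - T (f z)) \<le> c * norm (y - z) powr \<alpha>)" if x: "x \<in> U" for x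
    proof -
      obtain V c where V: "open V" "x \<in> V"
         "\<forall>y\<in>V \<inter> U. \<forall>z\<in>V \<inter> U. norm (f y - f z) \<le> c * norm (y - z) powr \<alpha>"
        using 0 False x unfolding Ck.simps locally_Hoelder_def by simp meson
      show ?thesis
      proof (intro exI conjI ballI)
        fix y z assume yz: "y \<in> V \<inter> U" "z \<in> V \<inter> U"
        have "norm (T (f y) - T (f z)) = norm (T (f y - f z))"
          using assms(1) by (simp add: bounded_linear.linear linear_diff)
        also have "\<dots> \<le> (c * norm (y - z) powr \<alpha>) * K"
          using K(1)[of "f y - f z"] K(2) V(3) yz by (meson mult_right_mono order_trans less_imp_le)
        finally show "norm (T (f y) - T (f z)) \<le> (c * K) * norm (y - z) powr \<alpha>" by (simp add: ac_simps)
      qed (use V in auto)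
    qed
    then show ?thesis using False by (simp add: locally_Hoelder_def)
  qed
next
  case (Suc k)
  then obtain f' where f': "\<forall>x\<in>U. (f has_derivative f' x) (at x)" "\<And>v. Ck k \<alpha> U (\<lambda>x. f' x v)"
    by auto
  then show ?case
    using Suc.IH bounded_linear.has_derivative[OF assms(1)] by (fastforce intro!: exI[of _ "\<lambda>x v. T (f' x v)"])
qed

lemma Ck_add:
  assumes "Ck k \<alpha> U f" "Ck k \<alpha> U g"
  shows "Ck k \<alpha> U (\<lambda>x. f x + g x)"
  using assms
proof (induction k arbitrary: f g)
  case 0
  show ?case
  proof (cases "\<alpha> = 0")
    case True then show ?thesis using 0 by (simp add: continuous_on_add)
  next
    case False
    have "\<exists>N c. open N \<and> x \<in> N \<and>
        (\<forall>y\<in>N \<inter> U. \<forall>z\<in>N \<inter> U. norm (f y + g y - (f z + g z)) \<le> c * norm (y - z) powr \<alpha>)" if x: "x \<in> U" for x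
    proof -
      have H: "locally_Hoelder \<alpha> U f" "locally_Hoelder \<alpha> U g" using 0 False by simp_all
      obtain V c where V: "open V" "x \<in> V"
         "\<forall>y\<in>V \<inter> U. \<forall>z\<in>V \<inter> U. norm (f y - f z) \<le> c * norm (y - z) powr \<alpha>"
        by (rule locally_HoelderE[OF H(1) x])
      obtain V' c' where V': "open V'" "x \<in> V'"
         "\<forall>y\<in>V' \<inter> U. \<forall>z\<in>V' \<inter> U. norm (g y - g z) \<le> c' * norm (y - z) powr \<alpha>"
        by (rule locally_HoelderE[OF H(2) x])
      note V = V V'
      show ?thesis
      proof (intro exI conjI ballI)
        fix y z assume "y \<in> V \<inter> V' \<inter> U" "z \<in> V \<inter> V' \<inter> U"
        then have "norm (f y - f z) \<le> c * norm (y - z) powr \<alpha>" "norm (g y - g z) \<le> c' * norm (y - z) powr \<alpha>"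
          using V by auto
        then show "norm (f y + g y - (f z + g z)) \<le> (c + c') * norm (y - z) powr \<alpha>"
          using norm_triangle_ineq[of "f y - f z" "g y - g z"] by (simp add: algebra_simps)
      qed (use V in auto)
    qed
    then show ?thesis using False by (simp add: locally_Hoelder_def)
  qed
next
  case (Suc k)
  from Suc.prems obtain f' g' where
    "\<forall>x\<in>U. (f has_derivative f' x) (at x)" "\<And>v. Ck k \<alpha> U (\<lambda>x. f' x v)"
    "\<forall>x\<in>U. (g has_derivative g' x) (at x)" "\<And>v. Ck k \<alpha> U (\<lambda>x. g' x v)" by (auto simp: Ck.simps(2))
  then show ?case
    by (auto intro!: exI[of _ "\<lambda>x v. f' x v + g' x v"] has_derivative_add Suc.IH)
qed

lemma Ck_sum:
  assumes "\<And>i. i \<in> I \<Longrightarrow> Ck k \<alpha> U (f i)"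
  shows "Ck k \<alpha> U (\<lambda>x. \<Sum>i\<in>I. f i x)"
  using assms
  by (induction I rule: infinite_finite_induct) (auto intro!: Ck_const Ck_add)

text \<open>The derivative is constant, so order \<open>Suc k\<close> is immediate for every
  \<open>k\<close>; lowering the order covers \<open>k = 0\<close> as well.\<close>

lemma Ck_linear:
  fixes T :: "'a::euclidean_space \<Rightarrow> 'b::euclidean_space"
  assumes "bounded_linear T" "open U" "0 \<le> \<alpha>" "\<alpha> \<le> 1"
  shows "Ck k \<alpha> U T"
proof -
  have "Ck (Suc k) \<alpha> U T"
    using assms(1) bounded_linear_imp_has_derivative
    by (auto intro!: exI[of _ "\<lambda>_. T"] Ck_const)
  then show ?thesis using Ck_Suc_imp_Ck assms by blast
qed

lemma Ck_bilinear:
  fixes f :: "'a::euclidean_space \<Rightarrow> 'b::euclidean_space" and g :: "'a \<Rightarrow> 'c::euclidean_space"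
    and prod :: "'b \<Rightarrow> 'c \<Rightarrow> 'd::euclidean_space"
  assumes prod: "bounded_bilinear prod"
    and "Ck k \<alpha> U f" "Ck k \<alpha> U g" "open U" and \<alpha>: "0 \<le> \<alpha>" "\<alpha> \<le> 1"
  shows "Ck k \<alpha> U (\<lambda>x. prod (f x) (g x))"
  using assms(2,3)
proof (induction k arbitrary: f g)
  case 0
  have cont: "continuous_on U f" "continuous_on U g" using 0 \<alpha> Ck_continuous_on by blast+
  show ?case
  proof (cases "\<alpha> = 0")
    case True then show ?thesis using cont by (simp add: bounded_bilinear.continuous_on[OF prod])
  next
    case False
    obtain K where K: "\<And>a b. norm (prod a b) \<le> norm a * norm b * K" "0 < K"
      using bounded_bilinear.pos_bounded[OF prod] by blast
    have "\<exists>N c. open N \<and> x \<in> N \<and>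
        (\<forall>y\<in>N \<inter> U. \<forall>z\<in>N \<inter> U. norm (prod (f y) (g y) - prod (f z) (g z)) \<le> c * norm (y - z) powr \<alpha>)"
      if x: "x \<in> U" for x
    proof -
      have H: "locally_Hoelder \<alpha> U f" "locally_Hoelder \<alpha> U g" using 0 False by simp_all
      obtain V c where V: "open V" "x \<in> V"
         "\<forall>y\<in>V \<inter> U. \<forall>z\<in>V \<inter> U. norm (f y - f z) \<le> c * norm (y - z) powr \<alpha>"
        by (rule locally_HoelderE[OF H(1) x])
      obtain V' c' where V': "open V'" "x \<in> V'"
         "\<forall>y\<in>V' \<inter> U. \<forall>z\<in>V' \<inter> U. norm (g y - g z) \<le> c' * norm (y - z) powr \<alpha>"
        by (rule locally_HoelderE[OF H(2) x])
      note V = V V'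
      \<comment> \<open>The Hoelder constant of a product involves the sizes of the factors, which
        are bounded on a compact ball.\<close>
      obtain r where r: "0 < r" "cball x r \<subseteq> U" using x assms(4) open_contains_cball by blast
      have "bounded (f ` cball x r)" "bounded (g ` cball x r)"
        using cont r by (auto intro!: compact_imp_bounded compact_continuous_image intro: continuous_on_subset)
      then obtain M M' where M: "\<And>y. y \<in> cball x r \<Longrightarrow> norm (f y) \<le> M" "0 < M"
         "\<And>y. y \<in> cball x r \<Longrightarrow> norm (g y) \<le> M'" "0 < M'"
        unfolding bounded_pos by (metis imageI)
      show ?thesis
      proof (intro exI conjI ballI)
        fix y z assume yz: "y \<in> V \<inter> V' \<inter> ball x r \<inter> U" "z \<in> V \<inter> V' \<inter> ball x r \<inter> U"
        then have b: "norm (f y - f z) \<le> c * norm (y - z) powr \<alpha>" "norm (g y - g z) \<le> c' * norm (y - z) powr \<alpha>"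
          using V by auto
        have "prod (f y) (g y) - prod (f z) (g z) = prod (f y) (g y - g z) + prod (f y - f z) (g z)"
          using bounded_bilinear.diff_left[OF prod] bounded_bilinear.diff_right[OF prod] by simp
        also have "norm \<dots> \<le> norm (f y) * norm (g y - g z) * K + norm (f y - f z) * norm (g z) * K"
          by (rule order_trans[OF norm_triangle_ineq]) (intro add_mono K)
        also have "\<dots> \<le> M * (c' * norm (y - z) powr \<alpha>) * K + (c * norm (y - z) powr \<alpha>) * M' * K"
        proof (intro add_mono mult_right_mono mult_mono)
          show "norm (f y) \<le> M" "norm (g z) \<le> M'" using M(1)[of y] M(3)[of z] yz by auto
          show "0 \<le> c * norm (y - z) powr \<alpha>" using b(1) norm_ge_zero order_trans by blast
        qed (use b M K(2) in auto)
        finally show "norm (prod (f y) (g y) - prod (f z) (g z))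
          \<le> (M * c' * K + c * M' * K) * norm (y - z) powr \<alpha>" by (simp add: algebra_simps)
      qed (use V r in auto)
    qed
    then show ?thesis using False by (simp add: locally_Hoelder_def)
  qed
next
  case (Suc k)
  have low: "Ck k \<alpha> U f" "Ck k \<alpha> U g" using Suc.prems Ck_Suc_imp_Ck assms(4) \<alpha> by blast+
  from Suc.prems obtain f' g' where
    "\<forall>x\<in>U. (f has_derivative f' x) (at x)" "\<And>v. Ck k \<alpha> U (\<lambda>x. f' x v)"
    "\<forall>x\<in>U. (g has_derivative g' x) (at x)" "\<And>v. Ck k \<alpha> U (\<lambda>x. g' x v)" by (auto simp: Ck.simps(2))
  then show ?case using low
    by (auto intro!: exI[of _ "\<lambda>x v. prod (f x) (g' x v) + prod (f' x v) (g x)"]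
        bounded_bilinear.FDERIV[OF prod] Ck_add Suc.IH)
qed

text \<open>For \<open>k = 0\<close> the inner function must be Lipschitz, since a composition of Hoelder maps loses exponent.\<close>

lemma Ck_compose:
  fixes f :: "'a::euclidean_space \<Rightarrow> 'b::euclidean_space" and g :: "'b \<Rightarrow> 'c::euclidean_space"
  assumes "Ck k \<alpha> V g" "Ck k \<alpha> U f" and Lip: "Ck 0 1 U f" and sub: "f ` U \<subseteq> V"
    and op: "open U" "open V" and \<alpha>: "0 \<le> \<alpha>" "\<alpha> \<le> 1"
  shows "Ck k \<alpha> U (\<lambda>x. g (f x))"
  using assms(1,2)
proof (induction k arbitrary: g)
  case 0
  have cont: "continuous_on U f" by (rule Ck_continuous_on[OF Lip]) simp
  show ?case
  proof (cases "\<alpha> = 0")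
    case True then show ?thesis using 0 cont sub by (simp add: continuous_on_compose2)
  next
    case False
    have "\<exists>N c. open N \<and> x \<in> N \<and>
        (\<forall>y\<in>N \<inter> U. \<forall>z\<in>N \<inter> U. norm (g (f y) - g (f z)) \<le> c * norm (y - z) powr \<alpha>)"
      if x: "x \<in> U" for x
    proof -
      obtain N c where N: "open N" "f x \<in> N"
         "\<forall>y\<in>N \<inter> V. \<forall>z\<in>N \<inter> V. norm (g y - g z) \<le> c * norm (y - z) powr \<alpha>"
      proof -
        have "locally_Hoelder \<alpha> V g" using 0 False by simp
        moreover have "f x \<in> V" using x sub by blast
        ultimately show ?thesis using that unfolding locally_Hoelder_def by meson
      qed
      obtain r K where r: "0 < r" "0 \<le> K" "ball x r \<subseteq> U"
        "\<And>y z. y \<in> ball x r \<Longrightarrow> z \<in> ball x r \<Longrightarrow> norm (f y - f z) \<le> K * norm (y - z)"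
        using Ck_0_1_D[OF Lip x op(1)] by metis
      have "open (U \<inter> f -` N)" using cont N(1) op by (simp add: continuous_on_open_vimage Int_commute)
      show ?thesis
      proof (intro exI conjI ballI)
        fix y z assume yz: "y \<in> (U \<inter> f -` N) \<inter> ball x r \<inter> U" "z \<in> (U \<inter> f -` N) \<inter> ball x r \<inter> U"
        then have "norm (g (f y) - g (f z)) \<le> c * norm (f y - f z) powr \<alpha>" using N sub by blast
        also have "\<dots> \<le> max c 0 * norm (f y - f z) powr \<alpha>" by (intro mult_right_mono) auto
        also have "\<dots> \<le> max c 0 * (K * norm (y - z)) powr \<alpha>"
          by (intro mult_left_mono powr_mono2) (use r yz \<alpha> in auto)
        finally show "norm (g (f y) - g (f z)) \<le> (max c 0 * K powr \<alpha>) * norm (y - z) powr \<alpha>"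
          using r(2) by (simp add: powr_mult ac_simps)
      next
        show "open (U \<inter> f -` N \<inter> ball x r)" using \<open>open (U \<inter> f -` N)\<close> by blast
      qed (use N r that in auto)
    qed
    then show ?thesis using False by (simp add: locally_Hoelder_def)
  qed
next
  case (Suc k)
  have low: "Ck k \<alpha> U f" using Suc.prems(2) Ck_Suc_imp_Ck op(1) \<alpha> by blast
  obtain f' where f': "\<And>x. x \<in> U \<Longrightarrow> (f has_derivative f' x) (at x)" "\<And>v. Ck k \<alpha> U (\<lambda>x. f' x v)"
    using Suc.prems(2) by auto
  obtain g' where g': "\<And>x. x \<in> V \<Longrightarrow> (g has_derivative g' x) (at x)" "\<And>v. Ck k \<alpha> V (\<lambda>x. g' x v)"
    using Suc.prems(1) by auto
  note d = f' g'
  have der: "((\<lambda>x. g (f x)) has_derivative (\<lambda>v. g' (f x) (f' x v))) (at x)" if x: "x \<in> U" for x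
  proof -
    have "(g has_derivative g' (f x)) (at (f x))" using d(3) that sub by blast
    then show ?thesis using has_derivative_compose[OF d(1)[OF that]] by blast
  qed
  \<comment> \<open>The direction \<open>f' x v\<close> varies with \<open>x\<close>, whereas the
    induction hypothesis covers \<open>g'\<close> at fixed vectors only. Expanding the direction in
    the basis leaves products of scalar functions with such compositions.\<close>
  have "Ck k \<alpha> U (\<lambda>x. g' (f x) (f' x v))" for v
  proof -
    have "Ck k \<alpha> U (\<lambda>x. \<Sum>b\<in>Basis. (f' x v \<bullet> b) *\<^sub>R g' (f x) b)"
      by (intro Ck_sum Ck_bilinear[OF bounded_bilinear_scaleR] Suc.IH low d \<alpha> op
          Ck_bounded_linear_compose[OF bounded_linear_inner_left])
    moreover have "(\<Sum>b\<in>Basis. (f' x v \<bullet> b) *\<^sub>R g' (f x) b) = g' (f x) (f' x v)" if x: "x \<in> U" for x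
    proof -
      have "linear (g' (f x))" using d(3) that sub has_derivative_linear by blast
      then show ?thesis by (rule linear_eq_sum_Basis[symmetric])
    qed
    ultimately show ?thesis by (rule Ck_cong[OF _ op(1)])
  qed
  with der show ?case by (auto intro!: exI[of _ "\<lambda>x v. g' (f x) (f' x v)"])
qed

lemma Ck_compose_linear:
  fixes T :: "'a::euclidean_space \<Rightarrow> 'b::euclidean_space"
  assumes "linear T" "Ck k \<alpha> V g" "open U" "open V" "T ` U \<subseteq> V" "0 \<le> \<alpha>" "\<alpha> \<le> 1"
  shows "Ck k \<alpha> U (\<lambda>x. g (T x))"
proof -
  have "bounded_linear T" using assms(1) by (simp add: linear_conv_bounded_linear)
  then show ?thesis using assms by (intro Ck_compose[of k \<alpha> V g U T] Ck_linear[of T]) simp_all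
qed

declare Ck.simps [simp del]

section \<open>Graphs over orthogonal projections\<close>

text \<open>As a symmetric idempotent, \<open>P\<close> encodes a pair of orthogonal complements,
  its range and its kernel: the data of one standard chart of the Grassmannian.\<close>

definition orth_projection :: "('a::euclidean_space \<Rightarrow> 'a) \<Rightarrow> bool" where
  "orth_projection P \<longleftrightarrow> linear P \<and> (\<forall>x. P (P x) = P x) \<and> (\<forall>x y. P x \<bullet> y = x \<bullet> P y)"

lemma orth_projectionD:
  assumes "orth_projection P"
  shows "linear P" "P (P x) = P x" "P x \<bullet> y = x \<bullet> P y" "bounded_linear P"
  using assms by (auto simp: orth_projection_def linear_conv_bounded_linear)

lemma orth_projection_range: "orth_projection P \<Longrightarrow> v \<in> range P \<longleftrightarrow> P v = v"
  unfolding orth_projection_def by (metis rangeE rangeI)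

lemma norm_orth_projection_le:
  assumes "orth_projection P" shows "norm (P x) \<le> norm x"
proof -
  have "norm (P x) * norm (P x) = x \<bullet> P x"
    using orth_projectionD(2,3)[OF assms] by (metis dot_square_norm power2_eq_square)
  also have "\<dots> \<le> norm x * norm (P x)" by (rule norm_cauchy_schwarz)
  finally show ?thesis by (metis mult_right_le_imp_le norm_ge_zero order_le_less)
qed

lemma orthogonal_comp_range:
  assumes "orth_projection P" shows "(range P)\<^sup>\<bottom> = {w. P w = 0}"
proof -
  have mem: "w \<in> (range P)\<^sup>\<bottom> \<longleftrightarrow> (\<forall>x. P x \<bullet> w = 0)" for w
    by (auto simp: orthogonal_comp_def orthogonal_def inner_commute)
  have "P w = 0" if "\<forall>x. P x \<bullet> w = 0" for w
    using that orth_projectionD(3)[OF assms] by (metis inner_eq_zero_iff)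
  moreover have "P x \<bullet> w = 0" if "P w = 0" for x w
    using that orth_projectionD(3)[OF assms] by simp
  ultimately show ?thesis unfolding set_eq_iff mem_Collect_eq mem by blast
qed

lemma orth_projection_exists:
  fixes E :: "'a::euclidean_space set"
  assumes "subspace E"
  obtains P where "orth_projection P" "range P = E"
proof -
  have sC: "subspace (E\<^sup>\<bottom>)" by (rule subspace_orthogonal_comp)
  have tE: "E \<inter> E\<^sup>\<bottom> = {0}"
    using assms sC subspace_0 by (fastforce simp: orthogonal_comp_def orthogonal_def)
  have dC: "dim E + dim (E\<^sup>\<bottom>) = DIM('a)"
    using dim_subspace_orthogonal_to_vectors[OF assms subspace_UNIV subset_UNIV]
    by (simp add: orthogonal_comp_def add.commute)
  obtain P where P: "linear P" "\<And>x. P x \<in> E" "\<And>x. x - P x \<in> E\<^sup>\<bottom>"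
    using linear_projection_along[OF assms sC tE dC] by metis
  have PE: "P v = v" if "v \<in> E" for v
  proof -
    have "v - P v \<in> E \<inter> E\<^sup>\<bottom>" using P that subspace_diff[OF assms, of v "P v"] by blast
    then show ?thesis using tE by simp
  qed
  have 0: "P x \<bullet> (y - P y) = 0" for x y
    using P(2)[of x] P(3)[of y] by (auto simp: orthogonal_comp_def orthogonal_def)
  have "P x \<bullet> y = x \<bullet> P y" for x y
    using 0[of x y] 0[of y x] by (simp add: inner_diff_right inner_commute)
  then have "orth_projection P" using P(1,2) PE by (auto simp: orth_projection_def)
  moreover have "range P = E" using P(2) PE by (metis rangeI image_subsetI subsetI subset_antisym)
  ultimately show thesis by (rule that)
qed

text \<open>A function on an open part of \<open>range P\<close> is encoded by its extension along
  the fibres of \<open>P\<close>, so \<open>W\<close> is saturated under \<open>P\<close> and open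
  in the whole space. Derivatives and \<open>Ck\<close> then need no separate notion on
  subspaces.\<close>

definition Ck_graph ::
    "nat \<Rightarrow> real \<Rightarrow> ('a::euclidean_space \<Rightarrow> 'a) \<Rightarrow> 'a set \<Rightarrow> ('a \<Rightarrow> 'a) \<Rightarrow> 'a set \<Rightarrow> bool" where
  "Ck_graph k \<alpha> P W h Y \<longleftrightarrow> open W \<and> Ck k \<alpha> W h \<and> (\<forall>x. h (P x) = h x) \<and> (\<forall>x. P x \<in> W \<longleftrightarrow> x \<in> W) \<and>
     (\<forall>x\<in>W. P (h x) = 0) \<and> Y = {x \<in> W. x = P x + h x}"

section \<open>Passage between arbitrary linear coordinates and orthogonal projections\<close>

definition coord_proj :: "'n set \<Rightarrow> real ^ 'n::finite \<Rightarrow> real ^ 'n" where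
  "coord_proj I x = (\<chi> i. if i \<in> I then x $ i else 0)"

lemma linear_coord_proj: "linear (coord_proj I)"
  by (rule linearI) (auto simp: coord_proj_def vec_eq_iff)

lemma coord_proj_in: "coord_proj I x \<in> coord_subspace I"
  by (auto simp: coord_proj_def coord_subspace_def)

lemma coord_proj_fixes: "x \<in> coord_subspace I \<Longrightarrow> coord_proj I x = x"
  by (auto simp: coord_proj_def coord_subspace_def vec_eq_iff)

lemma coord_proj_kills: "x \<in> coord_subspace (- I) \<Longrightarrow> coord_proj I x = 0"
  by (auto simp: coord_proj_def coord_subspace_def vec_eq_iff)

lemma dim_coord_subspace: "dim (coord_subspace I :: (real ^ 'n::finite) set) = card I"
  using dim_substandard_cart[where 'a = real, of I] by (simp add: coord_subspace_def dim_vec_eq)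

lemma subspace_coord_subspace: "subspace (coord_subspace I)"
  by (auto simp: subspace_def coord_subspace_def)

text \<open>The graph is sheared along its vertical space \<open>N\<close>, the kernel of \<open>T\<close>, so that its base becomes \<open>N\<^sup>\<bottom>\<close>.\<close>

lemma submanifold_near_imp_Ck_graph:
  fixes X :: "(real ^ 'n::finite) set"
  assumes sm: "submanifold_near d k \<alpha> X p" and \<alpha>: "0 \<le> \<alpha>" "\<alpha> \<le> 1"
  obtains P W h U where "orth_projection P" "dim (range P) = d" "open U" "p \<in> U" "Ck_graph k \<alpha> P W h (X \<inter> U)"
proof -
  obtain L :: "real ^ 'n \<Rightarrow> real ^ 'n" and I U W f where
    L: "linear L" "bij L" and I: "card I = d" and op: "open U" "p \<in> U" "open W" and f: "Ck k \<alpha> W f"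
    and fI: "f ` (W \<inter> coord_subspace I) \<subseteq> coord_subspace (- I)"
    and X: "L ` (X \<inter> U) = {u + f u | u. u \<in> W \<inter> coord_subspace I}"
    using sm unfolding submanifold_near_def by (elim exE conjE) (rule that)
  define Li where "Li = inv L"
  have Li: "linear Li" unfolding Li_def using L by (metis bij_is_inj inj_linear_imp_inv_linear)
  have LiL: "Li (L x) = x" for x using L(2) by (simp add: Li_def bij_is_inj)
  have LLi: "L (Li x) = x" for x using L(2) by (simp add: Li_def bij_is_surj surj_f_inv_f)
  let ?\<pi> = "coord_proj I"
  define T where "T x = ?\<pi> (L x)" for x
  have T: "linear T" unfolding T_def using linear_compose[OF L(1) linear_coord_proj[of I]] by (simp add: o_def)
  define N where "N = {x. T x = 0}"
  have sN: "subspace N" unfolding N_def using T by (simp add: linear_subspace_kernel)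
  obtain P where P: "orth_projection P" "range P = N\<^sup>\<bottom>"
    using orth_projection_exists[OF subspace_orthogonal_comp] by metis
  note linP = orth_projectionD(1)[OF P(1)]
  have kerP: "P w = 0 \<longleftrightarrow> T w = 0" for w
  proof -
    have "{w. P w = 0} = N" using orthogonal_comp_range[OF P(1)] P(2) orthogonal_comp_self[OF sN] by simp
    then show ?thesis by (auto simp: N_def)
  qed
  have TP: "T (P x) = T x" for x
    using kerP[of "x - P x"] orth_projectionD(2)[OF P(1)] by (simp add: linear_diff[OF linP] linear_diff[OF T])
  have TLi: "T (Li u) = ?\<pi> u" for u by (simp add: T_def LLi)
  have TTi: "T (Li (T x)) = T x" for x by (simp add: TLi) (simp add: T_def coord_proj_fixes coord_proj_in)
  \<comment> \<open>The point of \<open>X \<inter> U\<close> in the fibre of \<open>T\<close>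
    through \<open>x\<close> is \<open>Li (T x + f (T x))\<close>, for \<open>T x\<close> in
    \<open>W\<close>. Subtracting \<open>P x\<close> leaves a vertical vector, because
    \<open>T\<close> and \<open>T \<circ> P\<close> agree.\<close>
  define h where "h x = Li (T x) - P x + Li (f (T x))" for x
  have Ph: "P (h x) = 0" if "T x \<in> W" for x
  proof -
    have "f (T x) \<in> coord_subspace (- I)" using fI that coord_proj_in[of I] by (auto simp: T_def)
    then have "T (Li (f (T x))) = 0" by (simp add: TLi coord_proj_kills)
    then have "T (h x) = 0" by (simp add: h_def linear_add[OF T] linear_diff[OF T] TTi TP)
    then show ?thesis by (simp add: kerP)
  qed
  have dimP: "dim (range P) = d"
  proof -
    have "T ` range P = coord_subspace I"
    proof
      show "T ` range P \<subseteq> coord_subspace I" by (auto simp: T_def coord_proj_in)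
      show "coord_subspace I \<subseteq> T ` range P"
      proof
        fix u :: "real ^ 'n" assume "u \<in> coord_subspace I"
        then have "u = T (P (Li u))" by (simp add: TP TLi coord_proj_fixes)
        then show "u \<in> T ` range P" by blast
      qed
    qed
    moreover have "inj_on T (span (range P))"
    proof -
      have sub: "subspace (range P)" using linP by (simp add: linear_subspace_image)
      have "x = 0" if "x \<in> range P" "T x = 0" for x
        using that kerP[of x] orth_projection_range[OF P(1)] by auto
      then have "inj_on T (range P)" using linear_inj_on_iff_eq_0[OF T sub] by blast
      moreover have "span (range P) = range P" using sub span_eq_iff by blast
      ultimately show ?thesis by (simp only:)
    qed
    ultimately have "dim (range P) = dim (coord_subspace I)" using dim_image_eq[OF T] by metis
    then show ?thesis by (simp add: dim_coord_subspace I)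
  qed
  have opT: "open (T -` W)" using op(3) T by (metis continuous_on_open_vimage open_UNIV linear_continuous_on linear_conv_bounded_linear inf_top.right_neutral)
  have Ckh: "Ck k \<alpha> (T -` W) h"
  proof -
    have 1: "Ck k \<alpha> (T -` W) (\<lambda>x. Li (f (T x)))"
      by (rule Ck_bounded_linear_compose[OF _ Ck_compose_linear[OF T f opT op(3) _ \<alpha>]])
        (use Li in \<open>auto simp: linear_conv_bounded_linear\<close>)
    have "linear (\<lambda>x. Li (T x) - P x)"
      using linear_compose_sub[OF linear_compose[OF T Li] linP] by (simp add: o_def)
    then have "Ck k \<alpha> (T -` W) (\<lambda>x. Li (T x) - P x)"
      using Ck_linear opT \<alpha> linear_conv_bounded_linear by blast
    from Ck_add[OF this 1] show ?thesis by (simp add: h_def[abs_def])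
  qed
  have XU: "X \<inter> U = {x \<in> T -` W. x = P x + h x}"
  proof -
    have "x \<in> X \<inter> U \<longleftrightarrow> T x \<in> W \<and> x = P x + h x" for x
    proof -
      have "x \<in> X \<inter> U \<longleftrightarrow> L x \<in> L ` (X \<inter> U)" using L(2) by (metis bij_is_inj inj_image_mem_iff)
      also have "\<dots> \<longleftrightarrow> T x \<in> W \<and> L x = T x + f (T x)"
      proof
        assume "L x \<in> L ` (X \<inter> U)"
        then obtain u where u: "L x = u + f u" "u \<in> W" "u \<in> coord_subspace I" using X by blast
        have "f u \<in> coord_subspace (- I)" using fI u by blast
        then have "T x = u" unfolding T_def
          by (simp add: u linear_add[OF linear_coord_proj] coord_proj_fixes coord_proj_kills)
        then show "T x \<in> W \<and> L x = T x + f (T x)" using u by simp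
      next
        assume "T x \<in> W \<and> L x = T x + f (T x)"
        then show "L x \<in> L ` (X \<inter> U)" unfolding X using coord_proj_in[of I "L x"] by (auto simp: T_def)
      qed
      also have "\<dots> \<longleftrightarrow> T x \<in> W \<and> x = P x + h x"
      proof -
        have "L x = T x + f (T x) \<longleftrightarrow> x = Li (T x + f (T x))" using LiL LLi by metis
        then show ?thesis by (simp add: h_def linear_add[OF Li])
      qed
      finally show ?thesis .
    qed
    then show ?thesis by blast
  qed
  have "Ck_graph k \<alpha> P (T -` W) h (X \<inter> U)"
    unfolding Ck_graph_def using opT Ckh XU Ph by (auto simp: TP h_def orth_projectionD(2)[OF P(1)])
  with P(1) dimP op show thesis using that by blast
qed

text \<open>Any set \<open>I\<close> of \<open>d\<close> coordinates will do: isomorphisms from the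
  range and the kernel of \<open>P\<close> onto the coordinate subspaces of \<open>I\<close> and
  \<open>- I\<close> combine to a change of coordinates that respects both splittings and so carries
  graphs to graphs.\<close>

lemma Ck_graph_imp_submanifold_near:
  fixes X :: "(real ^ 'n::finite) set"
  assumes P: "orth_projection P" and d: "dim (range P) = d" and U: "open U" "p \<in> U"
    and G: "Ck_graph k \<alpha> P W h (X \<inter> U)" and \<alpha>: "0 \<le> \<alpha>" "\<alpha> \<le> 1"
  shows "submanifold_near d k \<alpha> X p"
proof -
  have W: "open W" "Ck k \<alpha> W h" "\<And>x. h (P x) = h x" "\<And>x. P x \<in> W \<longleftrightarrow> x \<in> W" "\<And>x. x \<in> W \<Longrightarrow> P (h x) = 0"
    and XU: "X \<inter> U = {x \<in> W. x = P x + h x}"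
    using G by (auto simp: Ck_graph_def)
  note linP = orth_projectionD(1)[OF P] and PP = orth_projectionD(2)[OF P]
  have sE: "subspace (range P)" using linP by (simp add: linear_subspace_image)
  have dn: "d \<le> CARD('n)" using d dim_subset_UNIV[of "range P"] by simp
  obtain I :: "'n set" where I: "card I = d" using obtain_subset_with_card_n[OF dn] by metis
  have comp: "(range P)\<^sup>\<bottom> = {w. P w = 0}" by (rule orthogonal_comp_range[OF P])
  have sC: "subspace {w. P w = 0}" using subspace_orthogonal_comp[of "range P"] comp by simp
  have "dim (range P) + dim ((range P)\<^sup>\<bottom>) = DIM(real ^ 'n)"
    using dim_subspace_orthogonal_to_vectors[OF sE subspace_UNIV subset_UNIV]
    by (simp add: orthogonal_comp_def add.commute)
  then have dC: "dim {w. P w = 0} = card (- I)" using comp d I by (simp add: Compl_eq_Diff_UNIV card_Diff_subset)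
  obtain f1 g1 where fg1: "linear f1" "f1 ` range P = coord_subspace I" "\<And>x. x \<in> range P \<Longrightarrow> g1 (f1 x) = x"
    using isometries_subspaces[OF sE subspace_coord_subspace[of I]] d I by (metis dim_coord_subspace)
  obtain f2 g2 where fg2: "linear f2" "f2 ` {w. P w = 0} = coord_subspace (- I)" "\<And>x. x \<in> {w. P w = 0} \<Longrightarrow> g2 (f2 x) = x"
    using isometries_subspaces[OF sC subspace_coord_subspace[of "- I"]] dC by (metis dim_coord_subspace)
  have f10: "x = 0" if "P x = x" "f1 x = 0" for x
    using fg1(3)[of x] fg1(3)[of 0] that linear_0[OF fg1(1)] linear_0[OF linP] orth_projection_range[OF P] by metis
  have f20: "x = 0" if "P x = 0" "f2 x = 0" for x
    using fg2(3)[of x] fg2(3)[of 0] that linear_0[OF fg2(1)] linear_0[OF linP] by (metis mem_Collect_eq)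
  define L where "L x = f1 (P x) + f2 (x - P x)" for x
  let ?\<pi> = "coord_proj I"
  have \<pi>L: "?\<pi> (L x) = f1 (P x)" for x
  proof -
    have "f1 (P x) \<in> coord_subspace I" using fg1(2) by blast
    moreover have "f2 (x - P x) \<in> coord_subspace (- I)"
    proof -
      have "x - P x \<in> {w. P w = 0}" by (simp add: linear_diff[OF linP] PP)
      then show ?thesis using fg2(2) by blast
    qed
    ultimately show ?thesis
      by (simp add: L_def linear_add[OF linear_coord_proj] coord_proj_fixes coord_proj_kills)
  qed
  have linL: "linear L"
    unfolding L_def using linear_compose_add[OF linear_compose[OF linP fg1(1)]
        linear_compose[OF linear_compose_sub[OF linear_ident linP] fg2(1)]] by (simp add: o_def)
  have "inj L"
  proof (subst linear_injective_0[OF linL], intro allI impI)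
    fix x assume "L x = 0"
    then have "f1 (P x) = 0" using \<pi>L[of x] by (simp add: linear_0[OF linear_coord_proj])
    then have "P x = 0" using f10[of "P x"] PP by simp
    moreover have "f2 (x - P x) = 0" using \<open>L x = 0\<close> \<open>f1 (P x) = 0\<close> by (simp add: L_def)
    ultimately show "x = 0" using f20 by simp
  qed
  then have bijL: "bij L" using linear_injective_imp_surjective[OF linL] by (simp add: bij_def)
  define Li where "Li = inv L"
  have LiL: "Li (L x) = x" for x using bijL by (simp add: Li_def bij_is_inj)
  have LLi: "L (Li x) = x" for x using bijL by (simp add: Li_def bij_is_surj surj_f_inv_f)
  have Li: "linear Li"
    by (rule linearI) (metis LiL LLi linear_add[OF linL], metis LiL LLi linear_scale[OF linL])
  have op: "open (Li -` W)"
    using W(1) Li by (metis continuous_on_open_vimage open_UNIV linear_continuous_on linear_conv_bounded_linear inf_top.right_neutral)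
  let ?f = "\<lambda>y. L (h (Li y))"
  have Ckf: "Ck k \<alpha> (Li -` W) ?f"
    by (rule Ck_bounded_linear_compose[OF _ Ck_compose_linear[OF Li W(2) op W(1) _ \<alpha>]])
      (use linL in \<open>auto simp: linear_conv_bounded_linear\<close>)
  have fI: "?f ` (Li -` W \<inter> coord_subspace I) \<subseteq> coord_subspace (- I)"
  proof clarify
    fix y assume "Li y \<in> W"
    then have "P (h (Li y)) = 0" by (rule W(5))
    then have "L (h (Li y)) = f2 (h (Li y))" "h (Li y) \<in> {w. P w = 0}"
      by (auto simp: L_def linear_0[OF fg1(1)])
    then show "L (h (Li y)) \<in> coord_subspace (- I)" using fg2(2) by (metis imageI)
  qed
  have "L ` (X \<inter> U) = {u + ?f u | u. u \<in> Li -` W \<inter> coord_subspace I}"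
  proof
    show "L ` (X \<inter> U) \<subseteq> {u + ?f u | u. u \<in> Li -` W \<inter> coord_subspace I}"
    proof clarify
      fix x assume "x \<in> X" "x \<in> U"
      then have x: "x \<in> W" "x = P x + h x" using XU by blast+
      have "L (P x) = f1 (P x)" by (simp add: L_def PP linear_0[OF fg2(1)])
      then have "L (P x) \<in> coord_subspace I" using fg1(2) by auto
      moreover have "L x = L (P x) + ?f (L (P x))"
        using x(2) by (metis LiL W(3) linear_add[OF linL])
      moreover have "Li (L (P x)) \<in> W" using x W(4) LiL by simp
      ultimately show "\<exists>u. L x = u + ?f u \<and> u \<in> Li -` W \<inter> coord_subspace I" by blast
    qed
    show "{u + ?f u | u. u \<in> Li -` W \<inter> coord_subspace I} \<subseteq> L ` (X \<inter> U)"
    proof clarify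
      fix u assume u: "Li u \<in> W" "u \<in> coord_subspace I"
      define y where "y = Li u"
      have Ly: "L y = u" by (simp add: y_def LLi)
      have Py: "P y = y"
      proof -
        have "f1 (P y) = u" using \<pi>L[of y] u Ly by (simp add: coord_proj_fixes)
        then have "f2 (y - P y) = 0" using Ly by (simp add: L_def)
        then show ?thesis using f20[of "y - P y"] by (simp add: linear_diff[OF linP] PP)
      qed
      have yW: "y \<in> W" using u by (simp add: y_def)
      define x where "x = y + h y"
      have Px: "P x = y" using W(5)[OF yW] Py by (simp add: x_def linear_add[OF linP])
      then have "x \<in> W" "h x = h y" using W(3,4)[of x] yW by auto
      then have "x \<in> X \<inter> U" using XU Px by (simp add: x_def)
      moreover have "u + ?f u = L x" by (simp add: x_def linear_add[OF linL] Ly y_def[symmetric])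
      ultimately show "u + ?f u \<in> L ` (X \<inter> U)" by (metis imageI)
    qed
  qed
  with linL bijL I U op Ckf fI show ?thesis unfolding submanifold_near_def by blast
qed

section \<open>Subspaces as graphs\<close>

text \<open>These are the linear maps from the range of \<open>P\<close> to its kernel, extended by
  \<open>0\<close> to the kernel, the same normalisation as in \<open>Gr_chart\<close>.\<close>

definition graph_map :: "('a::euclidean_space \<Rightarrow> 'a) \<Rightarrow> ('a \<Rightarrow> 'a) \<Rightarrow> bool" where
  "graph_map P A \<longleftrightarrow> linear A \<and> (\<forall>v. A (P v) = A v) \<and> (\<forall>v. P (A v) = 0)"

text \<open>An equation rather than an image, because later estimates measure the deviation
  \<open>v - P v - A v\<close>, which vanishes exactly on this space.\<close>

definition graph_space :: "('a::euclidean_space \<Rightarrow> 'a) \<Rightarrow> ('a \<Rightarrow> 'a) \<Rightarrow> 'a set" where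
  "graph_space P A = {v. v = P v + A v}"

lemma graph_mapD:
  assumes "graph_map P A" shows "linear A" "A (P v) = A v" "P (A v) = 0"
  using assms by (auto simp: graph_map_def)

lemma graph_map_square:
  assumes "graph_map P A" "linear P" shows "A (A v) = 0"
  using graph_mapD[OF assms(1)] by (metis linear_0)

lemma graph_spaceD: "v \<in> graph_space P A \<Longrightarrow> P v + A v = v"
  unfolding graph_space_def mem_Collect_eq by (rule sym)

lemma graph_space_eq_image:
  assumes P: "orth_projection P" and A: "graph_map P A"
  shows "graph_space P A = (\<lambda>u. u + A u) ` range P"
proof
  show "graph_space P A \<subseteq> (\<lambda>u. u + A u) ` range P"
  proof
    fix v assume "v \<in> graph_space P A"
    then have "v = P v + A (P v)" using graph_mapD(2)[OF A] by (simp add: graph_space_def)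
    then show "v \<in> (\<lambda>u. u + A u) ` range P" by blast
  qed
  show "(\<lambda>u. u + A u) ` range P \<subseteq> graph_space P A"
  proof clarify
    fix x
    show "P x + A (P x) \<in> graph_space P A"
      using graph_mapD[OF A] orth_projectionD[OF P] graph_map_square[OF A]
      by (simp add: graph_space_def linear_add)
  qed
qed

lemma graph_space_in_Gr:
  fixes P :: "real ^ 'n::finite \<Rightarrow> real ^ 'n"
  assumes P: "orth_projection P" and A: "graph_map P A"
  shows "graph_space P A \<in> Gr (dim (range P))"
proof -
  note linP = orth_projectionD(1)[OF P] and linA = graph_mapD(1)[OF A]
  have sub: "subspace (range P)" using linP by (simp add: linear_subspace_image)
  have lin: "linear (\<lambda>u. u + A u)" using linear_compose_add[OF linear_ident linA] by simp
  have "inj_on (\<lambda>u. u + A u) (range P)"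
  proof (rule inj_onI)
    fix u v assume uv: "u \<in> range P" "v \<in> range P" "u + A u = v + A v"
    from uv(3) have "P (u + A u) = P (v + A v)" by simp
    then show "u = v"
      using uv(1,2) by (simp add: linear_add[OF linP] graph_mapD(3)[OF A] orth_projection_range[OF P])
  qed
  moreover have "span (range P) = range P" using sub span_eq_iff by blast
  ultimately have "inj_on (\<lambda>u. u + A u) (span (range P))" by (simp only:)
  then have "dim (graph_space P A) = dim (range P)"
    unfolding graph_space_eq_image[OF P A] by (rule dim_image_eq[OF lin])
  moreover have "subspace (graph_space P A)"
    using linear_subspace_image[OF lin sub] graph_space_eq_image[OF P A] by simp
  ultimately show ?thesis by (simp add: Gr_def)
qed

lemma range_in_Gr:
  fixes P :: "real ^ 'n::finite \<Rightarrow> real ^ 'n"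
  assumes "orth_projection P" shows "range P \<in> Gr (dim (range P))"
  using orth_projectionD(1)[OF assms] by (simp add: Gr_def linear_subspace_image)

lemma Gr_chart_graph_space:
  fixes P :: "real ^ 'n::finite \<Rightarrow> real ^ 'n"
  assumes P: "orth_projection P" and d: "dim (range P) = d" and A: "graph_map P ((*v) A)"
  shows "graph_space P ((*v) A) \<in> Gr_chart_dom d (range P)"
    and "Gr_chart (range P) (graph_space P ((*v) A)) = A"
proof -
  let ?L = "graph_space P ((*v) A)"
  note linP = orth_projectionD(1)[OF P]
  have "v = 0" if "v \<in> ?L" "P v = 0" for v
  proof -
    have "A *v v = v" using graph_spaceD[OF that(1)] that(2) by simp
    moreover have "A *v v = 0" using graph_mapD(2)[OF A, of v] that(2) by simp
    ultimately show ?thesis by simp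
  qed
  moreover have "0 \<in> ?L" using linP by (simp add: graph_space_def linear_0)
  ultimately have "?L \<inter> (range P)\<^sup>\<bottom> = {0}" using linP by (auto simp: orthogonal_comp_range[OF P] linear_0)
  then show dom: "?L \<in> Gr_chart_dom d (range P)"
    using graph_space_in_Gr[OF P A] d by (simp add: Gr_chart_dom_def)
  have rP: "range P \<in> Gr d" using range_in_Gr[OF P] d by simp
  have "(\<forall>w\<in>(range P)\<^sup>\<bottom>. A *v w = 0) \<and> range ((*v) A) \<subseteq> (range P)\<^sup>\<bottom> \<and> ?L = {v + A *v v | v. v \<in> range P}"
  proof (intro conjI ballI)
    fix w assume "w \<in> (range P)\<^sup>\<bottom>"
    then show "A *v w = 0" using graph_mapD(2)[OF A, of w] by (simp add: orthogonal_comp_range[OF P])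
  next
    show "range ((*v) A) \<subseteq> (range P)\<^sup>\<bottom>" using graph_mapD(3)[OF A] by (auto simp: orthogonal_comp_range[OF P])
  next
    show "?L = {v + A *v v | v. v \<in> range P}" unfolding graph_space_eq_image[OF P A] by blast
  qed
  then show "Gr_chart (range P) ?L = A"
    unfolding Gr_chart_def by (rule the1_equality[OF Gr_chart_ex1[OF rP dom]])
qed

lemma graph_space_Gr_chart:
  fixes P :: "real ^ 'n::finite \<Rightarrow> real ^ 'n"
  assumes P: "orth_projection P" and E: "range P = E" "E \<in> Gr d" and L: "L \<in> Gr_chart_dom d E"
  shows "graph_map P ((*v) (Gr_chart E L))" "graph_space P ((*v) (Gr_chart E L)) = L"
proof -
  let ?A = "Gr_chart E L"
  note linP = orth_projectionD(1)[OF P]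
  have A: "\<forall>w\<in>E\<^sup>\<bottom>. ?A *v w = 0" "range ((*v) ?A) \<subseteq> E\<^sup>\<bottom>" "L = {v + ?A *v v | v. v \<in> E}"
    using theI'[OF Gr_chart_ex1[OF E(2) L]] unfolding Gr_chart_def by blast+
  have comp: "E\<^sup>\<bottom> = {w. P w = 0}" using orthogonal_comp_range[OF P] E(1) by simp
  show A': "graph_map P ((*v) ?A)"
    unfolding graph_map_def
  proof (intro conjI allI)
    fix v
    have "?A *v (v - P v) = 0" using A(1) comp by (simp add: linear_diff[OF linP] orth_projectionD(2)[OF P])
    then show "?A *v P v = ?A *v v" by (simp add: matrix_vector_mult_diff_distrib)
    show "P (?A *v v) = 0" using A(2) comp by blast
  qed simp
  show "graph_space P ((*v) ?A) = L"
    unfolding graph_space_eq_image[OF P A'] E(1) by (subst (2) A(3)) blast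
qed

text \<open>A unit vector \<open>a\<close> of the first graph moves by at most \<open>e\<close> to
  the vector \<open>b\<close> of the second graph with the same projection. Then
  \<open>norm b\<close> differs from \<open>1\<close> by at most \<open>e\<close>, so normalising
  costs another \<open>e\<close>; \<open>e < 1\<close> keeps \<open>b\<close> away from
  \<open>0\<close>.\<close>

lemma Gr_dist_graph_space:
  fixes P :: "real ^ 'n::finite \<Rightarrow> real ^ 'n"
  assumes P: "orth_projection P" and A: "graph_map P A" and B: "graph_map P B"
    and e: "\<And>v. norm (A v - B v) \<le> e * norm v" "0 \<le> e" "e < 1"
  shows "Gr_dist (graph_space P A) (graph_space P B) \<le> 2 * e"
proof -
  have half: "infdist a (graph_space P B \<inter> sphere 0 1) \<le> 2 * e"
    if A: "graph_map P A" and B: "graph_map P B" and e': "\<And>v. norm (A v - B v) \<le> e * norm v"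
      and a: "a \<in> graph_space P A \<inter> sphere 0 1" for A B a
  proof -
    define b where "b = P a + B (P a)"
    have "b - a = B (P a) - A (P a)" using a graph_mapD(2)[OF A] by (auto simp: b_def graph_space_def algebra_simps)
    then have "norm (b - a) \<le> e * norm (P a)" using e'[of "P a"] by (simp add: norm_minus_commute)
    also have "\<dots> \<le> e * 1" using norm_orth_projection_le[OF P, of a] a e(2) by (intro mult_left_mono) auto
    finally have ba: "norm (b - a) \<le> e" by simp
    have na: "norm a = 1" using a by simp
    have nb: "\<bar>norm b - 1\<bar> \<le> e" using ba norm_triangle_ineq3[of b a] na by simp
    then have b0: "norm b > 0" using e(3) by linarith
    have bB: "b \<in> graph_space P B" unfolding graph_space_eq_image[OF P B] b_def by blast
    have sub: "subspace (graph_space P B)" using graph_space_in_Gr[OF P B] by (simp add: Gr_def)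
    define c where "c = b /\<^sub>R norm b"
    have c: "c \<in> graph_space P B \<inter> sphere 0 1" using b0 bB sub by (simp add: c_def subspace_scale)
    have "norm (c - b) = norm ((1 / norm b - 1) *\<^sub>R b)" by (simp add: c_def algebra_simps divide_inverse)
    also have "\<dots> = \<bar>1 - norm b\<bar>"
    proof -
      have "\<bar>1 / norm b - 1\<bar> * norm b = \<bar>(1 / norm b - 1) * norm b\<bar>" using b0 by (simp add: abs_mult)
      also have "(1 / norm b - 1) * norm b = 1 - norm b" using b0 by (simp add: field_simps)
      finally show ?thesis by simp
    qed
    finally have "norm (c - b) \<le> e" using nb by simp
    then have "dist a c \<le> 2 * e"
      using ba norm_triangle_ineq[of "c - b" "b - a"] by (simp add: dist_norm norm_minus_commute)
    then show ?thesis using infdist_le[OF c, of a] by simp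
  qed
  let ?SA = "graph_space P A \<inter> sphere 0 1" and ?SB = "graph_space P B \<inter> sphere 0 1"
  have e': "norm (B v - A v) \<le> e * norm v" for v using e(1)[of v] by (simp add: norm_minus_commute)
  show ?thesis
  proof (cases "?SA = {} \<or> ?SB = {}")
    case True then show ?thesis using e(2) by (auto simp: Gr_dist_def Hausdorff_dist_def)
  next
    case False
    then show ?thesis
      unfolding Gr_dist_def using half[OF A B e(1)] half[OF B A e'] Hausdorff_dist_le_iff[of ?SA ?SB] by auto
  qed
qed

section \<open>Tangent cones and tangent spaces\<close>

text \<open>In finite dimension, pointwise convergence of linear maps allows the argument to
  converge at the same time: expand the argument in the basis.\<close>

lemma tendsto_linear_apply:
  fixes A :: "'i \<Rightarrow> 'a::euclidean_space \<Rightarrow> 'b::real_normed_vector"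
  assumes "\<forall>\<^sub>F i in F. linear (A i)" "linear B" "\<And>v. ((\<lambda>i. A i v) \<longlongrightarrow> B v) F" "(w \<longlongrightarrow> v) F"
  shows "((\<lambda>i. A i (w i)) \<longlongrightarrow> B v) F"
proof -
  have "((\<lambda>i. \<Sum>b\<in>Basis. (w i \<bullet> b) *\<^sub>R A i b) \<longlongrightarrow> (\<Sum>b\<in>Basis. (v \<bullet> b) *\<^sub>R B b)) F"
    by (intro tendsto_intros assms)
  then have "((\<lambda>i. \<Sum>b\<in>Basis. (w i \<bullet> b) *\<^sub>R A i b) \<longlongrightarrow> B v) F"
    using linear_eq_sum_Basis[OF assms(2)] by metis
  moreover have "\<forall>\<^sub>F i in F. (\<Sum>b\<in>Basis. (w i \<bullet> b) *\<^sub>R A i b) = A i (w i)"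
    using assms(1) by eventually_elim (simp add: linear_eq_sum_Basis[symmetric])
  ultimately show ?thesis using tendsto_cong by force
qed

lemma tangent_space_subset_cone_C3: "tangent_space X p \<subseteq> cone_C3 X p"
proof
  fix v assume "v \<in> tangent_space X p"
  then obtain \<gamma> \<epsilon> where \<gamma>: "\<epsilon> > 0" "\<gamma> ` {-\<epsilon><..<\<epsilon>} \<subseteq> X" "\<gamma> 0 = p" "(\<gamma> has_vector_derivative v) (at 0)"
    unfolding tangent_space_def by blast
  \<comment> \<open>The shift by \<open>2\<close> makes \<open>t i < \<epsilon>\<close> hold already
    for \<open>i = 0\<close>.\<close>
  define t where "t i = \<epsilon> / real (i + 2)" for i
  have t: "0 < t i" "t i < \<epsilon>" for i using \<gamma>(1) by (auto simp: t_def divide_less_eq)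
  have t0: "t \<longlonglongrightarrow> 0"
    unfolding t_def using LIMSEQ_ignore_initial_segment[OF lim_const_over_n[of \<epsilon>], of 2] by simp
  have at: "filterlim t (at 0) sequentially"
    using t0 t(1) by (simp add: filterlim_at eventually_sequentiallyI order_less_imp_not_eq2)
  have "((\<lambda>s. norm (\<gamma> s - \<gamma> 0 - s *\<^sub>R v) / norm s) \<longlongrightarrow> 0) (at 0)"
    using \<gamma>(4) by (simp add: has_vector_derivative_def has_derivative_at)
  then have "(\<lambda>i. norm (\<gamma> (t i) - \<gamma> 0 - t i *\<^sub>R v) / norm (t i)) \<longlonglongrightarrow> 0"
    using at filterlim_compose by blast
  moreover have "norm (\<gamma> (t i) - \<gamma> 0 - t i *\<^sub>R v) / norm (t i) = norm ((1 / t i) *\<^sub>R (\<gamma> (t i) - p) - v)" for i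
  proof -
    have "(1 / t i) *\<^sub>R (\<gamma> (t i) - p) - v = (1 / t i) *\<^sub>R (\<gamma> (t i) - \<gamma> 0 - t i *\<^sub>R v)"
      using t(1)[of i] \<gamma>(3) by (simp add: scaleR_diff_right)
    then show ?thesis by simp
  qed
  ultimately have "(\<lambda>i. norm ((1 / t i) *\<^sub>R (\<gamma> (t i) - p) - v)) \<longlonglongrightarrow> 0" by simp
  then have "(\<lambda>i. (1 / t i) *\<^sub>R (\<gamma> (t i) - p)) \<longlonglongrightarrow> v"
    by (rule LIM_zero_cancel[OF tendsto_norm_zero_cancel])
  moreover have "(\<lambda>i. \<gamma> (t i)) \<longlonglongrightarrow> p"
    using isCont_tendsto_compose[OF has_vector_derivative_continuous[OF \<gamma>(4)] t0] \<gamma>(3) by simp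
  moreover have "\<gamma> (t i) \<in> X" for i using \<gamma>(2) t[of i] \<gamma>(1) by (simp add: image_subset_iff)
  ultimately show "v \<in> cone_C3 X p" unfolding cone_C3_def using t(1)
    by (auto intro!: exI[of _ "\<lambda>i. \<gamma> (t i)"] exI[of _ t])
qed

text \<open>Linearity lets \<open>R\<close> pass through the factor \<open>1 / t i\<close>, so an
  estimate for secants survives rescaling and the limit; it holds there for every \<open>e\<close>.
  Applied to a deviation map \<open>R\<close>, this bounds the tangent cone from above.\<close>

lemma cone_C3_kernel:
  assumes R: "bounded_linear R" and small: "\<And>e. 0 < e \<Longrightarrow> \<exists>r>0. \<forall>y\<in>X. dist y p < r \<longrightarrow> norm (R (y - p)) \<le> e * norm (y - p)"
    and v: "v \<in> cone_C3 X p"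
  shows "R v = 0"
proof -
  obtain x t where x: "\<And>i::nat. x i \<in> X" "\<And>i. t i > 0" "x \<longlonglongrightarrow> p" "(\<lambda>i. (1 / t i) *\<^sub>R (x i - p)) \<longlonglongrightarrow> v"
    using v unfolding cone_C3_def by blast
  let ?w = "\<lambda>i. (1 / t i) *\<^sub>R (x i - p)"
  have lim: "(\<lambda>i. norm (R (?w i))) \<longlonglongrightarrow> norm (R v)"
    by (intro tendsto_norm bounded_linear.tendsto[OF R x(4)])
  have "norm (R v) \<le> e * norm v" if e: "0 < e" for e
  proof -
    obtain r where r: "r > 0" "\<And>y. y \<in> X \<Longrightarrow> dist y p < r \<Longrightarrow> norm (R (y - p)) \<le> e * norm (y - p)"
      using small[OF e] by blast
    have "\<forall>\<^sub>F i in sequentially. norm (R (?w i)) \<le> e * norm (?w i)"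
      using tendstoD[OF x(3) r(1)]
    proof eventually_elim
      case (elim i)
      have "norm (R (?w i)) = (1 / t i) * norm (R (x i - p))"
        using x(2)[of i] linear_scale[OF bounded_linear.linear[OF R]] by simp
      also have "\<dots> \<le> (1 / t i) * (e * norm (x i - p))"
        using r(2)[OF x(1) elim] x(2)[of i] by (intro mult_left_mono) auto
      finally show ?case using x(2)[of i] by simp
    qed
    then show ?thesis
      using tendsto_le[OF _ tendsto_mult[OF tendsto_const tendsto_norm[OF x(4)]] lim] by simp
  qed
  note bound = this
  have "norm (R v) \<le> 0 + e" if e: "0 < e" for e
  proof -
    have n: "0 < norm v + 1" by (simp add: add_nonneg_pos)
    have "norm (R v) \<le> e / (norm v + 1) * norm v" using e n by (intro bound) simp
    also have "\<dots> \<le> e / (norm v + 1) * (norm v + 1)" using e n by (intro mult_left_mono) auto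
    also have "\<dots> = e" using n by simp
    finally show ?thesis by simp
  qed
  then have "norm (R v) \<le> 0" by (rule field_le_epsilon)
  then show ?thesis by simp
qed

text \<open>Tangent spaces at regular points are read off from the continuous family
  \<open>A\<close>, so limits of tangent vectors satisfy the graph equation at \<open>p\<close>.
  Conversely a vector \<open>v\<close> of the graph at \<open>p\<close> is approached by the vectors
  with the same projection \<open>P v\<close> in nearby tangent spaces, and density of regular
  points at \<open>p\<close> supplies these.\<close>

lemma cone_C4_eq_graph_space:
  fixes X :: "(real ^ 'n::finite) set"
  assumes P: "orth_projection P" and U: "open U" "p \<in> U" and p: "p \<in> X" "p \<in> closure (Reg1 X)"
    and A: "\<And>x. x \<in> X \<inter> U \<Longrightarrow> graph_map P (A x)"
    and cont: "\<And>v. continuous_on (X \<inter> U) (\<lambda>x. A x v)"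
    and T: "\<And>x. x \<in> Reg1 X \<inter> U \<Longrightarrow> tangent_space X x = graph_space P (A x)"
  shows "cone_C4 X p = graph_space P (A p)"
proof -
  note linP = orth_projectionD(1)[OF P]
  have RX: "Reg1 X \<subseteq> X" by (auto simp: Reg1_def)
  have lin: "linear (A p)" using A p U graph_mapD by blast
  have limA: "(\<lambda>i. A (x i) v) \<longlonglongrightarrow> A p v" if "x \<longlonglongrightarrow> p" "\<forall>\<^sub>F i in sequentially. x i \<in> X \<inter> U" for x v
    using cont[of v] that p(1) U(2) by (auto simp: continuous_on_sequentially intro: continuous_on_tendsto_compose[OF cont])
  have evU: "\<forall>\<^sub>F i in sequentially. x i \<in> X \<inter> U" if "x \<longlonglongrightarrow> p" "\<And>i. x i \<in> Reg1 X" for x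
    using topological_tendstoD[OF that(1) U] by eventually_elim (use that(2) RX in blast)
  show ?thesis
  proof
    show "cone_C4 X p \<subseteq> graph_space P (A p)"
    proof
      fix v assume "v \<in> cone_C4 X p"
      then obtain x w where x: "\<And>i::nat. x i \<in> Reg1 X" "\<And>i. w i \<in> tangent_space X (x i)" "x \<longlonglongrightarrow> p" "w \<longlonglongrightarrow> v"
        unfolding cone_C4_def by blast
      note ev = evU[OF x(3,1)]
      have "(\<lambda>i. A (x i) (w i)) \<longlonglongrightarrow> A p v"
        by (rule tendsto_linear_apply[OF _ lin limA[OF x(3) ev] x(4)])
          (use ev in eventually_elim, use A graph_mapD(1) in blast)
      then have "(\<lambda>i. P (w i) + A (x i) (w i)) \<longlonglongrightarrow> P v + A p v"
        by (intro tendsto_add bounded_linear.tendsto[OF orth_projectionD(4)[OF P] x(4)])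
      moreover have "\<forall>\<^sub>F i in sequentially. P (w i) + A (x i) (w i) = w i"
        using ev
      proof eventually_elim
        case (elim i)
        then have "w i \<in> graph_space P (A (x i))" using x(1,2)[of i] T[of "x i"] by blast
        then show ?case by (rule graph_spaceD)
      qed
      ultimately have "w \<longlonglongrightarrow> P v + A p v" by (rule Lim_transform_eventually)
      then have "v = P v + A p v" by (rule LIMSEQ_unique[OF x(4)])
      then show "v \<in> graph_space P (A p)" unfolding graph_space_def mem_Collect_eq .
    qed
    show "graph_space P (A p) \<subseteq> cone_C4 X p"
    proof
      fix v assume v: "v \<in> graph_space P (A p)"
      obtain x where x: "\<And>i::nat. x i \<in> Reg1 X" "x \<longlonglongrightarrow> p" using p(2) closure_sequential by metis
      obtain N where N: "\<And>i. i \<ge> N \<Longrightarrow> x i \<in> X \<inter> U"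
        using evU[OF x(2,1)] unfolding eventually_sequentially by blast
      \<comment> \<open>\<open>cone_C4\<close> constrains every member of the sequence, while
        \<open>x\<close> lies in \<open>U\<close> only eventually; hence the shift.\<close>
      let ?y = "\<lambda>i. x (i + N)"
      have y: "?y \<longlonglongrightarrow> p" using x(2) by (rule LIMSEQ_ignore_initial_segment)
      have "P v + A (?y i) (P v) \<in> tangent_space X (?y i)" for i
      proof -
        have "?y i \<in> X \<inter> U" using N by simp
        then show ?thesis using T[of "?y i"] x(1) graph_space_eq_image[OF P A] by auto
      qed
      moreover have "(\<lambda>i. P v + A (?y i) (P v)) \<longlonglongrightarrow> P v + A p (P v)"
        by (intro tendsto_add tendsto_const limA[OF y]) (use N in simp)
      moreover have "P v + A p (P v) = v"
        using graph_spaceD[OF v] graph_mapD(2)[OF A] p U by simp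
      ultimately have "(\<forall>i. ?y i \<in> Reg1 X \<and> P v + A (?y i) (P v) \<in> tangent_space X (?y i)) \<and>
          ?y \<longlonglongrightarrow> p \<and> (\<lambda>i. P v + A (?y i) (P v)) \<longlonglongrightarrow> v"
        using y x(1) by simp
      then show "v \<in> cone_C4 X p" unfolding cone_C4_def mem_Collect_eq
        by (intro exI[of _ ?y] exI[of _ "\<lambda>i. P v + A (?y i) (P v)"])
    qed
  qed
qed

section \<open>Graphs of \<open>C\<^sup>1\<close> maps\<close>

lemma Ck_Suc_imp_C1:
  assumes "Ck (Suc k) \<alpha> W h" "0 \<le> \<alpha>"
  shows "Ck 1 0 W h"
proof -
  obtain h' where h': "\<And>x. x \<in> W \<Longrightarrow> (h has_derivative h' x) (at x)" "\<And>v. Ck k \<alpha> W (\<lambda>x. h' x v)"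
    using assms(1) unfolding Ck.simps by blast
  have "continuous_on W (\<lambda>x. h' x v)" for v by (rule Ck_continuous_on[OF h'(2) assms(2)])
  then show ?thesis using h'(1) unfolding One_nat_def Ck.simps
    by (intro exI[of _ h']) auto
qed

lemma Ck_graph_D:
  assumes "Ck_graph k \<alpha> P W h Y"
  shows "open W" "Ck k \<alpha> W h" "h (P x) = h x" "P x \<in> W \<longleftrightarrow> x \<in> W" "x \<in> W \<Longrightarrow> P (h x) = 0"
    "x \<in> Y \<longleftrightarrow> x \<in> W \<and> x = P x + h x"
  using assms unfolding Ck_graph_def by auto

lemma Ck_graph_C1:
  assumes "Ck_graph (Suc k) \<alpha> P W h Y" "0 \<le> \<alpha>"
  shows "Ck_graph 1 0 P W h Y"
  using assms Ck_Suc_imp_C1 unfolding Ck_graph_def by blast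

lemma path_length_Lipschitz:
  fixes \<gamma> :: "real \<Rightarrow> 'a::metric_space"
  assumes lip: "\<And>s t. s \<in> {0..1} \<Longrightarrow> t \<in> {0..1} \<Longrightarrow> dist (\<gamma> s) (\<gamma> t) \<le> K * \<bar>s - t\<bar>" and "0 \<le> K"
  shows "path_length \<gamma> \<le> ennreal K"
  unfolding path_length_def
proof (rule SUP_least, clarify, rule ennreal_leI)
  fix ts :: "real list" assume ts: "sorted ts" "set ts \<subseteq> {0..1}"
  show "(\<Sum>i<length ts - 1. dist (\<gamma> (ts ! i)) (\<gamma> (ts ! Suc i))) \<le> K"
  proof (cases "ts = []")
    case True then show ?thesis using assms(2) by simp
  next
    case False
    have mem: "ts ! i \<in> {0..1}" if "i \<le> length ts - 1" for i
      using ts(2) that False nth_mem[of i ts] by (metis One_nat_def Suc_pred le_imp_less_Suc length_greater_0_conv subsetD)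
    have "(\<Sum>i<length ts - 1. dist (\<gamma> (ts ! i)) (\<gamma> (ts ! Suc i))) \<le> (\<Sum>i<length ts - 1. K * (ts ! Suc i - ts ! i))"
    proof (rule sum_mono)
      fix i assume "i \<in> {..<length ts - 1}"
      then have i: "i < length ts - 1" by simp
      have "ts ! i \<le> ts ! Suc i" using ts(1) i by (simp add: sorted_iff_nth_Suc less_diff_conv)
      then show "dist (\<gamma> (ts ! i)) (\<gamma> (ts ! Suc i)) \<le> K * (ts ! Suc i - ts ! i)"
        using lip[OF mem mem, of i "Suc i"] i by simp
    qed
    also have "\<dots> = K * (ts ! (length ts - 1) - ts ! 0)"
      by (simp add: sum_distrib_left[symmetric] sum_lessThan_telescope)
    also have "\<dots> \<le> K * 1"
      using mem[of 0] mem[of "length ts - 1"] assms(2) by (intro mult_left_mono) auto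
    finally show ?thesis by simp
  qed
qed

section \<open>Tangent spaces, tangent cones and inner distance of a graph\<close>

context
  fixes P :: "real ^ 'n::finite \<Rightarrow> real ^ 'n" and W h Y h'
  assumes P: "orth_projection P" and G: "Ck_graph 1 0 P W h Y"
    and h': "\<And>x. x \<in> W \<Longrightarrow> (h has_derivative h' x) (at x)" "\<And>v. continuous_on W (\<lambda>x. h' x v)"
begin

text \<open>Differentiate the identities \<open>h (P y) = h y\<close> and, on \<open>W\<close>,
  \<open>P (h y) = 0\<close>. The first one is used at \<open>x\<close> and at \<open>P x\<close>,
  which makes the derivative constant along fibres too.\<close>

lemma graph_derivative_graph_map:
  assumes x: "x \<in> W"
  shows "graph_map P (h' x)" and "h' (P x) = h' x"
proof -
  note linP = orth_projectionD(1)[OF P] and PP = orth_projectionD(2)[OF P]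
  have Px: "P x \<in> W" using x Ck_graph_D(4)[OF G] by simp
  have "((\<lambda>y. h (P y)) has_derivative (\<lambda>v. h' (P x) (P v))) (at x)"
    using has_derivative_compose[OF bounded_linear_imp_has_derivative[OF orth_projectionD(4)[OF P]] h'(1)[OF Px]] .
  then have "(h has_derivative (\<lambda>v. h' (P x) (P v))) (at x)" by (simp add: Ck_graph_D(3)[OF G])
  then have eq: "h' x v = h' (P x) (P v)" for v using has_derivative_unique[OF h'(1)[OF x]] by metis
  have "((\<lambda>y. h (P y)) has_derivative (\<lambda>v. h' (P x) (P v))) (at (P x))"
    using has_derivative_compose[OF bounded_linear_imp_has_derivative[OF orth_projectionD(4)[OF P]], of h "h' (P x)" "P x"] h'(1)[OF Px] PP by simp
  then have "(h has_derivative (\<lambda>v. h' (P x) (P v))) (at (P x))" by (simp add: Ck_graph_D(3)[OF G])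
  then have eq': "h' (P x) v = h' (P x) (P v)" for v using has_derivative_unique[OF h'(1)[OF Px]] by metis
  show "h' (P x) = h' x" using eq eq' by auto
  have "((\<lambda>y. P (h y)) has_derivative (\<lambda>v. P (h' x v))) (at x)"
    using bounded_linear.has_derivative[OF orth_projectionD(4)[OF P] h'(1)[OF x]] .
  then have "((\<lambda>y. 0) has_derivative (\<lambda>v. P (h' x v))) (at x)"
    by (rule has_derivative_transform_within_open[OF _ Ck_graph_D(1)[OF G] x]) (simp add: Ck_graph_D(5)[OF G])
  then have "P (h' x v) = 0" for v
    using has_derivative_unique[OF has_derivative_const] by metis
  then show "graph_map P (h' x)"
    unfolding graph_map_def using eq PP has_derivative_linear[OF h'(1)[OF x]] by simp
qed

lemma graph_point:
  assumes "c \<in> W" "P c = c"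
  shows "c + h c \<in> Y" "P (c + h c) = c" "h (c + h c) = h c"
proof -
  show Pc: "P (c + h c) = c"
    using assms Ck_graph_D(5)[OF G] by (simp add: linear_add[OF orth_projectionD(1)[OF P]])
  show hc: "h (c + h c) = h c" using Pc Ck_graph_D(3)[OF G] by metis
  show "c + h c \<in> Y" using Pc hc assms Ck_graph_D(4,6)[OF G] by metis
qed

text \<open>A curve in \<open>X\<close> satisfies
  \<open>\<gamma> t = P (\<gamma> t) + h (\<gamma> t)\<close> as long as it stays in
  \<open>U\<close>, and differentiating at \<open>0\<close> gives the graph equation for its
  velocity. Conversely, a vector of the graph is the velocity of a lifted straight line.\<close>

lemma tangent_space_graph:
  assumes U: "open U" "Y = X \<inter> U" and x: "x \<in> Y"
  shows "tangent_space X x = graph_space P (h' x)"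
proof
  note linP = orth_projectionD(1)[OF P] and PP = orth_projectionD(2)[OF P]
  have xW: "x \<in> W" and xeq: "x = P x + h x" using Ck_graph_D(6)[OF G] x by blast+
  show "tangent_space X x \<subseteq> graph_space P (h' x)"
  proof
    fix v assume "v \<in> tangent_space X x"
    then obtain \<gamma> \<epsilon> where \<gamma>: "\<epsilon> > 0" "\<gamma> C1_differentiable_on {-\<epsilon><..<\<epsilon>}" "\<gamma> ` {-\<epsilon><..<\<epsilon>} \<subseteq> X" "\<gamma> 0 = x"
      "(\<gamma> has_vector_derivative v) (at 0)" unfolding tangent_space_def by blast
    have "continuous_on {-\<epsilon><..<\<epsilon>} \<gamma>" by (rule C1_differentiable_imp_continuous_on[OF \<gamma>(2)])
    then have op: "open ({-\<epsilon><..<\<epsilon>} \<inter> \<gamma> -` U)" using U(1) by (simp add: continuous_on_open_vimage Int_commute)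
    have 0: "0 \<in> {-\<epsilon><..<\<epsilon>} \<inter> \<gamma> -` U" using \<gamma>(1,4) x U(2) by simp
    have d\<gamma>: "(\<gamma> has_derivative (\<lambda>s. s *\<^sub>R v)) (at 0)" using \<gamma>(5) by (simp add: has_vector_derivative_def)
    have d1: "((\<lambda>t. P (\<gamma> t)) has_derivative (\<lambda>s. P (s *\<^sub>R v))) (at 0)"
      by (rule bounded_linear.has_derivative[OF orth_projectionD(4)[OF P] d\<gamma>])
    have "(h has_derivative h' x) (at (\<gamma> 0))" using h'(1)[OF xW] \<gamma>(4) by simp
    from has_derivative_compose[OF d\<gamma> this]
    have der: "((\<lambda>t. P (\<gamma> t) + h (\<gamma> t)) has_derivative (\<lambda>s. P (s *\<^sub>R v) + h' x (s *\<^sub>R v))) (at 0)"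
      by (rule has_derivative_add[OF d1])
    have "((\<lambda>t. P (\<gamma> t) + h (\<gamma> t)) has_derivative (\<lambda>s. s *\<^sub>R v)) (at 0)"
    proof (rule has_derivative_transform_within_open[OF d\<gamma> op 0])
      fix t assume "t \<in> {-\<epsilon><..<\<epsilon>} \<inter> \<gamma> -` U"
      then have "\<gamma> t \<in> Y" using \<gamma>(3) U(2) by blast
      then show "\<gamma> t = P (\<gamma> t) + h (\<gamma> t)" using Ck_graph_D(6)[OF G] by blast
    qed
    then have eq: "(\<lambda>s. P (s *\<^sub>R v) + h' x (s *\<^sub>R v)) = (\<lambda>s. s *\<^sub>R v)"
      by (rule has_derivative_unique[OF der])
    have "P v + h' x v = v" using fun_cong[OF eq, of 1] by simp
    then show "v \<in> graph_space P (h' x)" unfolding graph_space_def mem_Collect_eq by (rule sym)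
  qed
  show "graph_space P (h' x) \<subseteq> tangent_space X x"
  proof
    fix v assume v: "v \<in> graph_space P (h' x)"
    \<comment> \<open>The straight line in the base through \<open>P x\<close> with direction
      \<open>P v\<close>; its lift to the graph will have velocity \<open>v\<close>.\<close>
    define c where "c t = P x + t *\<^sub>R P v" for t :: real
    have Pc: "P (c t) = c t" for t by (simp add: c_def linear_add[OF linP] linear_scale[OF linP] PP)
    have contc: "continuous_on UNIV c" unfolding c_def by (intro continuous_intros)
    have "open (c -` W)" using Ck_graph_D(1)[OF G] contc by (metis continuous_on_open_vimage open_UNIV inf_top.right_neutral)
    moreover have "0 \<in> c -` W" using xW Ck_graph_D(4)[OF G] by (simp add: c_def)
    ultimately obtain \<epsilon> where \<epsilon>: "\<epsilon> > 0" "ball 0 \<epsilon> \<subseteq> c -` W" using open_contains_ball by blast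
    have cW: "c t \<in> W" if "t \<in> {-\<epsilon><..<\<epsilon>}" for t
      using that \<epsilon>(2) by (auto simp: dist_norm subset_iff)
    define \<gamma> where "\<gamma> t = c t + h (c t)" for t
    have der: "(\<gamma> has_vector_derivative (P v + h' (c t) (P v))) (at t)" if t: "t \<in> {-\<epsilon><..<\<epsilon>}" for t
    proof -
      have dc: "(c has_derivative (\<lambda>s. s *\<^sub>R P v)) (at t)"
        unfolding c_def by (auto intro!: derivative_eq_intros)
      have "(\<gamma> has_derivative (\<lambda>s. s *\<^sub>R P v + h' (c t) (s *\<^sub>R P v))) (at t)"
        unfolding \<gamma>_def by (rule has_derivative_add[OF dc has_derivative_compose[OF dc h'(1)[OF cW[OF t]]]])
      then show ?thesis
        using linear_scale[OF has_derivative_linear[OF h'(1)[OF cW[OF t]]]]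
        by (simp add: has_vector_derivative_def scaleR_add_right)
    qed
    have cont: "continuous_on {-\<epsilon><..<\<epsilon>} (\<lambda>t. P v + h' (c t) (P v))"
      by (intro continuous_on_add continuous_on_const continuous_on_compose2[OF h'(2)[of "P v"]]
          continuous_on_subset[OF contc]) (use cW in auto)
    have "\<gamma> C1_differentiable_on {-\<epsilon><..<\<epsilon>}"
      unfolding C1_differentiable_on_def using der cont by (intro exI[of _ "\<lambda>t. P v + h' (c t) (P v)"]) blast
    moreover have "\<gamma> ` {-\<epsilon><..<\<epsilon>} \<subseteq> X"
      using graph_point(1)[OF cW Pc] U(2) by (auto simp: \<gamma>_def)
    moreover have "\<gamma> 0 = x" using xeq Ck_graph_D(3)[OF G] by (simp add: \<gamma>_def c_def)
    moreover have "(\<gamma> has_vector_derivative v) (at 0)"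
    proof -
      have "P v + h' (c 0) (P v) = v"
        using graph_spaceD[OF v] graph_derivative_graph_map[OF xW] graph_mapD(2)[of P "h' x" v] by (simp add: c_def)
      then show ?thesis using der[of 0] \<epsilon>(1) by simp
    qed
    ultimately show "v \<in> tangent_space X x" unfolding tangent_space_def using \<epsilon>(1) by blast
  qed
qed

text \<open>On secants of the graph at \<open>x\<close>, the deviation \<open>R\<close> equals the
  remainder in the differentiability of \<open>h\<close>, so it is small to first order and
  \<open>R\<close> vanishes on the cone. The other inclusion comes from the tangent space.\<close>

lemma cone_C3_graph:
  assumes U: "open U" "Y = X \<inter> U" and x: "x \<in> Y"
  shows "cone_C3 X x = graph_space P (h' x)"
proof
  show "graph_space P (h' x) \<subseteq> cone_C3 X x"
    using tangent_space_subset_cone_C3[of X x] tangent_space_graph[OF U x] by simp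
  have xW: "x \<in> W" and xeq: "x = P x + h x" using Ck_graph_D(6)[OF G] x by blast+
  define R where "R v = v - P v - h' x v" for v
  have R: "bounded_linear R"
    unfolding R_def by (intro bounded_linear_sub bounded_linear_ident orth_projectionD(4)[OF P]
        has_derivative_bounded_linear[OF h'(1)[OF xW]])
  have small: "\<exists>r>0. \<forall>y\<in>X. dist y x < r \<longrightarrow> norm (R (y - x)) \<le> e * norm (y - x)" if "0 < e" for e
  proof -
    obtain r1 where r1: "r1 > 0" "ball x r1 \<subseteq> U" using U x open_contains_ball by blast
    obtain r2 where r2: "r2 > 0" "\<And>y. norm (y - x) < r2 \<Longrightarrow> norm (h y - h x - h' x (y - x)) \<le> e * norm (y - x)"
      using h'(1)[OF xW] \<open>0 < e\<close> unfolding has_derivative_at_alt by blast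
    have "norm (R (y - x)) \<le> e * norm (y - x)" if y: "y \<in> X" "dist y x < min r1 r2" for y
    proof -
      have "y \<in> Y" using y r1 U(2) by (auto simp: dist_commute subset_iff)
      then have "y = P y + h y" using Ck_graph_D(6)[OF G] by blast
      then have "R (y - x) = h y - h x - h' x (y - x)"
        using xeq unfolding R_def linear_diff[OF orth_projectionD(1)[OF P]] by (metis (no_types, opaque_lifting) add_diff_cancel_left' diff_diff_eq2 diff_add_eq diff_diff_add add_diff_eq)
      then show ?thesis using r2(2)[of y] y(2) by (simp add: dist_norm)
    qed
    then show ?thesis using r1(1) r2(1) by (intro exI[of _ "min r1 r2"]) auto
  qed
  show "cone_C3 X x \<subseteq> graph_space P (h' x)"
  proof
    fix v assume v: "v \<in> cone_C3 X x"
    have "R v = 0" by (rule cone_C3_kernel[OF R _ v]) (rule small)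
    then show "v \<in> graph_space P (h' x)" by (simp add: R_def graph_space_def algebra_simps)
  qed
qed

lemma LNE_at_graph:
  assumes U: "open U" "Y = X \<inter> U" and p: "p \<in> Y"
  shows "LNE_at X p"
proof -
  note linP = orth_projectionD(1)[OF P] and PP = orth_projectionD(2)[OF P]
  have PpW: "P p \<in> W" using Ck_graph_D(4,6)[OF G] p by blast
  have "Ck (Suc 0) 0 W h" using Ck_graph_D(2)[OF G] by simp
  from Ck_Lipschitz[OF this Ck_graph_D(1)[OF G]] have Lip: "Ck 0 1 W h" by simp
  obtain r c where r: "0 < r" "0 \<le> c" "ball (P p) r \<subseteq> W"
    "\<And>y z. y \<in> ball (P p) r \<Longrightarrow> z \<in> ball (P p) r \<Longrightarrow> norm (h y - h z) \<le> c * norm (y - z)"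
    using Ck_0_1_D[OF Lip PpW Ck_graph_D(1)[OF G]] by metis
  \<comment> \<open>A cylinder over a ball, because the lift of a segment of the base must stay in
    the neighbourhood: the ball is convex, and lifted points lie in \<open>Y\<close>, hence in
    \<open>U\<close>. The constant \<open>1 + c\<close> below is \<open>1\<close> for
    \<open>P\<close> plus \<open>c\<close> for \<open>h\<close>.\<close>
  define V where "V = U \<inter> P -` ball (P p) r"
  have "open (P -` ball (P p) r)"
    using orth_projectionD(4)[OF P] by (metis continuous_on_open_vimage open_UNIV open_ball linear_continuous_on inf_top.right_neutral)
  then have V: "open V" "p \<in> V" using U p r(1) by (auto simp: V_def)
  have "inner_dist (X \<inter> V) x y \<le> ennreal ((1 + c) * norm (x - y))" if xy: "x \<in> X \<inter> V" "y \<in> X \<inter> V" for x y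
  proof -
    define s where "s t = P x + t *\<^sub>R (P y - P x)" for t :: real
    define \<gamma> where "\<gamma> t = s t + h (s t)" for t
    have Ps: "P (s t) = s t" for t
      by (simp add: s_def linear_add[OF linP] linear_scale[OF linP] linear_diff[OF linP] PP)
    have sb: "s t \<in> ball (P p) r" if "t \<in> {0..1}" for t
    proof -
      have "s t = (1 - t) *\<^sub>R P x + t *\<^sub>R P y" by (simp add: s_def algebra_simps)
      then show ?thesis using that xy convexD_alt[OF convex_ball[of "P p" r], of "P x" "P y" t] by (simp add: V_def)
    qed
    have lip: "dist (\<gamma> a) (\<gamma> b) \<le> ((1 + c) * norm (x - y)) * \<bar>a - b\<bar>" if "a \<in> {0..1}" "b \<in> {0..1}" for a b
    proof -
      have "s a - s b = (a - b) *\<^sub>R (P y - P x)" by (simp add: s_def algebra_simps)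
      then have ns: "norm (s a - s b) = \<bar>a - b\<bar> * norm (P (y - x))" by (simp add: linear_diff[OF linP])
      have "dist (\<gamma> a) (\<gamma> b) \<le> norm (s a - s b) + norm (h (s a) - h (s b))"
        unfolding dist_norm \<gamma>_def by (metis add_diff_add norm_triangle_ineq)
      also have "\<dots> \<le> (1 + c) * norm (s a - s b)" using r(4)[OF sb[OF that(1)] sb[OF that(2)]] by (simp add: algebra_simps)
      also have "\<dots> \<le> (1 + c) * (\<bar>a - b\<bar> * norm (y - x))"
        unfolding ns using norm_orth_projection_le[OF P, of "y - x"] r(2) by (intro mult_left_mono) auto
      finally show ?thesis by (simp add: algebra_simps norm_minus_commute)
    qed
    have "continuous_on {0..1} (\<lambda>t. s t + h (s t))"
    proof (rule continuous_on_compose2[of "ball (P p) r" "\<lambda>z. z + h z" "{0..1}" s])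
      have "continuous_on (ball (P p) r) h" using Ck_continuous_on[OF Lip] r(3) continuous_on_subset by auto
      then show "continuous_on (ball (P p) r) (\<lambda>z. z + h z)" by (intro continuous_intros)
      show "continuous_on {0..1} s" unfolding s_def by (intro continuous_intros)
    qed (use sb in blast)
    then have path: "path \<gamma>" by (simp add: path_def \<gamma>_def[abs_def])
    have im: "path_image \<gamma> \<subseteq> X \<inter> V"
    proof -
      have "\<gamma> t \<in> X \<inter> V" if "t \<in> {0..1}" for t
        using graph_point(1,2)[OF _ Ps, of t] sb[OF that] r(3) U(2) by (auto simp: \<gamma>_def V_def)
      then show ?thesis by (auto simp: path_image_def)
    qed
    have Y: "z = P z + h (P z)" if "z \<in> X \<inter> V" for z
    proof -
      have "z \<in> Y" using that U(2) by (auto simp: V_def)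
      then show ?thesis using Ck_graph_D(3,6)[OF G] by metis
    qed
    have "pathstart \<gamma> = x" "pathfinish \<gamma> = y"
      using Y[OF xy(1)] Y[OF xy(2)] by (simp_all add: pathstart_def pathfinish_def \<gamma>_def s_def)
    with path im have "inner_dist (X \<inter> V) x y \<le> path_length \<gamma>"
      unfolding inner_dist_def by (intro INF_lower) simp
    also have "\<dots> \<le> ennreal ((1 + c) * norm (x - y))"
      by (rule path_length_Lipschitz[OF lip]) (use r(2) in auto)
    finally show ?thesis .
  qed
  then show ?thesis unfolding LNE_at_def using V r(2)
    by (intro exI[of _ V] exI[of _ "1 + c"]) (auto simp: interior_open)
qed

end

lemma Ck_graph_1_0_derivative:
  assumes "Ck_graph 1 0 P W h Y"
  obtains h' where "\<And>x. x \<in> W \<Longrightarrow> (h has_derivative h' x) (at x)" "\<And>v. continuous_on W (\<lambda>x. h' x v)"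
  using Ck_graph_D(2)[OF assms] unfolding One_nat_def Ck.simps by auto

text \<open>One local graph serves all nearby points of \<open>X\<close>, so regularity is an open
  condition in \<open>X\<close> and the dimension is locally constant.\<close>

lemma Reg1_dimension:
  fixes X :: "(real ^ 'n::finite) set"
  assumes "submanifold_near e 1 0 X p"
  obtains V where "open V" "p \<in> V" "X \<inter> V \<subseteq> Reg1 X" "\<And>x. x \<in> X \<inter> V \<Longrightarrow> tangent_space X x \<in> Gr e"
proof -
  obtain P W h U where P: "orth_projection P" and d: "dim (range P) = e" and U: "open U" "p \<in> U"
    and G: "Ck_graph 1 0 P W h (X \<inter> U)"
    by (rule submanifold_near_imp_Ck_graph[OF assms order_refl zero_le_one])
  obtain h' where h': "\<And>x. x \<in> W \<Longrightarrow> (h has_derivative h' x) (at x)" "\<And>v. continuous_on W (\<lambda>x. h' x v)"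
    using Ck_graph_1_0_derivative[OF G] by blast
  show thesis
  proof (rule that[OF U])
    show "X \<inter> U \<subseteq> Reg1 X"
    proof clarify
      fix x assume "x \<in> X" "x \<in> U"
      have "submanifold_near e 1 0 X x"
        by (rule Ck_graph_imp_submanifold_near[OF P d U(1) \<open>x \<in> U\<close> G]) auto
      then show "x \<in> Reg1 X" using \<open>x \<in> X\<close> by (auto simp: Reg1_def)
    qed
    fix x assume x: "x \<in> X \<inter> U"
    then have "x \<in> W" using Ck_graph_D(6)[OF G] by blast
    then show "tangent_space X x \<in> Gr e"
      using tangent_space_graph[OF P G h' U(1) refl x] graph_space_in_Gr[OF P graph_derivative_graph_map(1)[OF P G h']] d
      by simp
  qed
qed

section \<open>Smooth sets satisfy the three conditions\<close>

text \<open>Continuity is assumed for each fixed \<open>v\<close>; finitely many basis vectors make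
  the closeness uniform in \<open>v\<close>.\<close>

lemma linear_family_close:
  fixes A :: "'b::metric_space \<Rightarrow> 'a::euclidean_space \<Rightarrow> 'c::real_normed_vector"
  assumes lin: "\<And>y. y \<in> W \<Longrightarrow> linear (A y)" and cont: "\<And>v. continuous_on W (\<lambda>y. A y v)"
    and x: "x \<in> W" and e: "0 < e"
  obtains r where "0 < r" "\<And>y v. y \<in> W \<Longrightarrow> dist y x < r \<Longrightarrow> norm (A y v - A x v) \<le> e * norm v"
proof -
  define g where "g y = (\<Sum>b\<in>Basis. norm (A y b - A x b))" for y
  have "continuous_on W g" unfolding g_def by (intro continuous_intros cont)
  then obtain r where r: "r > 0" "\<And>y. y \<in> W \<Longrightarrow> dist y x < r \<Longrightarrow> dist (g y) (g x) < e"
    using x e unfolding continuous_on_iff by metis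
  show thesis
  proof (rule that[OF r(1)])
    fix y v assume y: "y \<in> W" "dist y x < r"
    have "A y v - A x v = (\<Sum>b\<in>Basis. (v \<bullet> b) *\<^sub>R (A y b - A x b))"
      using linear_eq_sum_Basis[OF lin[OF y(1)], of v] linear_eq_sum_Basis[OF lin[OF x], of v]
      by (simp add: sum_subtractf scaleR_diff_right)
    also have "norm \<dots> \<le> (\<Sum>b\<in>Basis. \<bar>v \<bullet> b\<bar> * norm (A y b - A x b))"
      by (rule order_trans[OF norm_sum]) simp
    also have "\<dots> \<le> (\<Sum>b\<in>Basis. norm v * norm (A y b - A x b))"
      by (intro sum_mono mult_right_mono) (auto simp: Basis_le_norm)
    also have "\<dots> = g y * norm v" by (simp add: g_def sum_distrib_left[symmetric])
    also have "\<dots> \<le> e * norm v"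
      using r(2)[OF y] by (intro mult_right_mono) (auto simp: g_def dist_real_def)
    finally show "norm (A y v - A x v) \<le> e * norm v" .
  qed
qed

lemma matrix_of_linear:
  fixes T :: "real ^ 'n::finite \<Rightarrow> real ^ 'm::finite"
  assumes "linear T" shows "matrix T *v x = T x"
  using assms by (simp add: matrix_works linear_matrix_vector_mul_eq)

lemma Ck_matrix:
  fixes A :: "'a::euclidean_space \<Rightarrow> real ^ 'n::finite \<Rightarrow> real ^ 'm::finite"
  assumes "\<And>v. Ck k \<alpha> W (\<lambda>x. A x v)"
  shows "Ck k \<alpha> W (\<lambda>x. matrix (A x))"
proof -
  \<comment> \<open>\<open>E j v\<close> is the matrix with \<open>j\<close>-th column
    \<open>v\<close> and all other columns \<open>0\<close>.\<close>
  define E :: "'n \<Rightarrow> real ^ 'm \<Rightarrow> real ^ 'n ^ 'm" where "E j v = (\<chi> i l. if l = j then v $ i else 0)" for j v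
  have E: "bounded_linear (E j)" for j
    unfolding linear_conv_bounded_linear[symmetric] by (rule linearI) (auto simp: E_def vec_eq_iff)
  have "matrix (A x) = (\<Sum>j\<in>UNIV. E j (A x (axis j 1)))" for x
    by (simp add: vec_eq_iff matrix_def E_def)
  then show ?thesis using assms by (simp only:) (intro Ck_sum Ck_bounded_linear_compose[OF E])
qed

lemma Ck_Pair:
  assumes "Ck k \<alpha> W f" "Ck k \<alpha> W g"
  shows "Ck k \<alpha> W (\<lambda>x. (f x, g x))"
proof -
  have "Ck k \<alpha> W (\<lambda>x. (f x, 0) + (0, g x))"
    by (intro Ck_add Ck_bounded_linear_compose[of "\<lambda>a. (a, 0)"] Ck_bounded_linear_compose[of "\<lambda>a. (0, a)"]
        bounded_linear_Pair bounded_linear_ident bounded_linear_zero assms)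
  then show ?thesis by simp
qed

lemma topspace_Gr_topology: "topspace (Gr_topology d) = Gr d"
  unfolding Gr_topology_def by (rule Metric_space.topspace_mtopology[OF Metric_space_Gr])

lemma subtopology_Nash_ambient:
  fixes X :: "(real ^ 'n::finite) set"
  shows "subtopology (Nash_ambient d) (X \<times> Gr d) = prod_topology (top_of_set X) (Gr_topology d)"
  using subtopology_topspace[of "Gr_topology d :: (real ^ 'n) set topology"]
  by (simp add: Nash_ambient_def subtopology_Times topspace_Gr_topology)

lemma submanifold_near_imp_Ck_graph_derivative:
  fixes X :: "(real ^ 'n::finite) set"
  assumes "submanifold_near d (Suc k) \<alpha> X p" and \<alpha>: "0 \<le> \<alpha>" "\<alpha> \<le> 1"
  obtains P W h U h' where "orth_projection P" "dim (range P) = d" "open U" "p \<in> U" "Ck_graph 1 0 P W h (X \<inter> U)"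
    "open W" "\<And>x. x \<in> W \<Longrightarrow> (h has_derivative h' x) (at x)" "\<And>v. continuous_on W (\<lambda>x. h' x v)"
    "\<And>v. Ck k \<alpha> W (\<lambda>x. h' x v)"
proof -
  obtain P W h U where P: "orth_projection P" "dim (range P) = d" and U: "open U" "p \<in> U"
    and G: "Ck_graph (Suc k) \<alpha> P W h (X \<inter> U)"
    by (rule submanifold_near_imp_Ck_graph[OF assms])
  obtain h' where h': "\<And>x. x \<in> W \<Longrightarrow> (h has_derivative h' x) (at x)" "\<And>v. Ck k \<alpha> W (\<lambda>x. h' x v)"
    using Ck_graph_D(2)[OF G] unfolding Ck.simps by blast
  show thesis
    by (rule that[OF P U Ck_graph_C1[OF G \<alpha>(1)] Ck_graph_D(1)[OF G] h'(1) Ck_continuous_on[OF h'(2) \<alpha>(1)] h'(2)])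
qed

text \<open>The graph of a continuous map into a Hausdorff space is closed, so the closure in the
  Nash space adds nothing, and a graph projects homeomorphically onto its base.\<close>

lemma Nash_space_eq_graph:
  fixes X :: "(real ^ 'n::finite) set"
  assumes Reg: "Reg1 X = X" and cont: "continuous_map (top_of_set X) (Gr_topology d) (tangent_space X)"
  shows "Nash_space d X = (\<lambda>x. (x, tangent_space X x)) ` X" "Nash_map_homeomorphism d X"
proof -
  let ?G = "Gr_topology d :: (real ^ 'n) set topology" and ?T = "tangent_space X"
  let ?g = "(\<lambda>x. (x, ?T x)) ` X"
  have T: "?T x \<in> Gr d" if "x \<in> X" for x
    using continuous_map_image_subset_topspace[OF cont] that by (auto simp: topspace_Gr_topology)
  note sub = subtopology_Nash_ambient[of d X]
  have "Hausdorff_space ?G"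
    unfolding Gr_topology_def by (rule Metric_space.Hausdorff_space_mtopology[OF Metric_space_Gr])
  then have "closedin (prod_topology (top_of_set X) ?G)
      {z \<in> topspace (prod_topology (top_of_set X) ?G). snd z = (?T \<circ> fst) z}"
    by (intro closedin_continuous_maps_eq[of ?G] continuous_map_snd continuous_map_compose[OF continuous_map_fst cont])
  moreover have "{z \<in> topspace (prod_topology (top_of_set X) ?G). snd z = (?T \<circ> fst) z} = ?g"
    using T by (auto simp: topspace_Gr_topology)
  ultimately have "closedin (prod_topology (top_of_set X) ?G) ?g" by simp
  moreover have "{(x, ?T x) | x. x \<in> Reg1 X} = ?g" using Reg by auto
  ultimately show N: "Nash_space d X = ?g"
    unfolding Nash_space_def sub by (simp add: closure_of_closedin)
  have g: "?g \<subseteq> X \<times> Gr d" using T by auto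
  have "subtopology (Nash_ambient d) (Nash_space d X) = subtopology (prod_topology (top_of_set X) ?G) ?g"
    unfolding N sub[symmetric] using g by (simp add: subtopology_subtopology Int_absorb1)
  moreover have "homeomorphic_maps (top_of_set X) (subtopology (prod_topology (top_of_set X) ?G) ?g) (\<lambda>x. (x, ?T x)) fst"
    using cont homeomorphic_maps_graph[of "top_of_set X" ?G ?T] by simp
  ultimately show "Nash_map_homeomorphism d X"
    unfolding Nash_map_homeomorphism_def using homeomorphic_maps_sym homeomorphic_maps_map by metis
qed

theorem smooth_set_imp_conditions:
  fixes X :: "(real ^ 'n::finite) set"
  assumes sm: "smooth_set d (Suc k) \<alpha> X" and \<alpha>: "0 \<le> \<alpha>" "\<alpha> \<le> 1"
  shows "Nash_map_homeomorphism d X" "Ck_into_on (Rn_Gr_atlas d) k \<alpha> X (Nash_map_inverse d X)"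
    "\<And>p. p \<in> X \<Longrightarrow> LNE_at X p" "\<And>p. p \<in> X \<Longrightarrow> cone_C3 X p = cone_C4 X p"
proof -
  let ?T = "tangent_space X"
  have near: "submanifold_near d (Suc k) \<alpha> X p" if "p \<in> X" for p using sm that by (simp add: smooth_set_def)
  have near1: "submanifold_near d 1 0 X p" if p: "p \<in> X" for p
  proof -
    obtain P W h U where "orth_projection P" "dim (range P) = d" "open U" "p \<in> U" "Ck_graph (Suc k) \<alpha> P W h (X \<inter> U)"
      by (rule submanifold_near_imp_Ck_graph[OF near[OF p] \<alpha>])
    then show ?thesis using Ck_graph_C1[OF _ \<alpha>(1)] Ck_graph_imp_submanifold_near order_refl zero_le_one by metis
  qed
  then have Reg: "Reg1 X = X" by (auto simp: Reg1_def)
  have TG: "?T x \<in> Gr d" if x: "x \<in> X" for x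
    using Reg1_dimension[OF near1[OF x]] x by blast
  have cont: "continuous_map (top_of_set X) (Gr_topology d) ?T"
    unfolding Gr_topology_def Metric_space.continuous_map_to_metric[OF Metric_space_Gr]
  proof (intro ballI allI impI)
    fix x and \<epsilon> :: real assume "x \<in> topspace (top_of_set X)" and \<epsilon>: "\<epsilon> > 0"
    then have x: "x \<in> X" by simp
    obtain P W h U h' where P: "orth_projection P" "dim (range P) = d" and U: "open U" "x \<in> U" and G: "Ck_graph 1 0 P W h (X \<inter> U)"
      and h': "\<And>x. x \<in> W \<Longrightarrow> (h has_derivative h' x) (at x)" "\<And>v. continuous_on W (\<lambda>x. h' x v)"
      using submanifold_near_imp_Ck_graph_derivative[OF near[OF x] \<alpha>] by metis
    have gm: "graph_map P (h' y)" if "y \<in> W" for y by (rule graph_derivative_graph_map(1)[OF P(1) G h' that])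
    have TX: "?T y = graph_space P (h' y)" "y \<in> W" if "y \<in> X \<inter> U" for y
      using tangent_space_graph[OF P(1) G h' U(1) refl that] Ck_graph_D(6)[OF G] that by auto
    \<comment> \<open>\<open>1/2\<close> gives the condition \<open>e < 1\<close> of
      \<open>Gr_dist_graph_space\<close>, and \<open>\<epsilon> / 4\<close> turns its bound
      \<open>2 * e\<close> into something below \<open>\<epsilon>\<close>.\<close>
    define e where "e = min (1/2) (\<epsilon> / 4)"
    have e: "0 < e" "e < 1" "2 * e < \<epsilon>" using \<epsilon> by (auto simp: e_def)
    have xW: "x \<in> W" using TX(2) x U(2) by blast
    obtain r where r: "0 < r" "\<And>y v. y \<in> W \<Longrightarrow> dist y x < r \<Longrightarrow> norm (h' y v - h' x v) \<le> e * norm v"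
      using linear_family_close[OF graph_mapD(1)[OF gm] h'(2) xW e(1)] by metis
    show "\<exists>V. openin (top_of_set X) V \<and> x \<in> V \<and> (\<forall>y\<in>V. ?T y \<in> Metric_space.mball (Gr d) Gr_dist (?T x) \<epsilon>)"
    proof (intro exI conjI ballI)
      show "openin (top_of_set X) (X \<inter> (U \<inter> ball x r))" by (intro openin_open_Int open_Int open_ball U(1))
      show "x \<in> X \<inter> (U \<inter> ball x r)" using x U r by simp
      fix y assume y: "y \<in> X \<inter> (U \<inter> ball x r)"
      then have yU: "y \<in> X \<inter> U" and yr: "dist y x < r" by (auto simp: dist_commute)
      have "Gr_dist (?T x) (?T y) \<le> 2 * e"
        using Gr_dist_graph_space[OF P(1) gm[OF xW] gm[OF TX(2)[OF yU]], of e] r(2)[OF TX(2)[OF yU] yr] e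
          TX(1)[OF yU] TX(1)[of x] x U(2) by (simp add: norm_minus_commute)
      then show "?T y \<in> Metric_space.mball (Gr d) Gr_dist (?T x) \<epsilon>"
        using TG x y e by (simp add: Metric_space.in_mball[OF Metric_space_Gr])
    qed
  qed
  note N = Nash_space_eq_graph[OF Reg cont]
  show "Nash_map_homeomorphism d X" by (rule N(2))
  have inv: "Nash_map_inverse d X x = (x, ?T x)" if "x \<in> X" for x
    unfolding Nash_map_inverse_def N(1) by (rule inv_into_f_eq) (use that in \<open>auto simp: inj_on_def\<close>)
  show "Ck_into_on (Rn_Gr_atlas d) k \<alpha> X (Nash_map_inverse d X)"
    unfolding Ck_into_on_def
  proof
    fix p assume p: "p \<in> X"
    obtain P W h U h' where P: "orth_projection P" "dim (range P) = d" and U: "open U" "p \<in> U" and G: "Ck_graph 1 0 P W h (X \<inter> U)"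
      and W: "open W"
      and h': "\<And>x. x \<in> W \<Longrightarrow> (h has_derivative h' x) (at x)" "\<And>v. continuous_on W (\<lambda>x. h' x v)" "\<And>v. Ck k \<alpha> W (\<lambda>x. h' x v)"
      using submanifold_near_imp_Ck_graph_derivative[OF near[OF p] \<alpha>] by metis
    have gm: "graph_map P (h' y)" if "y \<in> W" for y by (rule graph_derivative_graph_map(1)[OF P(1) G h'(1,2) that])
    \<comment> \<open>The function \<open>h'\<close> is defined on the open set \<open>W\<close>, so
      \<open>F\<close> extends the Nash inverse off \<open>X\<close>. In the chart at
      \<open>range P\<close> its second component is the matrix of \<open>h' x\<close>.\<close>
    define F where "F x = (x, graph_space P (h' x))" for x
    define \<phi> where "\<phi> = (\<lambda>(x, L). (x :: real ^ 'n, Gr_chart (range P) L))"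
    have mat: "(*v) (matrix (h' x)) = h' x" if "x \<in> W" for x
      using matrix_of_linear[OF graph_mapD(1)[OF gm[OF that]]] by auto
    have chart: "graph_space P (h' x) \<in> Gr_chart_dom d (range P)"
      "Gr_chart (range P) (graph_space P (h' x)) = matrix (h' x)" if x: "x \<in> W" for x
      using Gr_chart_graph_space[OF P, of "matrix (h' x)"] gm[OF x] by (simp_all add: mat[OF x])
    have atlas: "(UNIV \<times> Gr_chart_dom d (range P), \<phi>) \<in> Rn_Gr_atlas d"
      unfolding Rn_Gr_atlas_def \<phi>_def using range_in_Gr[OF P(1)] P(2) by blast
    have "Ck k \<alpha> (W \<inter> U) (\<lambda>x. (x, matrix (h' x)))"
      by (intro Ck_Pair Ck_linear bounded_linear_ident open_Int W U \<alpha> Ck_matrix Ck_subset[OF h'(3)]) auto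
    then have "Ck k \<alpha> (W \<inter> U) (\<phi> \<circ> F)"
      by (rule Ck_cong) (use W U chart in \<open>auto simp: \<phi>_def F_def\<close>)
    moreover have "F ` (W \<inter> U) \<subseteq> UNIV \<times> Gr_chart_dom d (range P)" using chart by (auto simp: F_def)
    ultimately have into: "Ck_into (Rn_Gr_atlas d) k \<alpha> (W \<inter> U) F"
      unfolding Ck_into_def using atlas W U
      by (intro ballI bexI[OF _ atlas]) (auto intro!: exI[of _ "W \<inter> U"])
    have XW: "x \<in> W" "F x = Nash_map_inverse d X x" if "x \<in> X \<inter> U" for x
    proof -
      show "x \<in> W" using Ck_graph_D(6)[OF G] that by blast
      have "x \<in> X" using that by simp
      then show "F x = Nash_map_inverse d X x"
        by (simp only: F_def inv tangent_space_graph[OF P(1) G h'(1,2) U(1) refl that])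
    qed
    have "open (W \<inter> U)" "p \<in> W \<inter> U" using W U XW(1) p by auto
    with into XW(2) show "\<exists>U F. open U \<and> p \<in> U \<and> Ck_into (Rn_Gr_atlas d) k \<alpha> U F \<and>
        (\<forall>x\<in>X \<inter> U. F x = Nash_map_inverse d X x)"
      by (intro exI[of _ "W \<inter> U"] exI[of _ F]) auto
  qed
  fix p assume p: "p \<in> X"
  obtain P W h U h' where P: "orth_projection P" "dim (range P) = d" and U: "open U" "p \<in> U" and G: "Ck_graph 1 0 P W h (X \<inter> U)"
    and h': "\<And>x. x \<in> W \<Longrightarrow> (h has_derivative h' x) (at x)" "\<And>v. continuous_on W (\<lambda>x. h' x v)"
    using submanifold_near_imp_Ck_graph_derivative[OF near[OF p] \<alpha>] by metis
  have pU: "p \<in> X \<inter> U" using p U by simp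
  have XW: "X \<inter> U \<subseteq> W" using Ck_graph_D(6)[OF G] by blast
  show "LNE_at X p" by (rule LNE_at_graph[OF P(1) G h' U(1) refl pU])
  have "cone_C4 X p = graph_space P (h' p)"
  proof (rule cone_C4_eq_graph_space[OF P(1) U p])
    show "p \<in> closure (Reg1 X)" using Reg p closure_subset by blast
    show "graph_map P (h' x)" if "x \<in> X \<inter> U" for x
      using graph_derivative_graph_map(1)[OF P(1) G h'] XW that by blast
    show "continuous_on (X \<inter> U) (\<lambda>x. h' x v)" for v using h'(2) XW continuous_on_subset by blast
    show "tangent_space X x = graph_space P (h' x)" if "x \<in> Reg1 X \<inter> U" for x
      using tangent_space_graph[OF P(1) G h' U(1) refl] that Reg by blast
  qed
  then show "cone_C3 X p = cone_C4 X p" using cone_C3_graph[OF P(1) G h' U(1) refl pU] by simp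
qed

section \<open>Sets whose tangent cones vary continuously\<close>

text \<open>The sums in \<open>path_length\<close> for a list of times, in recursive form so that
  lists can be concatenated. The index type is arbitrary and no order is built in.\<close>

fun polygon_length :: "('b \<Rightarrow> 'a::metric_space) \<Rightarrow> 'b list \<Rightarrow> real" where
  "polygon_length \<gamma> (s # t # ts) = dist (\<gamma> s) (\<gamma> t) + polygon_length \<gamma> (t # ts)"
| "polygon_length \<gamma> ts = 0"

lemma polygon_length_eq_sum:
  "polygon_length \<gamma> ts = (\<Sum>i<length ts - 1. dist (\<gamma> (ts ! i)) (\<gamma> (ts ! Suc i)))"
proof (induction \<gamma> ts rule: polygon_length.induct)
  case (1 \<gamma> s t ts) then show ?case by (simp add: sum.lessThan_Suc_shift del: sum.lessThan_Suc)
qed auto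

lemma polygon_length_append:
  assumes "ts \<noteq> []" "us \<noteq> []"
  shows "polygon_length \<gamma> (ts @ us) = polygon_length \<gamma> ts + dist (\<gamma> (last ts)) (\<gamma> (hd us)) + polygon_length \<gamma> us"
  using assms
proof (induction \<gamma> ts rule: polygon_length.induct)
  case ("2_2" \<gamma> v) then show ?case by (cases us) auto
qed auto

lemma polygon_length_le:
  assumes "path_length \<gamma> \<le> ennreal K" "0 \<le> K" "sorted ts" "set ts \<subseteq> {0..1}"
  shows "polygon_length \<gamma> ts \<le> K"
proof -
  have "ennreal (polygon_length \<gamma> ts) \<le> path_length \<gamma>"
    unfolding path_length_def polygon_length_eq_sum by (rule SUP_upper) (use assms in auto)
  then have "ennreal (polygon_length \<gamma> ts) \<le> ennreal K" using assms(1) by (rule order_trans)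
  then show ?thesis using assms(2) by (simp add: ennreal_le_iff)
qed

text \<open>Subdivide until each piece is short enough for the estimate at some point of it, then
  add up. The radius \<open>\<eta>\<close> depends on \<open>t\<close>, so the subdivision comes
  from the bisection principle \<open>Bolzano\<close>.\<close>

lemma path_deviation:
  fixes \<gamma> :: "real \<Rightarrow> 'a::real_normed_vector" and R :: "'a \<Rightarrow> 'b::real_normed_vector"
  assumes len: "path_length \<gamma> \<le> ennreal K" "0 \<le> K" and R: "linear R" and \<epsilon>: "0 \<le> \<epsilon>"
    and loc: "\<And>t. t \<in> {0..1} \<Longrightarrow> \<exists>\<eta>>0. \<forall>s\<in>{0..1}. \<bar>s - t\<bar> < \<eta> \<longrightarrow> norm (R (\<gamma> s - \<gamma> t)) \<le> \<epsilon> * norm (\<gamma> s - \<gamma> t)"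
  shows "norm (R (\<gamma> 1 - \<gamma> 0)) \<le> \<epsilon> * K"
proof -
  \<comment> \<open>Each interval carries its own list of times as a witness. Joining the witnesses
    replaces additivity of \<open>path_length\<close> over subintervals.\<close>
  define Q where "Q a b \<longleftrightarrow> (0 \<le> a \<and> a \<le> b \<and> b \<le> 1 \<longrightarrow> (\<exists>ts. sorted ts \<and> set ts \<subseteq> {a..b} \<and> ts \<noteq> [] \<and> hd ts = a \<and> last ts = b \<and>
      norm (R (\<gamma> b - \<gamma> a)) \<le> \<epsilon> * polygon_length \<gamma> ts))" for a b
  have "Q 0 1"
  proof (rule Bolzano)
    show "(0::real) \<le> 1" by simp
    fix a b c assume Q: "Q a b" "Q b c" "a \<le> b" "b \<le> c"
    show "Q a c" unfolding Q_def
    proof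
      assume "0 \<le> a \<and> a \<le> c \<and> c \<le> 1"
      then have "0 \<le> a \<and> a \<le> b \<and> b \<le> 1" "0 \<le> b \<and> b \<le> c \<and> c \<le> 1" using Q(3,4) by linarith+
      note Q' = Q(1)[unfolded Q_def, rule_format, OF this(1)] Q(2)[unfolded Q_def, rule_format, OF this(2)]
      obtain ts where ts: "sorted ts" "set ts \<subseteq> {a..b}" "ts \<noteq> []" "hd ts = a" "last ts = b"
          "norm (R (\<gamma> b - \<gamma> a)) \<le> \<epsilon> * polygon_length \<gamma> ts"
        using Q'(1) by blast
      obtain us where us: "sorted us" "set us \<subseteq> {b..c}" "us \<noteq> []" "hd us = b" "last us = c"
          "norm (R (\<gamma> c - \<gamma> b)) \<le> \<epsilon> * polygon_length \<gamma> us"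
        using Q'(2) by blast
      have "norm (R (\<gamma> c - \<gamma> a)) \<le> norm (R (\<gamma> c - \<gamma> b)) + norm (R (\<gamma> b - \<gamma> a))"
        using norm_triangle_ineq[of "R (\<gamma> c - \<gamma> b)" "R (\<gamma> b - \<gamma> a)"] by (simp add: linear_diff[OF R])
      \<comment> \<open>The common end \<open>b\<close> occurs twice in \<open>ts @ us\<close> and
        contributes length \<open>0\<close>.\<close>
      also have "\<dots> \<le> \<epsilon> * polygon_length \<gamma> (ts @ us)"
        using ts(6) us(6) by (simp add: polygon_length_append[OF ts(3) us(3)] ts(5) us(4) algebra_simps)
      finally have dev: "norm (R (\<gamma> c - \<gamma> a)) \<le> \<epsilon> * polygon_length \<gamma> (ts @ us)" .
      have "sorted (ts @ us)" unfolding sorted_append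
      proof (intro conjI ballI ts(1) us(1))
        fix s u assume "s \<in> set ts" "u \<in> set us"
        then have "s \<le> b" "b \<le> u" using ts(2) us(2) by auto
        then show "s \<le> u" by linarith
      qed
      moreover have "set (ts @ us) \<subseteq> {a..c}"
      proof
        fix s assume "s \<in> set (ts @ us)"
        then have "s \<in> {a..b} \<or> s \<in> {b..c}" using ts(2) us(2) by auto
        then show "s \<in> {a..c}" using Q(3,4) by auto
      qed
      ultimately show "\<exists>ts. sorted ts \<and> set ts \<subseteq> {a..c} \<and> ts \<noteq> [] \<and> hd ts = a \<and> last ts = c \<and>
          norm (R (\<gamma> c - \<gamma> a)) \<le> \<epsilon> * polygon_length \<gamma> ts"
        using dev ts us by (intro exI[of _ "ts @ us"]) auto
    qed
  next
    fix t :: real assume "0 \<le> t" "t \<le> 1"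
    then obtain \<eta> where \<eta>: "\<eta> > 0" "\<And>s. s \<in> {0..1} \<Longrightarrow> \<bar>s - t\<bar> < \<eta> \<Longrightarrow> norm (R (\<gamma> s - \<gamma> t)) \<le> \<epsilon> * norm (\<gamma> s - \<gamma> t)"
      using loc[of t] by auto
    have "Q a b" if ab: "a \<le> t" "t \<le> b" "b - a < \<eta>" for a b
      unfolding Q_def
    proof
      assume ab': "0 \<le> a \<and> a \<le> b \<and> b \<le> 1"
      have "norm (R (\<gamma> a - \<gamma> t)) \<le> \<epsilon> * norm (\<gamma> a - \<gamma> t)" "norm (R (\<gamma> b - \<gamma> t)) \<le> \<epsilon> * norm (\<gamma> b - \<gamma> t)"
        using \<eta>(2)[of a] \<eta>(2)[of b] ab ab' by auto
      moreover have "norm (R (\<gamma> b - \<gamma> a)) \<le> norm (R (\<gamma> b - \<gamma> t)) + norm (R (\<gamma> a - \<gamma> t))"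
        using norm_triangle_ineq4[of "R (\<gamma> b - \<gamma> t)" "R (\<gamma> a - \<gamma> t)"] by (simp add: linear_diff[OF R])
      \<comment> \<open>The local estimate compares points with \<open>\<gamma> t\<close> only, so
        the polygon of a short interval makes a stop at \<open>t\<close>.\<close>
      ultimately have "norm (R (\<gamma> b - \<gamma> a)) \<le> \<epsilon> * polygon_length \<gamma> [a, t, b]"
        by (simp add: dist_norm norm_minus_commute[of "\<gamma> t" "\<gamma> b"] algebra_simps)
      then show "\<exists>ts. sorted ts \<and> set ts \<subseteq> {a..b} \<and> ts \<noteq> [] \<and> hd ts = a \<and> last ts = b \<and>
          norm (R (\<gamma> b - \<gamma> a)) \<le> \<epsilon> * polygon_length \<gamma> ts"
        using ab ab' by (intro exI[of _ "[a, t, b]"]) auto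
    qed
    then show "\<exists>d>0. \<forall>a b. a \<le> t \<and> t \<le> b \<and> b - a < d \<longrightarrow> Q a b" using \<eta>(1) by blast
  qed
  then obtain ts where ts: "sorted ts" "set ts \<subseteq> {0..1}" "norm (R (\<gamma> 1 - \<gamma> 0)) \<le> \<epsilon> * polygon_length \<gamma> ts"
    unfolding Q_def by auto
  have "\<epsilon> * polygon_length \<gamma> ts \<le> \<epsilon> * K"
    using polygon_length_le[OF len ts(1,2)] \<epsilon> by (rule mult_left_mono)
  then show ?thesis using ts(3) by linarith
qed

text \<open>If the estimate failed at every scale, the offending secants, divided by their lengths,
  would subconverge on the unit sphere to a vector of the cone with \<open>norm (R v)\<close> at
  least \<open>\<epsilon>\<close>. The radius obtained depends on \<open>q\<close>.\<close>

lemma cone_C3_bound: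
  fixes R :: "real ^ 'n::finite \<Rightarrow> 'b::real_normed_vector"
  assumes R: "bounded_linear R" and bound: "\<And>v. v \<in> cone_C3 X q \<Longrightarrow> norm (R v) \<le> c * norm v" and c: "c < \<epsilon>"
  obtains \<eta> where "\<eta> > 0" "\<And>z. z \<in> X \<Longrightarrow> dist z q < \<eta> \<Longrightarrow> norm (R (z - q)) \<le> \<epsilon> * norm (z - q)"
proof (rule ccontr)
  assume no: "\<not> thesis"
  have "\<exists>z. z \<in> X \<and> dist z q < 1 / real (Suc n) \<and> \<epsilon> * norm (z - q) < norm (R (z - q))" for n
  proof (rule ccontr)
    assume "\<nexists>z. z \<in> X \<and> dist z q < 1 / real (Suc n) \<and> \<epsilon> * norm (z - q) < norm (R (z - q))"
    then have "thesis" by (intro that[of "1 / real (Suc n)"]) (auto simp: not_less)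
    with no show False ..
  qed
  then obtain z where z: "\<And>n. z n \<in> X" "\<And>n. dist (z n) q < 1 / real (Suc n)" "\<And>n. \<epsilon> * norm (z n - q) < norm (R (z n - q))"
    by metis
  have lin: "linear R" using R by (rule bounded_linear.linear)
  have nz: "z n - q \<noteq> 0" for n using z(3)[of n] linear_0[OF lin] by auto
  define u where "u n = (1 / norm (z n - q)) *\<^sub>R (z n - q)" for n
  have "u n \<in> sphere 0 1" for n using nz[of n] by (simp add: u_def)
  then obtain v r where v: "v \<in> sphere 0 1" "strict_mono (r :: nat \<Rightarrow> nat)" "(u \<circ> r) \<longlonglongrightarrow> v"
    using compact_sphere[of "0 :: real ^ 'n" 1] unfolding compact_def by metis
  have zq: "z \<longlonglongrightarrow> q"
  proof (rule metric_LIMSEQ_I)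
    fix e :: real assume "e > 0"
    then obtain N where "1 / real (Suc N) < e" using nat_approx_posE by blast
    then have "dist (z n) q < e" if "n \<ge> N" for n
      using z(2)[of n] that by (smt (verit) frac_le of_nat_0_less_iff of_nat_le_iff zero_less_Suc Suc_le_mono)
    then show "\<exists>N. \<forall>n\<ge>N. dist (z n) q < e" by blast
  qed
  have "v \<in> cone_C3 X q"
    unfolding cone_C3_def mem_Collect_eq
  proof (intro exI conjI allI)
    show "(z \<circ> r) i \<in> X" for i using z(1) by simp
    show "norm ((z \<circ> r) i - q) > 0" for i using nz by simp
    show "(z \<circ> r) \<longlonglongrightarrow> q" using zq v(2) by (rule LIMSEQ_subseq_LIMSEQ)
    show "(\<lambda>i. (1 / norm ((z \<circ> r) i - q)) *\<^sub>R ((z \<circ> r) i - q)) \<longlonglongrightarrow> v"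
      using v(3) by (simp add: u_def o_def)
  qed
  then have "norm (R v) \<le> c" using bound v(1) by fastforce
  moreover have "\<epsilon> \<le> norm (R v)"
  proof (rule LIMSEQ_le_const)
    show "(\<lambda>i. norm (R ((u \<circ> r) i))) \<longlonglongrightarrow> norm (R v)"
      by (intro tendsto_norm bounded_linear.tendsto[OF R v(3)])
    have "\<epsilon> \<le> norm (R (u n))" for n
    proof -
      have "norm (R (u n)) = norm (R (z n - q)) / norm (z n - q)" by (simp add: u_def linear_scale[OF lin])
      then show ?thesis using z(3)[of n] nz[of n] by (simp add: le_divide_eq)
    qed
    then show "\<exists>N. \<forall>n\<ge>N. \<epsilon> \<le> norm (R ((u \<circ> r) n))" by simp
  qed
  ultimately show False using c by linarith
qed

lemma locally_closed_compact:
  fixes X :: "'a::euclidean_space set"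
  assumes "locally_closed_set X" "p \<in> X"
  obtains r where "0 < r" "\<And>s. s \<le> r \<Longrightarrow> compact (X \<inter> cball p s)"
proof -
  obtain U C where UC: "open U" "closed C" "X = U \<inter> C" using assms unfolding locally_closed_set_def by blast
  obtain r where r: "0 < r" "cball p r \<subseteq> U" using UC assms open_contains_cball by blast
  show thesis
  proof (rule that[OF r(1)])
    fix s assume "s \<le> r"
    then have "X \<inter> cball p s = C \<inter> cball p s" using UC(3) r(2) by auto
    then show "compact (X \<inter> cball p s)" using UC(2) by (simp add: closed_Int_compact)
  qed
qed

section \<open>Projecting a set whose tangent cones are graphs over one subspace\<close>

context
  fixes X :: "(real ^ 'n::finite) set" and P :: "real ^ 'n \<Rightarrow> real ^ 'n" and W A p
  assumes P: "orth_projection P" and W: "open W" "p \<in> W" and p: "p \<in> X"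
    and A: "\<And>x. x \<in> W \<Longrightarrow> graph_map P (A x)" and cont: "\<And>v. continuous_on W (\<lambda>x. A x v)"
    and C3: "\<And>q. q \<in> X \<inter> W \<Longrightarrow> cone_C3 X q = graph_space P (A q)"
begin

lemma bounded_linear_deviation: "q \<in> W \<Longrightarrow> bounded_linear (\<lambda>v. v - P v - A q v)"
  using A graph_mapD(1) by (intro bounded_linear_sub bounded_linear_ident orth_projectionD(4)[OF P])
    (auto simp: linear_conv_bounded_linear)

text \<open>The path provided by the LNE condition stays close to \<open>p\<close>, so it moves almost along
  the tangent space at \<open>p\<close>; as it is not much longer than its chord, so does the chord.\<close>

lemma projection_bilipschitz:
  assumes LNE: "LNE_at X p"
  obtains r M where "0 < r" "1 \<le> M" "\<forall>x\<in>X \<inter> ball p r. \<forall>y\<in>X \<inter> ball p r. norm (x - y) \<le> M * norm (P (x - y))"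
proof -
  note linP = orth_projectionD(1)[OF P]
  define R where "R v = v - P v - A p v" for v
  have R: "bounded_linear R" unfolding R_def by (rule bounded_linear_deviation[OF W(2)])
  have linR: "linear R" using R by (rule bounded_linear.linear)
  have "bounded_linear (A p)" using graph_mapD(1)[OF A[OF W(2)]] by (simp add: linear_conv_bounded_linear)
  then obtain a where a: "0 < a" "\<And>v. norm (A p v) \<le> norm v * a" using bounded_linear.pos_bounded by blast
  have vR: "norm v \<le> norm (R v) + (1 + a) * norm (P v)" for v
  proof -
    have "norm (R v + (P v + A p (P v))) \<le> norm (R v) + (norm (P v) + norm (A p (P v)))"
      by (rule order_trans[OF norm_triangle_ineq add_left_mono[OF norm_triangle_ineq]])
    moreover have "R v + (P v + A p (P v)) = v" using graph_mapD(2)[OF A[OF W(2)]] by (simp add: R_def)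
    ultimately have "norm v \<le> norm (R v) + (norm (P v) + norm (A p (P v)))" by simp
    then show ?thesis using a(2)[of "P v"] by (simp add: algebra_simps)
  qed
  obtain U C where U: "p \<in> interior U" and C: "C \<ge> 1"
    and inner: "\<And>x y. x \<in> X \<inter> U \<Longrightarrow> y \<in> X \<inter> U \<Longrightarrow> inner_dist (X \<inter> U) x y \<le> ennreal (C * norm (x - y))"
    using LNE unfolding LNE_at_def by blast
  \<comment> \<open>With path length at most \<open>(C + 1) * norm (x - y)\<close>, this makes the
    deviation of the chord at most half its length; the half is absorbed into the left-hand side of
    \<open>vR\<close>, whence the constant \<open>2 * (1 + a)\<close>.\<close>
  define \<epsilon> where "\<epsilon> = 1 / (2 * (C + 1))"
  have \<epsilon>: "0 < \<epsilon>" "\<epsilon> * (C + 1) = 1 / 2" using C by (auto simp: \<epsilon>_def field_simps)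
  obtain \<delta>1 where \<delta>1: "0 < \<delta>1" "\<And>q v. q \<in> W \<Longrightarrow> dist q p < \<delta>1 \<Longrightarrow> norm (A q v - A p v) \<le> (\<epsilon> / 2) * norm v"
    using linear_family_close[OF graph_mapD(1)[OF A] cont W(2), of "\<epsilon> / 2"] \<epsilon>(1) by auto
  obtain \<delta>2 where \<delta>2: "0 < \<delta>2" "ball p \<delta>2 \<subseteq> W" using W open_contains_ball by blast
  obtain \<rho> where \<rho>: "0 < \<rho>" "ball p \<rho> \<subseteq> U" using U mem_interior by blast
  define \<delta> where "\<delta> = min \<delta>1 \<delta>2"
  \<comment> \<open>The path starts within \<open>r\<close> of \<open>p\<close> and has length at
    most \<open>(C + 1) * (2 * r)\<close>. Since \<open>2 * C + 3 < 2 * C + 4\<close>, it cannot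
    leave the \<open>\<delta>\<close>-ball.\<close>
  define r where "r = min \<rho> (\<delta> / (2 * C + 4))"
  have r: "0 < r" "r \<le> \<rho>" using \<delta>1 \<delta>2 \<rho> C by (auto simp: r_def \<delta>_def)
  have "r * (2 * C + 4) \<le> \<delta>"
  proof -
    have "r \<le> \<delta> / (2 * C + 4)" by (simp add: r_def)
    then show ?thesis using C by (simp add: le_divide_eq)
  qed
  then have r\<delta>: "r + (C + 1) * (2 * r) < \<delta>" using r(1) by (simp add: algebra_simps)
  \<comment> \<open>\<open>R\<close> is the deviation from the graph at \<open>p\<close>, but the
    cone at \<open>q\<close> is the graph of \<open>A q\<close>; on it \<open>R\<close> equals
    \<open>A q - A p\<close>, bounded by \<open>\<epsilon> / 2\<close>. The other half is the slack
    required by \<open>cone_C3_bound\<close>.\<close>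
  have loc: "\<exists>\<eta>>0. \<forall>z\<in>X. dist z q < \<eta> \<longrightarrow> norm (R (z - q)) \<le> \<epsilon> * norm (z - q)" if q: "q \<in> X" "dist q p < \<delta>" for q
  proof -
    have qW: "q \<in> W" using q(2) \<delta>2(2) by (auto simp: \<delta>_def dist_commute)
    have "norm (R v) \<le> (\<epsilon> / 2) * norm v" if "v \<in> cone_C3 X q" for v
    proof -
      have "v \<in> graph_space P (A q)" using that C3 q(1) qW by blast
      then have "P v + A q v = v" by (rule graph_spaceD)
      then have "R v = A q v - A p v" unfolding R_def by (metis add_diff_cancel_left')
      then show ?thesis using \<delta>1(2)[OF qW, of v] q(2) by (simp add: \<delta>_def)
    qed
    from cone_C3_bound[OF R this, of X] \<epsilon>(1) obtain \<eta> where
      "\<eta> > 0" "\<And>z. z \<in> X \<Longrightarrow> dist z q < \<eta> \<Longrightarrow> norm (R (z - q)) \<le> \<epsilon> * norm (z - q)"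
      by (metis field_sum_of_halves less_add_same_cancel1 half_gt_zero)
    then show ?thesis by blast
  qed
  have "norm (x - y) \<le> (2 * (1 + a)) * norm (P (x - y))" if x: "x \<in> X \<inter> ball p r" and y: "y \<in> X \<inter> ball p r" for x y
  proof (cases "x = y")
    case True then show ?thesis using linear_0[OF linP] by simp
  next
    case False
    \<comment> \<open>The inner distance is an infimum, so an actual path is obtained only for a
      bound strictly above \<open>C * norm (x - y)\<close>; \<open>x \<noteq> y\<close> makes
      \<open>C + 1\<close> large enough.\<close>
    define K where "K = (C + 1) * norm (x - y)"
    have K: "0 \<le> K" using C by (simp add: K_def)
    have "inner_dist (X \<inter> U) x y \<le> ennreal (C * norm (x - y))" using x y r(2) \<rho>(2) by (intro inner) auto
    also have "\<dots> < ennreal K" using False C by (auto simp: K_def ennreal_less_iff algebra_simps)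
    finally obtain \<gamma> where \<gamma>: "path \<gamma>" "path_image \<gamma> \<subseteq> X \<inter> U" "pathstart \<gamma> = x" "pathfinish \<gamma> = y" "path_length \<gamma> < ennreal K"
      unfolding inner_dist_def INF_less_iff by blast
    have ends: "\<gamma> 0 = x" "\<gamma> 1 = y" using \<gamma>(3,4) by (simp_all add: pathstart_def pathfinish_def)
    have K2: "K \<le> (C + 1) * (2 * r)"
    proof -
      have "norm (x - y) \<le> dist p x + dist p y" by (metis dist_commute dist_norm dist_triangle)
      then have "norm (x - y) \<le> 2 * r" using x y by simp
      then show ?thesis unfolding K_def using C by (intro mult_left_mono) auto
    qed
    have near: "\<gamma> t \<in> X \<and> dist (\<gamma> t) p < \<delta>" if t: "t \<in> {0..1}" for t
    proof -
      \<comment> \<open>The one-chord polygon from the start to time \<open>t\<close> bounds the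
        distance of \<open>\<gamma> t\<close> from \<open>x\<close>.\<close>
      have "polygon_length \<gamma> [0, t] \<le> K" by (rule polygon_length_le) (use \<gamma>(5) K t in auto)
      then have "dist x (\<gamma> t) \<le> K" by (simp add: ends)
      moreover have "dist (\<gamma> t) p \<le> dist x (\<gamma> t) + dist p x" by (metis dist_commute dist_triangle add.commute)
      ultimately have "dist (\<gamma> t) p < \<delta>" using x K2 r\<delta> by auto
      then show ?thesis using \<gamma>(2) t by (auto simp: path_image_def)
    qed
    have "norm (R (\<gamma> 1 - \<gamma> 0)) \<le> \<epsilon> * K"
    proof (rule path_deviation[OF less_imp_le[OF \<gamma>(5)] K linR])
      fix t :: real assume t: "t \<in> {0..1}"
      obtain \<eta> where \<eta>: "\<eta> > 0" "\<And>z. z \<in> X \<Longrightarrow> dist z (\<gamma> t) < \<eta> \<Longrightarrow> norm (R (z - \<gamma> t)) \<le> \<epsilon> * norm (z - \<gamma> t)"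
        using loc near[OF t] by blast
      obtain d where d: "d > 0" "\<And>s. s \<in> {0..1} \<Longrightarrow> dist s t < d \<Longrightarrow> dist (\<gamma> s) (\<gamma> t) < \<eta>"
        using \<gamma>(1) t \<eta>(1) unfolding path_def continuous_on_iff by metis
      show "\<exists>\<eta>>0. \<forall>s\<in>{0..1}. \<bar>s - t\<bar> < \<eta> \<longrightarrow> norm (R (\<gamma> s - \<gamma> t)) \<le> \<epsilon> * norm (\<gamma> s - \<gamma> t)"
        using d \<eta>(2) near by (intro exI[of _ d]) (auto simp: dist_real_def)
    qed (use \<epsilon> in simp)
    then have "norm (R (x - y)) \<le> \<epsilon> * K" by (simp add: ends linear_diff[OF linR] norm_minus_commute)
    also have "\<dots> = (\<epsilon> * (C + 1)) * norm (x - y)" by (simp add: K_def)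
    finally have "norm (R (x - y)) \<le> norm (x - y) / 2" by (simp add: \<epsilon>(2))
    then show ?thesis using vR[of "x - y"] by (simp add: algebra_simps)
  qed
  then show thesis using that[of r "2 * (1 + a)"] r(1) a(1) by auto
qed

text \<open>If points near the projection of \<open>p\<close> were missed, one could take a nearest point of the
  projected set; there the tangent cone, which is all of \<open>range P\<close>, would have to avoid an open half-space.\<close>

lemma projection_locally_surjective:
  assumes lc: "locally_closed_set X" and r: "0 < r"
    and M: "1 \<le> M" "\<forall>x\<in>X \<inter> ball p r. \<forall>y\<in>X \<inter> ball p r. norm (x - y) \<le> M * norm (P (x - y))"
  obtains s \<rho> where "0 < s" "s \<le> r" "ball p s \<subseteq> W" "0 < \<rho>"
    "\<forall>u. P u = u \<and> dist u (P p) < \<rho> \<longrightarrow> (\<exists>x\<in>X \<inter> ball p s. P x = u)"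
proof -
  note linP = orth_projectionD(1)[OF P] and PP = orth_projectionD(2)[OF P]
  obtain r1 where r1: "0 < r1" "\<And>s. s \<le> r1 \<Longrightarrow> compact (X \<inter> cball p s)" using locally_closed_compact[OF lc p] by blast
  obtain r2 where r2: "0 < r2" "ball p r2 \<subseteq> W" using W open_contains_ball by blast
  \<comment> \<open>\<open>r / 2\<close> places the closed ball inside \<open>ball p r\<close>,
    \<open>r1\<close> makes its trace on \<open>X\<close> compact, and \<open>r2\<close> keeps the
    open ball in \<open>W\<close>.\<close>
  define s where "s = min (r / 2) (min r1 r2)"
  have s: "0 < s" "s < r" "s \<le> r1" "s \<le> r2" using r r1 r2 by (auto simp: s_def)
  have sW: "ball p s \<subseteq> W" using s(4) r2(2) by auto
  \<comment> \<open>A nearest point \<open>a\<close> to \<open>u\<close> lies within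
    \<open>2 * \<rho>\<close> of \<open>P p\<close>, so its preimage \<open>q\<close> lies within
    \<open>M * (2 * \<rho>) = s\<close> of \<open>p\<close>. Thus \<open>q\<close> is interior to
    the ball and points of \<open>X\<close> near \<open>q\<close> compete in the
    minimisation.\<close>
  define \<rho> where "\<rho> = s / (2 * M)"
  have \<rho>: "0 < \<rho>" using s(1) M(1) by (simp add: \<rho>_def)
  have "\<exists>x\<in>X \<inter> ball p s. P x = u" if u: "P u = u" "dist u (P p) < \<rho>" for u
  proof (rule ccontr)
    assume no: "\<not> (\<exists>x\<in>X \<inter> ball p s. P x = u)"
    define K where "K = P ` (X \<inter> cball p s)"
    have "compact K" unfolding K_def
      by (intro compact_continuous_image linear_continuous_on orth_projectionD(4)[OF P] r1(2) s(3))
    moreover have PpK: "P p \<in> K" using p s(1) by (auto simp: K_def)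
    ultimately obtain a where a: "a \<in> K" "\<And>y. y \<in> K \<Longrightarrow> dist u a \<le> dist u y"
      using distance_attains_inf[of K u] compact_imp_closed by blast
    obtain q where q: "q \<in> X" "q \<in> cball p s" "a = P q" using a(1) by (auto simp: K_def)
    have "dist a (P p) < 2 * \<rho>"
      using a(2)[OF PpK] u(2) dist_triangle[of a "P p" u] by (simp add: dist_commute)
    moreover have "norm (q - p) \<le> M * norm (P (q - p))"
      using q p s by (intro M(2)[rule_format]) auto
    ultimately have "norm (q - p) < M * (2 * \<rho>)"
      using M(1) q(3) by (smt (verit) dist_norm linear_diff[OF linP] mult_less_cancel_left_pos)
    then have qs: "dist q p < s" using M(1) by (simp add: \<rho>_def dist_norm)
    then have qW: "q \<in> W" using sW by (auto simp: dist_commute)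
    define e where "e = u - a"
    have Pe: "P e = e" using u(1) q(3) PP by (simp add: e_def linear_diff[OF linP])
    have e0: "e \<noteq> 0" using no q qs by (auto simp: e_def dist_commute)
    \<comment> \<open>The tangent cone at \<open>q\<close> contains a direction that projects onto
      \<open>e\<close>, pointing from the nearest point \<open>a\<close> towards the missed point
      \<open>u\<close>.\<close>
    have "e + A q e \<in> graph_space P (A q)"
      unfolding graph_space_eq_image[OF P A[OF qW]] using Pe orth_projection_range[OF P] by blast
    then have "e + A q e \<in> cone_C3 X q" using C3 q(1) qW by blast
    then obtain x t where x: "\<And>i::nat. x i \<in> X" "\<And>i. t i > 0" "x \<longlonglongrightarrow> q" "(\<lambda>i. (1 / t i) *\<^sub>R (x i - q)) \<longlonglongrightarrow> e + A q e"
      unfolding cone_C3_def by blast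
    define y where "y i = P (x i) - a" for i
    have "y \<longlonglongrightarrow> P q - a" unfolding y_def
      by (intro tendsto_diff tendsto_const bounded_linear.tendsto[OF orth_projectionD(4)[OF P] x(3)])
    then have y0: "y \<longlonglongrightarrow> 0" by (simp add: q(3))
    have "(\<lambda>i. P ((1 / t i) *\<^sub>R (x i - q))) \<longlonglongrightarrow> P (e + A q e)"
      by (rule bounded_linear.tendsto[OF orth_projectionD(4)[OF P] x(4)])
    then have ye: "(\<lambda>i. (1 / t i) *\<^sub>R y i) \<longlonglongrightarrow> e"
      using Pe graph_mapD(3)[OF A[OF qW]]
      by (simp add: y_def q(3) linear_scale[OF linP] linear_diff[OF linP] linear_add[OF linP])
    have "\<forall>\<^sub>F i in sequentially. dist (x i) q < s - dist q p" using qs by (intro tendstoD[OF x(3)]) simp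
    \<comment> \<open>Minimality of \<open>a\<close> says
      \<open>norm e \<le> norm (e - y i)\<close>, that is
      \<open>2 * (y i \<bullet> e) \<le> y i \<bullet> y i\<close>. After division by
      \<open>t i\<close> the left side tends to \<open>2 * (e \<bullet> e)\<close> and the right
      side to \<open>0\<close>.\<close>
    then have "\<forall>\<^sub>F i in sequentially. 2 * (((1 / t i) *\<^sub>R y i) \<bullet> e) \<le> ((1 / t i) *\<^sub>R y i) \<bullet> y i"
    proof eventually_elim
      case (elim i)
      have "dist (x i) p \<le> dist (x i) q + dist q p" by (rule dist_triangle)
      then have "P (x i) \<in> K" using elim x(1) by (auto simp: K_def dist_commute)
      then have "norm e \<le> norm (e - y i)"
        using a(2)[of "P (x i)"] by (simp add: e_def y_def dist_norm)
      then have "e \<bullet> e \<le> (e - y i) \<bullet> (e - y i)" by (simp add: norm_le)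
      then have "2 * (y i \<bullet> e) \<le> y i \<bullet> y i" by (simp add: inner_diff_left inner_diff_right inner_commute)
      then show ?case using x(2)[of i] by (simp add: divide_le_cancel)
    qed
    then have "2 * (e \<bullet> e) \<le> e \<bullet> 0"
      using tendsto_le[OF sequentially_bot tendsto_inner[OF ye y0] tendsto_mult[OF tendsto_const tendsto_inner[OF ye tendsto_const]], of 2 e]
      by simp
    then have "e \<bullet> e \<le> 0" by simp
    moreover have "0 < e \<bullet> e" using e0 by (simp add: inner_gt_zero_iff)
    ultimately show False by linarith
  qed
  then show thesis using that[of s \<rho>] s \<rho> sW by simp
qed

text \<open>Bi-Lipschitz projection makes \<open>X\<close> a graph and local surjectivity makes its
  base open. Differentiability needs both facts again: secants of \<open>X\<close> at
  \<open>q\<close> deviate from the cone to higher order, and their length is comparable to that of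
  their projection.\<close>

lemma graph_of_tangent_cones:
  assumes lc: "locally_closed_set X" and LNE: "LNE_at X p"
  obtains h U V where "open U" "p \<in> U" "open V" "\<And>x. h (P x) = h x" "\<And>x. P x \<in> V \<longleftrightarrow> x \<in> V" "\<And>x. x \<in> V \<Longrightarrow> P (h x) = 0"
    "X \<inter> U = {x \<in> V. x = P x + h x}" "\<And>x. x \<in> V \<Longrightarrow> P x + h x \<in> W"
    "\<And>x. x \<in> V \<Longrightarrow> (h has_derivative A (P x + h x)) (at x)"
proof -
  note linP = orth_projectionD(1)[OF P] and PP = orth_projectionD(2)[OF P]
  obtain r M where r: "0 < r" and M: "1 \<le> M" "\<forall>x\<in>X \<inter> ball p r. \<forall>y\<in>X \<inter> ball p r. norm (x - y) \<le> M * norm (P (x - y))"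
    by (rule projection_bilipschitz[OF LNE])
  obtain s \<rho> where s: "0 < s" "s \<le> r" "ball p s \<subseteq> W" "0 < \<rho>"
    and surj: "\<forall>u. P u = u \<and> dist u (P p) < \<rho> \<longrightarrow> (\<exists>x\<in>X \<inter> ball p s. P x = u)"
    by (rule projection_locally_surjective[OF lc r M])
  have lip: "norm (x - y) \<le> M * norm (P x - P y)" if "x \<in> X \<inter> ball p s" "y \<in> X \<inter> ball p s" for x y
    using M(2)[rule_format, of x y] that s(2) by (simp add: linear_diff[OF linP])
  define V where "V = P -` ball (P p) \<rho>"
  have opV: "open V" unfolding V_def
    using orth_projectionD(4)[OF P] by (metis continuous_on_open_vimage open_UNIV open_ball linear_continuous_on inf_top.right_neutral)
  have PV: "P x \<in> V \<longleftrightarrow> x \<in> V" for x by (simp add: V_def PP)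
  \<comment> \<open>The choice depends on \<open>y\<close> only through \<open>P y\<close>, so
    \<open>h\<close> is constant along fibres even outside \<open>V\<close>.\<close>
  define \<psi> where "\<psi> y = (SOME x. x \<in> X \<inter> ball p s \<and> P x = P y)" for y
  have \<psi>: "\<psi> y \<in> X \<inter> ball p s \<and> P (\<psi> y) = P y" if "y \<in> V" for y
    unfolding \<psi>_def by (rule someI_ex) (use surj[rule_format, of "P y"] PP that in \<open>auto simp: V_def dist_commute\<close>)
  have \<psi>_uniq: "\<psi> x = x" if "x \<in> X \<inter> ball p s" "x \<in> V" for x
    using lip[OF that(1), of "\<psi> x"] \<psi>[OF that(2)] by simp
  define h where "h y = \<psi> y - P y" for y
  have hP: "h (P x) = h x" for x by (simp add: h_def \<psi>_def PP)
  have Ph: "P (h x) = 0" if "x \<in> V" for x using \<psi>[OF that] by (simp add: h_def linear_diff[OF linP] PP)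
  have \<psi>h: "P x + h x = \<psi> x" for x by (simp add: h_def)
  have XU: "X \<inter> (ball p s \<inter> V) = {x \<in> V. x = P x + h x}"
  proof -
    have "x \<in> X \<inter> (ball p s \<inter> V) \<longleftrightarrow> x \<in> V \<and> x = \<psi> x" for x
    proof (cases "x \<in> V")
      case True
      have "x \<in> X \<inter> ball p s" if "x = \<psi> x" using \<psi>[OF True] that by metis
      moreover have "x = \<psi> x" if "x \<in> X \<inter> ball p s" using \<psi>_uniq[OF that True] by (rule sym)
      ultimately show ?thesis using True by blast
    qed simp
    then show ?thesis unfolding \<psi>h by blast
  qed
  have der: "(h has_derivative A (\<psi> x)) (at x)" if x: "x \<in> V" for x
  proof -
    let ?q = "\<psi> x"
    have q: "?q \<in> X" "?q \<in> W" using \<psi>[OF x] s(3) by auto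
    define R where "R v = v - P v - A ?q v" for v
    have R: "bounded_linear R" unfolding R_def by (rule bounded_linear_deviation[OF q(2)])
    \<comment> \<open>This time the deviation is taken at \<open>?q\<close> itself, where it
      annihilates the cone; \<open>cone_C3_bound\<close> applies with \<open>c = 0\<close> and hence
      with every positive tolerance.\<close>
    have R0: "norm (R v) \<le> 0 * norm v" if "v \<in> cone_C3 X ?q" for v
    proof -
      have "v \<in> graph_space P (A ?q)" using that C3 q by blast
      from graph_spaceD[OF this] have "R v = 0" unfolding R_def by (metis add_diff_cancel_left' diff_self)
      then show ?thesis by simp
    qed
    have "\<exists>d>0. \<forall>y. norm (y - x) < d \<longrightarrow> norm (h y - h x - A ?q (y - x)) \<le> e * norm (y - x)" if e: "0 < e" for e
    proof -
      \<comment> \<open>A secant of \<open>X\<close> is at most \<open>M\<close> times as long as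
        the displacement \<open>y - x\<close>. Hence the tolerance \<open>e / M\<close>, and the
        radius \<open>\<eta> / M\<close> below.\<close>
      have "0 < e / M" using e M(1) by simp
      then obtain \<eta> where \<eta>: "\<eta> > 0" "\<And>z. z \<in> X \<Longrightarrow> dist z ?q < \<eta> \<Longrightarrow> norm (R (z - ?q)) \<le> e / M * norm (z - ?q)"
        using cone_C3_bound[where \<epsilon> = "e / M", OF R R0] by blast
      obtain d1 where d1: "0 < d1" "ball x d1 \<subseteq> V" using opV x open_contains_ball by blast
      show ?thesis
      proof (intro exI conjI allI impI)
        show "min d1 (\<eta> / M) > 0" using d1 \<eta> M(1) by simp
        fix y assume y: "norm (y - x) < min d1 (\<eta> / M)"
        then have yV: "y \<in> V" using d1(2) by (auto simp: dist_norm norm_minus_commute)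
        have "norm (\<psi> y - ?q) \<le> M * norm (P (y - x))"
          using lip[of "\<psi> y" ?q] \<psi>[OF yV] \<psi>[OF x] by (simp add: linear_diff[OF linP])
        also have "\<dots> \<le> M * norm (y - x)"
          using norm_orth_projection_le[OF P] M(1) by (intro mult_left_mono) auto
        finally have L: "norm (\<psi> y - ?q) \<le> M * norm (y - x)" .
        also have "\<dots> < \<eta>" using y M(1) by (simp add: less_divide_eq mult.commute)
        finally have "dist (\<psi> y) ?q < \<eta>" by (simp add: dist_norm)
        then have "norm (R (\<psi> y - ?q)) \<le> e / M * norm (\<psi> y - ?q)" using \<eta>(2) \<psi>[OF yV] by blast
        also have "\<dots> \<le> e / M * (M * norm (y - x))" using L e M(1) by (intro mult_left_mono) auto
        also have "\<dots> = e * norm (y - x)" using M(1) by simp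
        finally have "norm (R (\<psi> y - ?q)) \<le> e * norm (y - x)" .
        moreover have "R (\<psi> y - ?q) = h y - h x - A ?q (y - x)"
        proof -
          have "P (\<psi> y - ?q) = P (y - x)" using \<psi>[OF yV] \<psi>[OF x] by (simp add: linear_diff[OF linP])
          then have "A ?q (\<psi> y - ?q) = A ?q (y - x)" using graph_mapD(2)[OF A[OF q(2)]] by metis
          then show ?thesis
            unfolding R_def h_def \<open>P (\<psi> y - ?q) = P (y - x)\<close> by (simp add: linear_diff[OF linP])
        qed
        ultimately show "norm (h y - h x - A ?q (y - x)) \<le> e * norm (y - x)" by simp
      qed
    qed
    moreover have "bounded_linear (A ?q)" using graph_mapD(1)[OF A[OF q(2)]] by (simp add: linear_conv_bounded_linear)
    ultimately show ?thesis unfolding has_derivative_at_alt by blast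
  qed
  show thesis
  proof (rule that[of "ball p s \<inter> V" V h])
    show "p \<in> ball p s \<inter> V" using s by (simp add: V_def)
    show "P x + h x \<in> W" if "x \<in> V" for x unfolding \<psi>h using \<psi>[OF that] s(3) by blast
    show "(h has_derivative A (P x + h x)) (at x)" if "x \<in> V" for x unfolding \<psi>h by (rule der[OF that])
  qed (use opV hP PV Ph XU in auto)
qed

end

section \<open>The conditions imply smoothness\<close>

lemma bounded_linear_matrix_apply: "bounded_linear (\<lambda>M :: real ^ 'n::finite ^ 'm::finite. M *v v)"
  unfolding linear_conv_bounded_linear[symmetric]
  by (rule linearI) (simp_all add: matrix_vector_mult_add_rdistrib scaleR_matrix_vector_assoc)

text \<open>The derivative of \<open>h\<close> is \<open>A\<close> along the graph of
  \<open>h\<close>, so knowing \<open>h\<close> at order \<open>j\<close> gives its derivative at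
  order \<open>j\<close> as long as \<open>A\<close> has that order. Each round gains one
  derivative, and the gain ends one order above \<open>A\<close>.\<close>

lemma Ck_bootstrap:
  fixes P h :: "real ^ 'n::finite \<Rightarrow> real ^ 'n" and A :: "real ^ 'n \<Rightarrow> real ^ 'n ^ 'n"
  assumes P: "bounded_linear P" and op: "open V" "open W" and A: "Ck k \<alpha> W A" and \<alpha>: "0 \<le> \<alpha>" "\<alpha> \<le> 1"
    and W: "\<And>x. x \<in> V \<Longrightarrow> P x + h x \<in> W"
    and der: "\<And>x. x \<in> V \<Longrightarrow> (h has_derivative (*v) (A (P x + h x))) (at x)"
  shows "Ck (Suc k) \<alpha> V h"
proof -
  let ?\<psi> = "\<lambda>x. P x + h x"
  have im: "?\<psi> ` V \<subseteq> W" using W by blast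
  have "continuous_on V h"
    using der has_derivative_continuous continuous_at_imp_continuous_on by blast
  then have "continuous_on V ?\<psi>" by (rule continuous_on_add[OF linear_continuous_on[OF P]])
  then have "continuous_on V (\<lambda>x. A (?\<psi> x))"
    by (rule continuous_on_compose2[OF Ck_continuous_on[OF A \<alpha>(1)] _ im])
  then have "continuous_on V (\<lambda>x. A (?\<psi> x) *v v)" for v
    by (rule bounded_linear.continuous_on[OF bounded_linear_matrix_apply])
  \<comment> \<open>This preliminary round, with exponent \<open>0\<close>, serves only to make
    \<open>h\<close> locally Lipschitz, so that later compositions with \<open>A\<close> keep the
    exponent \<open>\<alpha>\<close>.\<close>
  then have "Ck (Suc 0) 0 V h"
    unfolding Ck.simps using der by (intro exI[of _ "\<lambda>x. (*v) (A (?\<psi> x))"]) auto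
  from Ck_Lipschitz[OF this op(1)] have Lip: "Ck 0 1 V h" by simp
  have "Ck 0 1 V ?\<psi>" by (intro Ck_add Lip Ck_linear P op) auto
  have "j \<le> Suc k \<Longrightarrow> Ck j \<alpha> V h" for j
  proof (induction j)
    case 0 show ?case by (rule Lipschitz_imp_Ck_0[OF Lip op(1) \<alpha>])
  next
    case (Suc j)
    then have "Ck j \<alpha> V ?\<psi>" by (intro Ck_add[OF Ck_linear[OF P op(1) \<alpha>]]) simp
    moreover have "Ck j \<alpha> W A" using Ck_mono[OF A _ op(2) \<alpha>] Suc.prems by simp
    ultimately have "Ck j \<alpha> V (\<lambda>x. A (?\<psi> x))"
      by (intro Ck_compose[of j \<alpha> W A V ?\<psi>] \<open>Ck 0 1 V ?\<psi>\<close> im op \<alpha>)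
    then have "Ck j \<alpha> V (\<lambda>x. A (?\<psi> x) *v v)" for v
      by (rule Ck_bounded_linear_compose[OF bounded_linear_matrix_apply])
    then show ?case
      unfolding Ck.simps using der by (intro exI[of _ "\<lambda>x. (*v) (A (?\<psi> x))"]) auto
  qed
  then show ?thesis by simp
qed

section \<open>Regular points when the Nash map is a homeomorphism\<close>

context
  fixes X :: "(real ^ 'n::finite) set" and d
  assumes homeo: "Nash_map_homeomorphism d X"
begin

lemma Nash_map_bij_betw: "bij_betw fst (Nash_space d X) X"
proof -
  have "Nash_space d X \<subseteq> topspace (Nash_ambient d)"
    using closure_of_subset_topspace[of "subtopology (Nash_ambient d) (X \<times> Gr d)"] unfolding Nash_space_def by auto
  then have "topspace (subtopology (Nash_ambient d) (Nash_space d X)) = Nash_space d X" by auto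
  then show ?thesis
    using homeomorphic_imp_injective_map[OF homeo[unfolded Nash_map_homeomorphism_def]]
      homeomorphic_imp_surjective_map[OF homeo[unfolded Nash_map_homeomorphism_def]]
    by (simp add: bij_betw_def)
qed

text \<open>By surjectivity some \<open>(x, L)\<close> lies in the closure defining the Nash space.
  That closure is formed inside \<open>X \<times> Gr d\<close>, so the points of the Gauss graph
  approaching \<open>(x, L)\<close> have tangent spaces of dimension \<open>d\<close>.\<close>

lemma Reg1_near:
  assumes x: "x \<in> X" and V: "open V" "x \<in> V"
  shows "\<exists>y\<in>Reg1 X \<inter> V. tangent_space X y \<in> Gr d"
proof -
  obtain L where L: "(x, L) \<in> Nash_space d X"
    using Nash_map_bij_betw x unfolding bij_betw_def by (metis imageE prod.collapse)
  then have top: "(x, L) \<in> X \<times> Gr d"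
    using closure_of_subset_topspace[of "subtopology (Nash_ambient d) (X \<times> Gr d)"]
    unfolding Nash_space_def by (auto simp: subtopology_Nash_ambient topspace_Gr_topology)
  have "openin (top_of_set X) (X \<inter> V)" using V(1) by (rule openin_open_Int)
  moreover have "openin (Gr_topology d) (Gr d :: (real ^ 'n) set set)" using openin_topspace topspace_Gr_topology by metis
  ultimately have "openin (subtopology (Nash_ambient d) (X \<times> Gr d)) ((X \<inter> V) \<times> Gr d)"
    by (simp add: subtopology_Nash_ambient openin_prod_Times_iff)
  moreover have "(x, L) \<in> (X \<inter> V) \<times> Gr d" using top V(2) by simp
  ultimately obtain z where "z \<in> {(x, tangent_space X x) | x. x \<in> Reg1 X}" "z \<in> (X \<inter> V) \<times> Gr d"
    using L unfolding Nash_space_def in_closure_of by meson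
  then show ?thesis by auto
qed

text \<open>\<open>Reg1\<close> admits submanifold points of any dimension \<open>e\<close>. This
  dimension is constant near \<open>x\<close>, and tangent spaces of dimension \<open>d\<close>
  occur arbitrarily near \<open>x\<close>, so \<open>e = d\<close>.\<close>

lemma tangent_space_in_Gr:
  assumes "x \<in> Reg1 X" shows "tangent_space X x \<in> Gr d"
proof -
  obtain e where e: "submanifold_near e 1 0 X x" and x: "x \<in> X" using assms by (auto simp: Reg1_def)
  obtain V where V: "open V" "x \<in> V" "X \<inter> V \<subseteq> Reg1 X" "\<And>y. y \<in> X \<inter> V \<Longrightarrow> tangent_space X y \<in> Gr e"
    using Reg1_dimension[OF e] by blast
  obtain y where y: "y \<in> Reg1 X \<inter> V" "tangent_space X y \<in> Gr d" using Reg1_near[OF x V(1,2)] by blast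
  then have "y \<in> X \<inter> V" by (auto simp: Reg1_def)
  then have "d = e" using V(4) y(2) by (force simp: Gr_def)
  then show ?thesis using V(2,4) x by blast
qed

text \<open>The Gauss graph point over \<open>x\<close> lies in the Nash space now that its tangent
  space is in \<open>Gr d\<close>; injectivity leaves no other point over \<open>x\<close>.\<close>

lemma Nash_map_inverse_Reg1:
  assumes "x \<in> Reg1 X" shows "Nash_map_inverse d X x = (x, tangent_space X x)"
proof -
  have "x \<in> X" using assms by (auto simp: Reg1_def)
  then have "(x, tangent_space X x) \<in> topspace (subtopology (Nash_ambient d) (X \<times> Gr d))"
    using tangent_space_in_Gr[OF assms] by (simp add: subtopology_Nash_ambient topspace_Gr_topology)
  moreover have "(x, tangent_space X x) \<in> {(x, tangent_space X x) | x. x \<in> Reg1 X}" using assms by blast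
  ultimately have "(x, tangent_space X x) \<in> Nash_space d X"
    unfolding Nash_space_def by (intro subsetD[OF closure_of_subset_Int] IntI)
  then show ?thesis
    unfolding Nash_map_inverse_def using Nash_map_bij_betw by (intro inv_into_f_eq) (auto simp: bij_betw_def)
qed

lemma Reg1_dense: "X \<subseteq> closure (Reg1 X)"
proof
  fix x assume x: "x \<in> X"
  show "x \<in> closure (Reg1 X)"
    unfolding closure_iff_nhds_not_empty
  proof (intro allI impI)
    fix B V assume "V \<subseteq> B" "open V" "x \<in> V"
    then show "Reg1 X \<inter> B \<noteq> {}" using Reg1_near[OF x] by blast
  qed
qed

end

theorem conditions_imp_smooth_set:
  fixes X :: "(real ^ 'n::finite) set"
  assumes lc: "locally_closed_set X" and homeo: "Nash_map_homeomorphism d X"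
    and smooth: "Ck_into_on (Rn_Gr_atlas d) k \<alpha> X (Nash_map_inverse d X)"
    and LNE: "\<And>p. p \<in> X \<Longrightarrow> LNE_at X p" and C34: "\<And>p. p \<in> X \<Longrightarrow> cone_C3 X p = cone_C4 X p"
    and \<alpha>: "0 \<le> \<alpha>" "\<alpha> \<le> 1"
  shows "smooth_set d (Suc k) \<alpha> X"
  unfolding smooth_set_def
proof
  fix p assume p: "p \<in> X"
  obtain U F where U: "open U" "p \<in> U" and F: "Ck_into (Rn_Gr_atlas d) k \<alpha> U F"
    "\<forall>x\<in>X \<inter> U. F x = Nash_map_inverse d X x"
    using bspec[OF smooth[unfolded Ck_into_on_def] p] by (elim exE conjE) (rule that)
  obtain V \<phi> W where at: "(V, \<phi>) \<in> Rn_Gr_atlas d" and W: "open W" "p \<in> W" "W \<subseteq> U"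
    and FW: "F ` W \<subseteq> V" and CkF: "Ck k \<alpha> W (\<phi> \<circ> F)"
    using bspec[OF F(1)[unfolded Ck_into_def] U(2)] by blast
  obtain E where E: "E \<in> Gr d" and V: "V = UNIV \<times> Gr_chart_dom d E" and \<phi>: "\<phi> = (\<lambda>(x, L). (x, Gr_chart E L))"
    using at unfolding Rn_Gr_atlas_def by blast
  obtain P where P: "orth_projection P" "range P = E"
    using orth_projection_exists[of E] E by (auto simp: Gr_def)
  \<comment> \<open>\<open>F\<close> maps all of \<open>W\<close> into the chart domain, so
    \<open>A\<close> is of class \<open>k\<close> on an open set, as the bootstrapping requires. Its
    values have geometric meaning only at points of \<open>X\<close>.\<close>
  define A where "A x = Gr_chart E (snd (F x))" for x
  have "Ck k \<alpha> W (\<lambda>x. snd ((\<phi> \<circ> F) x))" by (rule Ck_bounded_linear_compose[OF bounded_linear_snd CkF])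
  then have CkA: "Ck k \<alpha> W A" by (simp add: A_def[abs_def] \<phi> case_prod_beta)
  have gA: "graph_map P ((*v) (A x))" "graph_space P ((*v) (A x)) = snd (F x)" if "x \<in> W" for x
  proof -
    have "snd (F x) \<in> Gr_chart_dom d E" using FW V that by auto
    then show "graph_map P ((*v) (A x))" "graph_space P ((*v) (A x)) = snd (F x)"
      unfolding A_def by (rule graph_space_Gr_chart[OF P E])+
  qed
  have contA: "continuous_on W (\<lambda>x. A x *v v)" for v
    by (rule bounded_linear.continuous_on[OF bounded_linear_matrix_apply Ck_continuous_on[OF CkA \<alpha>(1)]])
  have RX: "Reg1 X \<subseteq> X" by (auto simp: Reg1_def)
  \<comment> \<open>At regular points \<open>A\<close> represents the tangent space; continuity
    extends this to the limits that form \<open>cone_C4\<close>, and the equality of cones transfers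
    it to secants.\<close>
  have C3: "cone_C3 X q = graph_space P ((*v) (A q))" if q: "q \<in> X \<inter> W" for q
  proof -
    have "cone_C4 X q = graph_space P ((*v) (A q))"
    proof (rule cone_C4_eq_graph_space[OF P(1) W(1)])
      show "q \<in> W" "q \<in> X" using q by auto
      then show "q \<in> closure (Reg1 X)" using Reg1_dense[OF homeo] by blast
      show "graph_map P ((*v) (A x))" if "x \<in> X \<inter> W" for x using gA(1) that by blast
      show "continuous_on (X \<inter> W) (\<lambda>x. A x *v v)" for v using contA continuous_on_subset by blast
      show "tangent_space X x = graph_space P ((*v) (A x))" if "x \<in> Reg1 X \<inter> W" for x
      proof -
        have "F x = (x, tangent_space X x)"
          using F(2)[rule_format, of x] Nash_map_inverse_Reg1[OF homeo, of x] that RX W(3) by auto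
        then show ?thesis using gA(2)[of x] that by simp
      qed
    qed
    then show ?thesis using C34 q by simp
  qed
  obtain h U' V' where U': "open U'" "p \<in> U'" "open V'" "\<And>x. h (P x) = h x" "\<And>x. P x \<in> V' \<longleftrightarrow> x \<in> V'"
    "\<And>x. x \<in> V' \<Longrightarrow> P (h x) = 0" "X \<inter> U' = {x \<in> V'. x = P x + h x}" "\<And>x. x \<in> V' \<Longrightarrow> P x + h x \<in> W"
    "\<And>x. x \<in> V' \<Longrightarrow> (h has_derivative (*v) (A (P x + h x))) (at x)"
    by (rule graph_of_tangent_cones[OF P(1) W(1,2) p gA(1) contA C3 lc LNE[OF p]]) blast+
  have "Ck (Suc k) \<alpha> V' h"
    by (rule Ck_bootstrap[OF orth_projectionD(4)[OF P(1)] U'(3) W(1) CkA \<alpha> U'(8,9)])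
  then have "Ck_graph (Suc k) \<alpha> P V' h (X \<inter> U')"
    unfolding Ck_graph_def using U' by blast
  moreover have "dim (range P) = d" using P(2) E by (simp add: Gr_def)
  ultimately show "submanifold_near d (Suc k) \<alpha> X p"
    using Ck_graph_imp_submanifold_near[OF P(1) _ U'(1,2) _ \<alpha>] by blast
qed

theorem corollary3p16:
  fixes S :: "nat \<Rightarrow> (nat \<Rightarrow> real) set set"
    and X :: "(real ^ 'n::finite) set"
    and d k :: nat
    and \<alpha> :: real
  assumes "o_minimal_structure S"
    and "locally_definable S X"
    and "pure_dimensional S d X"
    and "locally_closed_set X"
    and "0 \<le> \<alpha>" and "\<alpha> \<le> 1"
  shows "smooth_set d (k + 1) \<alpha> X \<longleftrightarrow>
    (Nash_map_homeomorphism d X \<and> Ck_into_on (Rn_Gr_atlas d) k \<alpha> X (Nash_map_inverse d X)) \<and>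
    (\<forall>p\<in>X. LNE_at X p) \<and>
    (\<forall>p\<in>X. cone_C3 X p = cone_C4 X p)"
  using smooth_set_imp_conditions[of d k \<alpha> X] conditions_imp_smooth_set[of X d k \<alpha>] assms(4-6)
  unfolding Suc_eq_plus1 by blast

end
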